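(* Let $D$ be an inhabited algebraic dcpo with basis of compact elements $B_D$ and let $E$ be a pointed bounded complete algebraic dcpo with basis of compact elements $B_E$. Let $B$ be the set of all $\bigsqcup S$, where $S$ is a bounded (in $E^D$) Kuratowski finite subset of single-step functions of the form $(a\Rightarrow b)$ with $a\in B_D$ and $b\in B_E$. Then the exponential $E^D$ is algebraic and $B$ is its basis of compact elements. Moreover, if for every $b\in B_E$ it is decidable whether $b=\bot$, then for every $f\in B$ it is decidable whether $f=\bot$. Finally, if for every $a,b\in B_D$ it is decidable whether $a\sqsubseteq b$ and for every $a,b\in B_E$ it is decidable whether $a\sqsubseteq b$ (equivalently, these conditions with $\ll$ in place of $\sqsubseteq$), then for every $f,g\in B$ it is decidable whether $f\sqsubseteq g$, and for every $f,g\in B$ it is decidable whether $f\ll g$.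
   Context: Everything is constructive: neither excluded middle nor choice is assumed. A proposition $P$ is decidable if $P\vee\lnot P$ holds. A subset $S$ of a poset is semidirected if any two elements of $S$ have an upper bound in $S$, and directed if moreover it is inhabited. A dcpo is a poset $(D,\sqsubseteq)$ in which every directed subset $S$ has a supremum $\bigsqcup S$; it is pointed if it has a least element $\bot$ (then all semidirected subsets have suprema). Write $x\ll y$ if for every directed $S$ with $y\sqsubseteq\bigsqcup S$ there is $s\in S$ with $x\sqsubseteq s$; $c$ is compact if $c\ll c$. $D$ is algebraic if for every $x\in D$ the set $\{c\in D\mid c\sqsubseteq x,\ c\text{ compact}\}$ is directed with supremum $x$; its basis of compact elements is the set of all compact elements. A subset of a poset is bounded if it has an upper bound; a poset is bounded complete if every bounded subset has a supremum. A set $X$ is Kuratowski finite if there is a surjection $\{0,\dots,n-1\}\to X$ for some $n\in\mathbb N$. A function between dcpos is Scott continuous if it preserves directed suprema. The exponential $E^D$ is the dcpo of Scott continuous functions $D\to E$ with the pointwise order and pointwise directed suprema. For $x\in D$ and $y\in E$ ($E$ pointed), the single-step function $(x\Rightarrow y)\colon D\to E$ is $(x\Rightarrow y)(d)=\bigsqcup\{y\mid x\sqsubseteq d\}$, where $\{y\mid x\sqsubseteq d\}$ is the (semidirected) set whose elements are those $w$ with $w=y$ and $x\sqsubseteq d$ true; it is Scott continuous when $x$ is compact. *)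

theory Defs
  imports "HOL-Library.Extended_Nat"
begin

text \<open>
  In HOL itself every proposition satisfies \<open>P \<or> \<not> P\<close>, so constructive statements about
  decidability are interpreted here in Heyting-valued higher-order logic (the internal logic
  of the topos of sets valued in a complete Heyting algebra, equivalently of sheaves on a
  locale).  A proposition is an element of an arbitrary complete Heyting algebra \<open>'h\<close>, a
  predicate on \<open>'a\<close> is a function \<open>'a \<Rightarrow> 'h\<close>, and connectives and quantifiers are the
  Heyting algebra operations.  Neither excluded middle nor choice is valid in general.
\<close>

section \<open>Heyting-valued logic\<close>

class complete_heyting_algebra = complete_lattice +
  assumes inf_Sup_le: "inf a (Sup B) \<le> Sup (inf a ` B)"

instance bool :: complete_heyting_algebra
  by standard auto

instance enat :: complete_heyting_algebra
  by standard (simp add: inf_Sup)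

abbreviation Conj :: "'h::complete_heyting_algebra \<Rightarrow> 'h \<Rightarrow> 'h"  (infixr "\<^bold>\<and>" 35)
  where "\<phi> \<^bold>\<and> \<psi> \<equiv> inf \<phi> \<psi>"

abbreviation Disj :: "'h::complete_heyting_algebra \<Rightarrow> 'h \<Rightarrow> 'h"  (infixr "\<^bold>\<or>" 30)
  where "\<phi> \<^bold>\<or> \<psi> \<equiv> sup \<phi> \<psi>"

definition Imp :: "'h::complete_heyting_algebra \<Rightarrow> 'h \<Rightarrow> 'h"  (infixr "\<^bold>\<longrightarrow>" 25)
  where "(\<phi> \<^bold>\<longrightarrow> \<psi>) = Sup {\<theta>. inf \<theta> \<phi> \<le> \<psi>}"

abbreviation Iff :: "'h::complete_heyting_algebra \<Rightarrow> 'h \<Rightarrow> 'h"  (infixr "\<^bold>\<longleftrightarrow>" 25)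
  where "(\<phi> \<^bold>\<longleftrightarrow> \<psi>) \<equiv> (\<phi> \<^bold>\<longrightarrow> \<psi>) \<^bold>\<and> (\<psi> \<^bold>\<longrightarrow> \<phi>)"

abbreviation Neg :: "'h::complete_heyting_algebra \<Rightarrow> 'h"  ("\<^bold>\<not> _" [40] 40)
  where "\<^bold>\<not> \<phi> \<equiv> (\<phi> \<^bold>\<longrightarrow> bot)"

abbreviation Forall :: "('a \<Rightarrow> 'h::complete_heyting_algebra) \<Rightarrow> 'h"  (binder "\<^bold>\<forall>" 10)
  where "Forall \<Phi> \<equiv> Inf (range \<Phi>)"

abbreviation Exists :: "('a \<Rightarrow> 'h::complete_heyting_algebra) \<Rightarrow> 'h"  (binder "\<^bold>\<exists>" 10)
  where "Exists \<Phi> \<equiv> Sup (range \<Phi>)"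

definition valid :: "'h::complete_heyting_algebra \<Rightarrow> bool"
  where "valid \<phi> \<longleftrightarrow> \<phi> = top"

definition decidable :: "'h::complete_heyting_algebra \<Rightarrow> 'h"
  where "decidable \<phi> = (\<phi> \<^bold>\<or> \<^bold>\<not> \<phi>)"

lemma le_Imp_iff: "\<theta> \<le> (\<phi> \<^bold>\<longrightarrow> \<psi>) \<longleftrightarrow> inf \<theta> \<phi> \<le> \<psi>"
proof
  have "inf (\<phi> \<^bold>\<longrightarrow> \<psi>) \<phi> \<le> Sup (inf \<phi> ` {\<theta>. inf \<theta> \<phi> \<le> \<psi>})"
    unfolding Imp_def by (subst inf.commute) (rule inf_Sup_le)
  also have "\<dots> \<le> \<psi>"
    by (rule Sup_least) (auto simp: inf.commute)
  finally have "inf (\<phi> \<^bold>\<longrightarrow> \<psi>) \<phi> \<le> \<psi>" .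
  then show "inf \<theta> \<phi> \<le> \<psi>" if "\<theta> \<le> (\<phi> \<^bold>\<longrightarrow> \<psi>)"
    using that by (meson inf_mono order_refl order_trans)
  show "\<theta> \<le> (\<phi> \<^bold>\<longrightarrow> \<psi>)" if "inf \<theta> \<phi> \<le> \<psi>"
    unfolding Imp_def using that by (auto intro: Sup_upper)
qed

text \<open>
  For \<open>'h = bool\<close> this is classical logic; already on the chain \<open>enat\<close>, excluded middle fails.
\<close>

lemma Imp_bool: "(\<phi> \<^bold>\<longrightarrow> \<psi>) = (\<phi> \<longrightarrow> \<psi>)" for \<phi> \<psi> :: bool
  using le_Imp_iff[of True \<phi> \<psi>] by auto

lemma not_valid_decidable: "\<not> valid (decidable (1 :: enat))"
proof -
  have "(1 \<^bold>\<longrightarrow> bot) = (0 :: enat)"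
    using le_Imp_iff[of "1 \<^bold>\<longrightarrow> bot" 1 "bot :: enat"]
    by (auto simp: bot_enat_def inf_enat_def min_def split: if_splits)
  then show ?thesis
    by (simp add: valid_def decidable_def sup_enat_def top_enat_def)
qed

section \<open>Sets, subsets and functions\<close>

text \<open>
  A Heyting-valued set is a type with a Heyting-valued equality that is symmetric and
  transitive but not necessarily reflexive: \<open>E x x\<close> is the truth value of ``\<open>x\<close> is an element
  of the set''.  Subsets and functions are arbitrary \<open>'h\<close>-valued predicates and relations
  about which the internal statements \<open>is_subset\<close> and \<open>is_function\<close> hold; quantifying over
  the power set or a function set is quantifying over all of them, relativised to that
  truth value.
\<close>

definition is_set :: "('a \<Rightarrow> 'a \<Rightarrow> 'h::complete_heyting_algebra) \<Rightarrow> 'h" where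
  "is_set E =
     ((\<^bold>\<forall>x y. E x y \<^bold>\<longrightarrow> E y x) \<^bold>\<and>
      (\<^bold>\<forall>x y z. E x y \<^bold>\<and> E y z \<^bold>\<longrightarrow> E x z))"

definition is_subset ::
  "('a \<Rightarrow> 'a \<Rightarrow> 'h::complete_heyting_algebra) \<Rightarrow> ('a \<Rightarrow> 'h) \<Rightarrow> 'h" where
  "is_subset E S =
     ((\<^bold>\<forall>x. S x \<^bold>\<longrightarrow> E x x) \<^bold>\<and>
      (\<^bold>\<forall>x y. S x \<^bold>\<and> E x y \<^bold>\<longrightarrow> S y))"

text \<open>A function is given by its graph.\<close>

definition is_function ::
  "('a \<Rightarrow> 'a \<Rightarrow> 'h::complete_heyting_algebra) \<Rightarrow> ('b \<Rightarrow> 'b \<Rightarrow> 'h) \<Rightarrow> ('a \<Rightarrow> 'b \<Rightarrow> 'h) \<Rightarrow> 'h" where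
  "is_function E E' F =
     ((\<^bold>\<forall>x y. F x y \<^bold>\<longrightarrow> E x x \<^bold>\<and> E' y y) \<^bold>\<and>
      (\<^bold>\<forall>x x' y y'. F x y \<^bold>\<and> E x x' \<^bold>\<and> E' y y' \<^bold>\<longrightarrow> F x' y') \<^bold>\<and>
      (\<^bold>\<forall>x y y'. F x y \<^bold>\<and> F x y' \<^bold>\<longrightarrow> E' y y') \<^bold>\<and>
      (\<^bold>\<forall>x. E x x \<^bold>\<longrightarrow> (\<^bold>\<exists>y. F x y)))"

text \<open>
  The natural numbers object of Heyting-valued sets is \<open>nat\<close> with two-valued equality, so an
  internal existential over it is a supremum over \<open>nat\<close>, and \<open>fin_eq n\<close> is the
  set \<open>{0, \<dots>, n - 1}\<close>.
\<close>

definition fin_eq :: "nat \<Rightarrow> nat \<Rightarrow> nat \<Rightarrow> 'h::complete_heyting_algebra" where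
  "fin_eq n i j = (if i < n \<and> i = j then top else bot)"

definition kuratowski_finite ::
  "('a \<Rightarrow> 'a \<Rightarrow> 'h::complete_heyting_algebra) \<Rightarrow> ('a \<Rightarrow> 'h) \<Rightarrow> 'h" where
  "kuratowski_finite E S =
     (\<^bold>\<exists>n. \<^bold>\<exists>F. is_function (fin_eq n) (\<lambda>x y. S x \<^bold>\<and> E x y) F \<^bold>\<and>
        (\<^bold>\<forall>x. S x \<^bold>\<longrightarrow> (\<^bold>\<exists>i. F i x)))"

section \<open>Posets and dcpos\<close>

record ('a, 'h) hposet =
  eq :: "'a \<Rightarrow> 'a \<Rightarrow> 'h"  (infix "\<doteq>\<index>" 50)
  le :: "'a \<Rightarrow> 'a \<Rightarrow> 'h"  (infix "\<sqsubseteq>\<index>" 50)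

abbreviation mem :: "'a \<Rightarrow> ('a, 'h::complete_heyting_algebra) hposet \<Rightarrow> 'h"  (infix "\<^bold>\<in>" 50)
  where "x \<^bold>\<in> D \<equiv> x \<doteq>\<^bsub>D\<^esub> x"

definition poset :: "('a, 'h::complete_heyting_algebra) hposet \<Rightarrow> 'h" where
  "poset D =
     (is_set (eq D) \<^bold>\<and>
      (\<^bold>\<forall>x y. x \<sqsubseteq>\<^bsub>D\<^esub> y \<^bold>\<longrightarrow> x \<^bold>\<in> D \<^bold>\<and> y \<^bold>\<in> D) \<^bold>\<and>
      (\<^bold>\<forall>x x' y y'. x \<sqsubseteq>\<^bsub>D\<^esub> y \<^bold>\<and> x \<doteq>\<^bsub>D\<^esub> x' \<^bold>\<and> y \<doteq>\<^bsub>D\<^esub> y' \<^bold>\<longrightarrow> x' \<sqsubseteq>\<^bsub>D\<^esub> y') \<^bold>\<and>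
      (\<^bold>\<forall>x. x \<^bold>\<in> D \<^bold>\<longrightarrow> x \<sqsubseteq>\<^bsub>D\<^esub> x) \<^bold>\<and>
      (\<^bold>\<forall>x y z. x \<sqsubseteq>\<^bsub>D\<^esub> y \<^bold>\<and> y \<sqsubseteq>\<^bsub>D\<^esub> z \<^bold>\<longrightarrow> x \<sqsubseteq>\<^bsub>D\<^esub> z) \<^bold>\<and>
      (\<^bold>\<forall>x y. x \<sqsubseteq>\<^bsub>D\<^esub> y \<^bold>\<and> y \<sqsubseteq>\<^bsub>D\<^esub> x \<^bold>\<longrightarrow> x \<doteq>\<^bsub>D\<^esub> y))"

definition inhabited :: "('a, 'h::complete_heyting_algebra) hposet \<Rightarrow> 'h" where
  "inhabited D = (\<^bold>\<exists>x. x \<^bold>\<in> D)"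

definition is_ub :: "('a, 'h::complete_heyting_algebra) hposet \<Rightarrow> ('a \<Rightarrow> 'h) \<Rightarrow> 'a \<Rightarrow> 'h" where
  "is_ub D S u = (u \<^bold>\<in> D \<^bold>\<and> (\<^bold>\<forall>x. S x \<^bold>\<longrightarrow> x \<sqsubseteq>\<^bsub>D\<^esub> u))"

definition is_sup :: "('a, 'h::complete_heyting_algebra) hposet \<Rightarrow> ('a \<Rightarrow> 'h) \<Rightarrow> 'a \<Rightarrow> 'h" where
  "is_sup D S z = (is_ub D S z \<^bold>\<and> (\<^bold>\<forall>u. is_ub D S u \<^bold>\<longrightarrow> z \<sqsubseteq>\<^bsub>D\<^esub> u))"

definition is_bounded :: "('a, 'h::complete_heyting_algebra) hposet \<Rightarrow> ('a \<Rightarrow> 'h) \<Rightarrow> 'h" where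
  "is_bounded D S = (\<^bold>\<exists>u. is_ub D S u)"

definition semidirected :: "('a, 'h::complete_heyting_algebra) hposet \<Rightarrow> ('a \<Rightarrow> 'h) \<Rightarrow> 'h" where
  "semidirected D S =
     (is_subset (eq D) S \<^bold>\<and>
      (\<^bold>\<forall>x y. S x \<^bold>\<and> S y \<^bold>\<longrightarrow> (\<^bold>\<exists>z. S z \<^bold>\<and> x \<sqsubseteq>\<^bsub>D\<^esub> z \<^bold>\<and> y \<sqsubseteq>\<^bsub>D\<^esub> z)))"

definition directed :: "('a, 'h::complete_heyting_algebra) hposet \<Rightarrow> ('a \<Rightarrow> 'h) \<Rightarrow> 'h" where
  "directed D S = (semidirected D S \<^bold>\<and> (\<^bold>\<exists>x. S x))"

definition dcpo :: "('a, 'h::complete_heyting_algebra) hposet \<Rightarrow> 'h" where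
  "dcpo D = (poset D \<^bold>\<and> (\<^bold>\<forall>S. directed D S \<^bold>\<longrightarrow> (\<^bold>\<exists>z. is_sup D S z)))"

definition is_least :: "('a, 'h::complete_heyting_algebra) hposet \<Rightarrow> 'a \<Rightarrow> 'h" where
  "is_least D z = (z \<^bold>\<in> D \<^bold>\<and> (\<^bold>\<forall>x. x \<^bold>\<in> D \<^bold>\<longrightarrow> z \<sqsubseteq>\<^bsub>D\<^esub> x))"

definition pointed :: "('a, 'h::complete_heyting_algebra) hposet \<Rightarrow> 'h" where
  "pointed D = (\<^bold>\<exists>z. is_least D z)"

definition eq_bot :: "('a, 'h::complete_heyting_algebra) hposet \<Rightarrow> 'a \<Rightarrow> 'h" where
  "eq_bot D x = (\<^bold>\<exists>z. is_least D z \<^bold>\<and> x \<doteq>\<^bsub>D\<^esub> z)"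

definition bounded_complete :: "('a, 'h::complete_heyting_algebra) hposet \<Rightarrow> 'h" where
  "bounded_complete D =
     (poset D \<^bold>\<and>
      (\<^bold>\<forall>S. is_subset (eq D) S \<^bold>\<and> is_bounded D S \<^bold>\<longrightarrow> (\<^bold>\<exists>z. is_sup D S z)))"

definition way_below :: "('a, 'h::complete_heyting_algebra) hposet \<Rightarrow> 'a \<Rightarrow> 'a \<Rightarrow> 'h" where
  "way_below D x y =
     (x \<^bold>\<in> D \<^bold>\<and> y \<^bold>\<in> D \<^bold>\<and>
      (\<^bold>\<forall>S z. directed D S \<^bold>\<and> is_sup D S z \<^bold>\<and> y \<sqsubseteq>\<^bsub>D\<^esub> z \<^bold>\<longrightarrow>
         (\<^bold>\<exists>s. S s \<^bold>\<and> x \<sqsubseteq>\<^bsub>D\<^esub> s)))"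

definition is_compact :: "('a, 'h::complete_heyting_algebra) hposet \<Rightarrow> 'a \<Rightarrow> 'h" where
  "is_compact D c = way_below D c c"

definition algebraic_dcpo :: "('a, 'h::complete_heyting_algebra) hposet \<Rightarrow> 'h" where
  "algebraic_dcpo D =
     (dcpo D \<^bold>\<and>
      (\<^bold>\<forall>x. x \<^bold>\<in> D \<^bold>\<longrightarrow>
         directed D (\<lambda>c. is_compact D c \<^bold>\<and> c \<sqsubseteq>\<^bsub>D\<^esub> x) \<^bold>\<and>
         is_sup D (\<lambda>c. is_compact D c \<^bold>\<and> c \<sqsubseteq>\<^bsub>D\<^esub> x) x))"

section \<open>Exponentials and step functions\<close>

definition scott_continuous ::
  "('a, 'h::complete_heyting_algebra) hposet \<Rightarrow> ('b, 'h) hposet \<Rightarrow> ('a \<Rightarrow> 'b \<Rightarrow> 'h) \<Rightarrow> 'h" where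
  "scott_continuous D E F =
     (is_function (eq D) (eq E) F \<^bold>\<and>
      (\<^bold>\<forall>S z y. directed D S \<^bold>\<and> is_sup D S z \<^bold>\<and> F z y \<^bold>\<longrightarrow>
         is_sup E (\<lambda>w. \<^bold>\<exists>x. S x \<^bold>\<and> F x w) y))"

definition exponential ::
  "('a, 'h::complete_heyting_algebra) hposet \<Rightarrow> ('b, 'h) hposet \<Rightarrow> ('a \<Rightarrow> 'b \<Rightarrow> 'h, 'h) hposet" where
  "exponential D E =
     \<lparr> eq = \<lambda>F G. scott_continuous D E F \<^bold>\<and> scott_continuous D E G \<^bold>\<and>
              (\<^bold>\<forall>x y. F x y \<^bold>\<longleftrightarrow> G x y),
       le = \<lambda>F G. scott_continuous D E F \<^bold>\<and> scott_continuous D E G \<^bold>\<and>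
              (\<^bold>\<forall>x y y'. F x y \<^bold>\<and> G x y' \<^bold>\<longrightarrow> y \<sqsubseteq>\<^bsub>E\<^esub> y') \<rparr>"

text \<open>
  \<open>step D E a b d y\<close> is the truth value of \<open>(a \<Rightarrow> b)(d) = y\<close>.  The set whose supremum is
  taken has \<open>b\<close> as its only possible element, and has it to the extent that \<open>a \<sqsubseteq> d\<close> holds.
\<close>

definition step ::
  "('a, 'h::complete_heyting_algebra) hposet \<Rightarrow> ('b, 'h) hposet \<Rightarrow> 'a \<Rightarrow> 'b \<Rightarrow> 'a \<Rightarrow> 'b \<Rightarrow> 'h" where
  "step D E a b = (\<lambda>d y. d \<^bold>\<in> D \<^bold>\<and> is_sup E (\<lambda>w. w \<doteq>\<^bsub>E\<^esub> b \<^bold>\<and> a \<sqsubseteq>\<^bsub>D\<^esub> d) y)"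

definition step_family ::
  "('a, 'h::complete_heyting_algebra) hposet \<Rightarrow> ('b, 'h) hposet \<Rightarrow> (('a \<Rightarrow> 'b \<Rightarrow> 'h) \<Rightarrow> 'h) \<Rightarrow> 'h" where
  "step_family D E S =
     (is_subset (eq (exponential D E)) S \<^bold>\<and>
      is_bounded (exponential D E) S \<^bold>\<and>
      kuratowski_finite (eq (exponential D E)) S \<^bold>\<and>
      (\<^bold>\<forall>s. S s \<^bold>\<longrightarrow>
         (\<^bold>\<exists>a b. is_compact D a \<^bold>\<and> is_compact E b \<^bold>\<and> s \<doteq>\<^bsub>exponential D E\<^esub> step D E a b)))"

definition step_basis ::
  "('a, 'h::complete_heyting_algebra) hposet \<Rightarrow> ('b, 'h) hposet \<Rightarrow> ('a \<Rightarrow> 'b \<Rightarrow> 'h) \<Rightarrow> 'h" where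
  "step_basis D E f = (\<^bold>\<exists>S. step_family D E S \<^bold>\<and> is_sup (exponential D E) S f)"

end

theory Submission
  imports Defs
begin

text \<open>
  Suprema in the exponential are computed pointwise, so it is a bounded complete dcpo.  For
  compact \<open>a\<close>, \<open>(a \<Rightarrow> b) \<sqsubseteq> f\<close> holds iff \<open>b \<sqsubseteq> f(a)\<close>; hence step functions of compact elements
  are compact, and every \<open>f\<close> is the supremum of those below it.  In any bounded complete dcpo
  with such a generating set of compact elements, the bounded finite suprema of generators below
  \<open>x\<close> form a directed set with supremum \<open>x\<close>; so they are exactly the compact elements.  A
  comparison \<open>\<Squnion>S \<sqsubseteq> g\<close> with \<open>S\<close> finite is a finite conjunction of comparisons \<open>b \<sqsubseteq> g(a)\<close>, and
  \<open>g(a)\<close> is compact if \<open>\<sqsubseteq>\<close> is decidable on compact elements of \<open>D\<close>.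
\<close>

section \<open>Forcing\<close>

text \<open>Two features of the setting shape the proof. A function is a total single-valued
  relation, so a value of \<open>f\<close> at \<open>a\<close> is at hand only after passing to a
  smaller stage; pointwise arguments begin by eliminating a totality statement. And
  \<open>(a \<Rightarrow> b)(d)\<close> cannot be found by asking whether
  \<open>a \<sqsubseteq> d\<close>: it is the supremum of a set with at most one element and is
  handled through its universal property. Kuratowski finiteness likewise yields a list of elements
  only locally, which is enough because the goals are forced propositions. The passage from
  generators to a basis never looks at functions, hence its treatment for an abstract poset. The
  generators below \<open>x\<close> need not be directed; closing them under bounded finite suprema
  repairs this, and the empty supremum provides the inhabitant that directedness asks for.
  Compactness of \<open>g(a)\<close> matters because the hypothesis on \<open>E\<close> decides
  comparisons between compact elements, and \<open>b \<sqsubseteq> g(a)\<close> becomes such a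
  comparison once \<open>g(a)\<close> is known to be compact.\<close>

text \<open>
  The fixed \<open>h\<close> carries the standing hypotheses and \<open>q\<close> is the current stage, so that facts
  implied by \<open>h\<close> hold at every stage.  Eliminating an existential or a disjunction passes to a
  smaller stage.
\<close>

locale heyting_context =
  fixes h :: "'h::complete_heyting_algebra"
begin

text \<open>This is Kripke-Joyal semantics with the elements of the algebra as stages: connectives
  of the algebra turn into connectives of HOL, relativised to smaller stages where needed, and
  internal arguments become ordinary natural deduction.\<close>

definition forces :: "'h \<Rightarrow> 'h \<Rightarrow> bool"  (infix "\<tturnstile>" 45)
  where "q \<tturnstile> \<phi> \<longleftrightarrow> inf h q \<le> \<phi>"

lemma forces_mono: "r \<le> q \<Longrightarrow> q \<tturnstile> \<phi> \<Longrightarrow> r \<tturnstile> \<phi>"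
  unfolding forces_def by (rule order_trans[OF inf_mono[OF order_refl]])

lemma forces_if_le: "h \<le> \<phi> \<Longrightarrow> q \<tturnstile> \<phi>"
  unfolding forces_def by (meson inf_le1 order_trans)

lemma forces_top [simp]: "q \<tturnstile> top"
  by (simp add: forces_def)

lemma forces_botE: "q \<tturnstile> bot \<Longrightarrow> q \<tturnstile> \<chi>"
  unfolding forces_def by (meson bot_least order_trans)

lemma forces_conj [simp]: "q \<tturnstile> (\<phi> \<^bold>\<and> \<psi>) \<longleftrightarrow> q \<tturnstile> \<phi> \<and> q \<tturnstile> \<psi>"
  by (simp add: forces_def)

lemma forces_all [simp]: "q \<tturnstile> (INF x\<in>A. \<Phi> x) \<longleftrightarrow> (\<forall>x\<in>A. q \<tturnstile> \<Phi> x)"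
  by (simp add: forces_def le_INF_iff)

lemma forces_imp [simp]: "q \<tturnstile> (\<phi> \<^bold>\<longrightarrow> \<psi>) \<longleftrightarrow> (\<forall>r\<le>q. r \<tturnstile> \<phi> \<longrightarrow> r \<tturnstile> \<psi>)"
proof
  assume "q \<tturnstile> (\<phi> \<^bold>\<longrightarrow> \<psi>)"
  then have *: "inf (inf h q) \<phi> \<le> \<psi>"
    by (simp add: forces_def le_Imp_iff)
  show "\<forall>r\<le>q. r \<tturnstile> \<phi> \<longrightarrow> r \<tturnstile> \<psi>"
  proof (intro allI impI)
    fix r assume "r \<le> q" and "r \<tturnstile> \<phi>"
    then have "inf h r \<le> inf (inf h q) \<phi>"
      by (simp add: forces_def le_infI2)
    then show "r \<tturnstile> \<psi>"
      unfolding forces_def using * by (rule order_trans)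
  qed
next
  assume *: "\<forall>r\<le>q. r \<tturnstile> \<phi> \<longrightarrow> r \<tturnstile> \<psi>"
  \<comment> \<open>This is the generic smaller stage at which \<open>\<phi>\<close> holds; what is
    forced there determines the implication.\<close>
  have "inf q \<phi> \<tturnstile> \<psi>"
    using * by (simp add: forces_def le_infI2)
  then show "q \<tturnstile> (\<phi> \<^bold>\<longrightarrow> \<psi>)"
    by (simp add: forces_def le_Imp_iff inf.assoc)
qed

lemmas forces_simps = forces_conj forces_all forces_imp

lemma forces_bexI: "q \<tturnstile> \<Phi> x \<Longrightarrow> x \<in> A \<Longrightarrow> q \<tturnstile> (SUP x\<in>A. \<Phi> x)"
  unfolding forces_def by (meson SUP_upper order_trans)

lemma forces_exI: "q \<tturnstile> \<Phi> x \<Longrightarrow> q \<tturnstile> (\<^bold>\<exists>x. \<Phi> x)"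
  by (rule forces_bexI) simp_all

text \<open>Distributivity of \<open>inf\<close> over \<open>Sup\<close> splits the goal by
  witnesses, and \<open>x\<close> is a witness at stage \<open>inf q (\<Phi> x)\<close>. The stage
  varies with the witness, hence the premise for all \<open>r \<le> q\<close>. An index set covers
  quantifiers, disjunctions and finite enumerations alike.\<close>

lemma forces_bexE:
  assumes ex: "q \<tturnstile> (SUP x\<in>A. \<Phi> x)"
    and step: "\<And>r x. r \<le> q \<Longrightarrow> x \<in> A \<Longrightarrow> r \<tturnstile> \<Phi> x \<Longrightarrow> r \<tturnstile> \<chi>"
  shows "q \<tturnstile> \<chi>"
proof -
  have "inf h q \<le> inf (inf h q) (SUP x\<in>A. \<Phi> x)"
    using ex by (simp add: forces_def)
  also have "\<dots> \<le> (SUP x\<in>A. inf (inf h q) (\<Phi> x))"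
    using inf_Sup_le[of "inf h q" "\<Phi> ` A"] by (simp add: image_image)
  also have "\<dots> \<le> \<chi>"
  proof (rule SUP_least)
    fix x assume "x \<in> A"
    then have "inf q (\<Phi> x) \<tturnstile> \<chi>"
      by (rule step[rotated]) (simp_all add: forces_def le_infI2)
    then show "inf (inf h q) (\<Phi> x) \<le> \<chi>"
      by (simp add: forces_def inf.assoc)
  qed
  finally show ?thesis
    by (simp add: forces_def)
qed

lemma forces_exE:
  assumes "q \<tturnstile> (\<^bold>\<exists>x. \<Phi> x)" and "\<And>r x. r \<le> q \<Longrightarrow> r \<tturnstile> \<Phi> x \<Longrightarrow> r \<tturnstile> \<chi>"
  shows "q \<tturnstile> \<chi>"
  using assms(1) by (rule forces_bexE) (rule assms(2))

lemma forces_disjI1: "q \<tturnstile> \<phi> \<Longrightarrow> q \<tturnstile> (\<phi> \<^bold>\<or> \<psi>)"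
  by (simp add: forces_def le_supI1)

lemma forces_disjI2: "q \<tturnstile> \<psi> \<Longrightarrow> q \<tturnstile> (\<phi> \<^bold>\<or> \<psi>)"
  by (simp add: forces_def le_supI2)

lemma forces_disjE:
  assumes "q \<tturnstile> (\<phi> \<^bold>\<or> \<psi>)" and "\<And>r. r \<le> q \<Longrightarrow> r \<tturnstile> \<phi> \<Longrightarrow> r \<tturnstile> \<chi>"
    and "\<And>r. r \<le> q \<Longrightarrow> r \<tturnstile> \<psi> \<Longrightarrow> r \<tturnstile> \<chi>"
  shows "q \<tturnstile> \<chi>"
proof (rule forces_bexE)
  \<comment> \<open>A disjunction is an existential over a two-element index set.\<close>
  show "q \<tturnstile> (SUP x\<in>{\<phi>, \<psi>}. x)"
    using assms(1) by simp
qed (use assms(2,3) in auto)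

section \<open>Finite choice and decidable propositions\<close>

text \<open>Choice over a finite index set of the metalogic needs no axiom: each witness costs one
  passage to a smaller stage, and there are finitely many. The goal has to be a forced proposition,
  since the stage \<open>r\<close> that carries the choice function is only one piece of
  \<open>q\<close>.\<close>

lemma forces_finite_choice:
  assumes "finite X" and "\<And>x. x \<in> X \<Longrightarrow> q \<tturnstile> (\<^bold>\<exists>y. \<Phi> x y)"
    and "\<And>r f. r \<le> q \<Longrightarrow> (\<And>x. x \<in> X \<Longrightarrow> r \<tturnstile> \<Phi> x (f x)) \<Longrightarrow> r \<tturnstile> \<chi>"
  shows "q \<tturnstile> \<chi>"
  using assms
proof (induction X arbitrary: q rule: finite_induct)
  case empty
  then show ?case by blast
next
  case (insert a X)
  have "q \<tturnstile> (\<^bold>\<exists>y. \<Phi> a y)"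
    using insert.prems(1) by blast
  then show ?case
  proof (rule forces_exE)
    fix r b assume r: "r \<le> q" and b: "r \<tturnstile> \<Phi> a b"
    show "r \<tturnstile> \<chi>"
    proof (rule insert.IH)
      show "r \<tturnstile> (\<^bold>\<exists>y. \<Phi> x y)" if "x \<in> X" for x
        using insert.prems(1) that by (blast intro: forces_mono[OF r])
      fix s f assume s: "s \<le> r" and f: "\<And>x. x \<in> X \<Longrightarrow> s \<tturnstile> \<Phi> x (f x)"
      show "s \<tturnstile> \<chi>"
      proof (rule insert.prems(2))
        show "s \<le> q" using s r by (rule order_trans)
        show "s \<tturnstile> \<Phi> x ((f(a := b)) x)" if "x \<in> insert a X" for x
          using that f forces_mono[OF s b] by auto
      qed
    qed
  qed
qed

lemma forces_decidableE:
  assumes "q \<tturnstile> decidable \<phi>" and "\<And>r. r \<le> q \<Longrightarrow> r \<tturnstile> \<phi> \<Longrightarrow> r \<tturnstile> \<chi>"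
    and "\<And>r. r \<le> q \<Longrightarrow> r \<tturnstile> (\<^bold>\<not> \<phi>) \<Longrightarrow> r \<tturnstile> \<chi>"
  shows "q \<tturnstile> \<chi>"
  using assms unfolding decidable_def by (rule forces_disjE)

text \<open>Agreement at all smaller stages, rather than at \<open>q\<close> alone, is internal
  equivalence; this is why a negation transfers as well.\<close>

lemma forces_decidable_cong:
  assumes "\<And>r. r \<le> q \<Longrightarrow> r \<tturnstile> \<phi> \<longleftrightarrow> r \<tturnstile> \<psi>" and "q \<tturnstile> decidable \<phi>"
  shows "q \<tturnstile> decidable \<psi>"
  using assms(2)
proof (rule forces_decidableE)
  fix r assume r: "r \<le> q"
  show "r \<tturnstile> decidable \<psi>" if "r \<tturnstile> \<phi>"
    using that assms(1)[OF r] by (simp add: decidable_def forces_disjI1)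
  show "r \<tturnstile> decidable \<psi>" if "r \<tturnstile> (\<^bold>\<not> \<phi>)"
    using that assms(1) r unfolding decidable_def forces_imp
    by (intro forces_disjI2) (auto dest: order_trans)
qed

text \<open>The conjuncts are decided one by one: a refuted one refutes the conjunction, and if all
  hold, so does the conjunction. Infinitely many decisions could not be combined in this
  way.\<close>

lemma forces_decidable_INF:
  assumes "finite X" and "\<And>x. x \<in> X \<Longrightarrow> q \<tturnstile> decidable (\<Phi> x)"
  shows "q \<tturnstile> decidable (INF x\<in>X. \<Phi> x)"
  using assms
proof (induction X arbitrary: q rule: finite_induct)
  case empty
  then show ?case by (simp add: decidable_def)
next
  case (insert a X)
  have "q \<tturnstile> decidable (\<Phi> a)" "q \<tturnstile> decidable (INF x\<in>X. \<Phi> x)"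
    using insert by auto
  show ?case
    using \<open>q \<tturnstile> decidable (\<Phi> a)\<close>
  proof (rule forces_decidableE)
    \<comment> \<open>Once \<open>\<Phi> a\<close> holds, the conjunction over
      \<open>insert a X\<close> agrees with the one over \<open>X\<close>.\<close>
    fix r assume r: "r \<le> q" and "r \<tturnstile> \<Phi> a"
    then show "r \<tturnstile> decidable (INF x\<in>insert a X. \<Phi> x)"
      using forces_mono[OF r \<open>q \<tturnstile> decidable (INF x\<in>X. \<Phi> x)\<close>]
      by (rule_tac forces_decidable_cong[of _ "INF x\<in>X. \<Phi> x"]) (auto intro: forces_mono)
  next
    fix r assume r: "r \<le> q" and "r \<tturnstile> (\<^bold>\<not> \<Phi> a)"
    then show "r \<tturnstile> decidable (INF x\<in>insert a X. \<Phi> x)"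
      unfolding decidable_def by (intro forces_disjI2) simp
  qed
qed

end
section \<open>Posets\<close>

text \<open>The order axioms are implied by \<open>h\<close> and so hold at every stage; they become
  HOL rules about one arbitrary stage.\<close>

locale forced_poset = heyting_context h for h :: "'h::complete_heyting_algebra" +
  fixes P :: "('a, 'h) hposet" (structure)
  assumes poset: "h \<le> poset P"
begin

lemma forces_poset: "q \<tturnstile> poset P"
  using poset by (rule forces_if_le)

lemma eq_sym: "q \<tturnstile> x \<doteq> y \<Longrightarrow> q \<tturnstile> y \<doteq> x"
  using forces_poset[of q] unfolding poset_def is_set_def forces_simps by (meson UNIV_I order_refl)

lemma eq_trans: "q \<tturnstile> x \<doteq> y \<Longrightarrow> q \<tturnstile> y \<doteq> z \<Longrightarrow> q \<tturnstile> x \<doteq> z"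
  using forces_poset[of q] unfolding poset_def is_set_def forces_simps by (meson UNIV_I order_refl)

lemma eq_memL: "q \<tturnstile> x \<doteq> y \<Longrightarrow> q \<tturnstile> x \<^bold>\<in> P"
  by (blast intro: eq_sym eq_trans)

lemma eq_memR: "q \<tturnstile> x \<doteq> y \<Longrightarrow> q \<tturnstile> y \<^bold>\<in> P"
  by (blast intro: eq_sym eq_trans)

lemma le_memL: "q \<tturnstile> x \<sqsubseteq> y \<Longrightarrow> q \<tturnstile> x \<^bold>\<in> P"
  using forces_poset[of q] unfolding poset_def is_set_def forces_simps by (meson UNIV_I order_refl)

lemma le_memR: "q \<tturnstile> x \<sqsubseteq> y \<Longrightarrow> q \<tturnstile> y \<^bold>\<in> P"
  using forces_poset[of q] unfolding poset_def is_set_def forces_simps by (meson UNIV_I order_refl)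

lemma le_refl: "q \<tturnstile> x \<^bold>\<in> P \<Longrightarrow> q \<tturnstile> x \<sqsubseteq> x"
  using forces_poset[of q] unfolding poset_def is_set_def forces_simps by (meson UNIV_I order_refl)

lemma le_trans: "q \<tturnstile> x \<sqsubseteq> y \<Longrightarrow> q \<tturnstile> y \<sqsubseteq> z \<Longrightarrow> q \<tturnstile> x \<sqsubseteq> z"
  using forces_poset[of q] unfolding poset_def is_set_def forces_simps by (meson UNIV_I order_refl)

lemma le_antisym: "q \<tturnstile> x \<sqsubseteq> y \<Longrightarrow> q \<tturnstile> y \<sqsubseteq> x \<Longrightarrow> q \<tturnstile> x \<doteq> y"
  using forces_poset[of q] unfolding poset_def is_set_def forces_simps by (meson UNIV_I order_refl)

lemma le_cong: "q \<tturnstile> x \<sqsubseteq> y \<Longrightarrow> q \<tturnstile> x \<doteq> x' \<Longrightarrow> q \<tturnstile> y \<doteq> y' \<Longrightarrow> q \<tturnstile> x' \<sqsubseteq> y'"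
  using forces_poset[of q] unfolding poset_def is_set_def forces_simps by (meson UNIV_I order_refl)

lemma eq_le: "q \<tturnstile> x \<doteq> y \<Longrightarrow> q \<tturnstile> x \<sqsubseteq> y"
  by (blast intro: le_cong le_refl eq_memL)

lemma eq_ge: "q \<tturnstile> x \<doteq> y \<Longrightarrow> q \<tturnstile> y \<sqsubseteq> x"
  by (blast intro: eq_le eq_sym)

section \<open>Subsets, upper bounds and suprema\<close>

lemma is_subsetI:
  assumes "\<And>r x. r \<le> q \<Longrightarrow> r \<tturnstile> S x \<Longrightarrow> r \<tturnstile> x \<^bold>\<in> P"
    and "\<And>r x y. r \<le> q \<Longrightarrow> r \<tturnstile> S x \<Longrightarrow> r \<tturnstile> x \<doteq> y \<Longrightarrow> r \<tturnstile> S y"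
  shows "q \<tturnstile> is_subset (eq P) S"
  using assms unfolding is_subset_def forces_simps by blast

lemma subset_mem: "q \<tturnstile> is_subset (eq P) S \<Longrightarrow> q \<tturnstile> S x \<Longrightarrow> q \<tturnstile> x \<^bold>\<in> P"
  unfolding is_subset_def forces_simps by blast

lemma subset_cong: "q \<tturnstile> is_subset (eq P) S \<Longrightarrow> q \<tturnstile> S x \<Longrightarrow> q \<tturnstile> x \<doteq> y \<Longrightarrow> q \<tturnstile> S y"
  unfolding is_subset_def forces_simps by blast

lemma is_ubI:
  assumes "q \<tturnstile> u \<^bold>\<in> P" and "\<And>r x. r \<le> q \<Longrightarrow> r \<tturnstile> S x \<Longrightarrow> r \<tturnstile> x \<sqsubseteq> u"
  shows "q \<tturnstile> is_ub P S u"
  using assms unfolding is_ub_def forces_simps by blast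

lemma is_ub_mem: "q \<tturnstile> is_ub P S u \<Longrightarrow> q \<tturnstile> u \<^bold>\<in> P"
  unfolding is_ub_def forces_simps by blast

lemma is_ub_upper: "q \<tturnstile> is_ub P S u \<Longrightarrow> q \<tturnstile> S x \<Longrightarrow> q \<tturnstile> x \<sqsubseteq> u"
  unfolding is_ub_def forces_simps by blast

lemma is_supI:
  assumes "q \<tturnstile> z \<^bold>\<in> P" and "\<And>r x. r \<le> q \<Longrightarrow> r \<tturnstile> S x \<Longrightarrow> r \<tturnstile> x \<sqsubseteq> z"
    and "\<And>r u. r \<le> q \<Longrightarrow> r \<tturnstile> is_ub P S u \<Longrightarrow> r \<tturnstile> z \<sqsubseteq> u"
  shows "q \<tturnstile> is_sup P S z"
  using assms unfolding is_sup_def forces_simps by (blast intro: is_ubI)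

lemma is_sup_ub: "q \<tturnstile> is_sup P S z \<Longrightarrow> q \<tturnstile> is_ub P S z"
  unfolding is_sup_def forces_simps by blast

lemma is_sup_mem: "q \<tturnstile> is_sup P S z \<Longrightarrow> q \<tturnstile> z \<^bold>\<in> P"
  by (blast intro: is_sup_ub is_ub_mem)

lemma is_sup_upper: "q \<tturnstile> is_sup P S z \<Longrightarrow> q \<tturnstile> S x \<Longrightarrow> q \<tturnstile> x \<sqsubseteq> z"
  by (blast intro: is_sup_ub is_ub_upper)

lemma is_sup_least:
  assumes "q \<tturnstile> is_sup P S z" "q \<tturnstile> u \<^bold>\<in> P"
    and "\<And>r x. r \<le> q \<Longrightarrow> r \<tturnstile> S x \<Longrightarrow> r \<tturnstile> x \<sqsubseteq> u"
  shows "q \<tturnstile> z \<sqsubseteq> u"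
proof -
  have "q \<tturnstile> is_ub P S u"
    using assms(2,3) by (rule is_ubI)
  then show ?thesis
    using assms(1) unfolding is_sup_def forces_simps by blast
qed

lemma is_sup_cong:
  assumes "\<And>r x. r \<le> q \<Longrightarrow> r \<tturnstile> S x \<longleftrightarrow> r \<tturnstile> T x" and "q \<tturnstile> is_sup P S z"
  shows "q \<tturnstile> is_sup P T z"
proof (rule is_supI)
  show "q \<tturnstile> z \<^bold>\<in> P"
    using assms(2) by (rule is_sup_mem)
  fix r assume r: "r \<le> q"
  note sup = forces_mono[OF r assms(2)]
  show "r \<tturnstile> x \<sqsubseteq> z" if "r \<tturnstile> T x" for x
    using sup that assms(1)[OF r] by (blast intro: is_sup_upper)
  fix u assume u: "r \<tturnstile> is_ub P T u"
  show "r \<tturnstile> z \<sqsubseteq> u"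
    using sup is_ub_mem[OF u]
  proof (rule is_sup_least)
    fix s x assume s: "s \<le> r" and "s \<tturnstile> S x"
    then show "s \<tturnstile> x \<sqsubseteq> u"
      using assms(1)[of s x] r is_ub_upper[OF forces_mono[OF s u]] by simp
  qed
qed

lemma is_sup_unique: "q \<tturnstile> is_sup P S y \<Longrightarrow> q \<tturnstile> is_sup P S z \<Longrightarrow> q \<tturnstile> y \<doteq> z"
  unfolding is_sup_def forces_simps by (blast intro: le_antisym)

lemma is_sup_eq:
  assumes "q \<tturnstile> is_sup P S y" and "q \<tturnstile> y \<doteq> z"
  shows "q \<tturnstile> is_sup P S z"
proof (rule is_supI)
  show "q \<tturnstile> z \<^bold>\<in> P"
    using assms(2) by (rule eq_memR)
  fix r assume r: "r \<le> q"
  note sup = forces_mono[OF r assms(1)] and eq = forces_mono[OF r assms(2)]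
  show "r \<tturnstile> x \<sqsubseteq> z" if "r \<tturnstile> S x" for x
    using is_sup_upper[OF sup that] eq_le[OF eq] by (rule le_trans)
  show "r \<tturnstile> z \<sqsubseteq> u" if "r \<tturnstile> is_ub P S u" for u
    using eq_ge[OF eq] sup that by (auto simp: is_sup_def intro: le_trans)
qed

section \<open>Directed subsets\<close>

lemma directedI:
  assumes "q \<tturnstile> is_subset (eq P) S"
    and "\<And>r x y. r \<le> q \<Longrightarrow> r \<tturnstile> S x \<Longrightarrow> r \<tturnstile> S y \<Longrightarrow> r \<tturnstile> (\<^bold>\<exists>z. S z \<^bold>\<and> x \<sqsubseteq> z \<^bold>\<and> y \<sqsubseteq> z)"
    and "q \<tturnstile> (\<^bold>\<exists>x. S x)"
  shows "q \<tturnstile> directed P S"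
  using assms unfolding directed_def semidirected_def forces_simps by blast

lemma directed_subset: "q \<tturnstile> directed P S \<Longrightarrow> q \<tturnstile> is_subset (eq P) S"
  unfolding directed_def semidirected_def forces_simps by blast

lemma directed_inhabited: "q \<tturnstile> directed P S \<Longrightarrow> q \<tturnstile> (\<^bold>\<exists>x. S x)"
  unfolding directed_def forces_simps by blast

lemma directed_upper:
  "q \<tturnstile> directed P S \<Longrightarrow> q \<tturnstile> S x \<Longrightarrow> q \<tturnstile> S y \<Longrightarrow> q \<tturnstile> (\<^bold>\<exists>z. S z \<^bold>\<and> x \<sqsubseteq> z \<^bold>\<and> y \<sqsubseteq> z)"
  unfolding directed_def semidirected_def forces_simps by blast

lemma is_subset_cong:
  assumes "\<And>r x. r \<le> q \<Longrightarrow> r \<tturnstile> S x \<longleftrightarrow> r \<tturnstile> T x" and "q \<tturnstile> is_subset (eq P) S"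
  shows "q \<tturnstile> is_subset (eq P) T"
  using assms unfolding is_subset_def forces_simps by blast

lemma directed_cong:
  assumes cong: "\<And>r x. r \<le> q \<Longrightarrow> r \<tturnstile> S x \<longleftrightarrow> r \<tturnstile> T x" and dir: "q \<tturnstile> directed P S"
  shows "q \<tturnstile> directed P T"
proof (rule directedI)
  show "q \<tturnstile> is_subset (eq P) T"
    using cong directed_subset[OF dir] by (rule is_subset_cong)
  show "q \<tturnstile> (\<^bold>\<exists>x. T x)"
    using directed_inhabited[OF dir] by (rule forces_exE) (metis cong forces_exI)
  fix r x y assume r: "r \<le> q" and "r \<tturnstile> T x" "r \<tturnstile> T y"
  then have "r \<tturnstile> (\<^bold>\<exists>z. S z \<^bold>\<and> x \<sqsubseteq> z \<^bold>\<and> y \<sqsubseteq> z)"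
    using cong directed_upper[OF forces_mono[OF r dir]] by blast
  then show "r \<tturnstile> (\<^bold>\<exists>z. T z \<^bold>\<and> x \<sqsubseteq> z \<^bold>\<and> y \<sqsubseteq> z)"
  proof (rule forces_exE)
    fix s z assume "s \<le> r" and "s \<tturnstile> (S z \<^bold>\<and> x \<sqsubseteq> z \<^bold>\<and> y \<sqsubseteq> z)"
    then show "s \<tturnstile> (\<^bold>\<exists>z. T z \<^bold>\<and> x \<sqsubseteq> z \<^bold>\<and> y \<sqsubseteq> z)"
      using cong[of s z] r by (intro forces_exI[of _ _ z]) simp
  qed
qed

lemma down_subset: "q \<tturnstile> is_subset (eq P) (\<lambda>x. x \<sqsubseteq> y)"
proof (rule is_subsetI)
  fix r x x' assume "r \<tturnstile> x \<sqsubseteq> y" and "r \<tturnstile> x \<doteq> x'"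
  then show "r \<tturnstile> x' \<sqsubseteq> y"
    by (blast intro: le_cong le_memR)
qed (rule le_memL)

text \<open>The principal lower set is the test set from which way-below yields the order and
  continuity yields monotonicity.\<close>

lemma down_directed:
  assumes "q \<tturnstile> y \<^bold>\<in> P"
  shows "q \<tturnstile> directed P (\<lambda>x. x \<sqsubseteq> y)"
proof (rule directedI)
  show "q \<tturnstile> (\<^bold>\<exists>x. x \<sqsubseteq> y)"
    using le_refl[OF assms] by (rule forces_exI)
  fix r x x' assume "r \<tturnstile> x \<sqsubseteq> y" and "r \<tturnstile> x' \<sqsubseteq> y"
  then show "r \<tturnstile> (\<^bold>\<exists>z. z \<sqsubseteq> y \<^bold>\<and> x \<sqsubseteq> z \<^bold>\<and> x' \<sqsubseteq> z)"
    by (intro forces_exI[of _ _ y]) (simp add: le_refl le_memR)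
qed (rule down_subset)

lemma down_sup: "q \<tturnstile> y \<^bold>\<in> P \<Longrightarrow> q \<tturnstile> is_sup P (\<lambda>x. x \<sqsubseteq> y) y"
  by (rule is_supI) (auto intro: is_ub_upper le_refl forces_mono)

section \<open>The way-below relation and compact elements\<close>

lemma way_below_memL: "q \<tturnstile> way_below P x y \<Longrightarrow> q \<tturnstile> x \<^bold>\<in> P"
  unfolding way_below_def forces_simps by blast

lemma way_below_memR: "q \<tturnstile> way_below P x y \<Longrightarrow> q \<tturnstile> y \<^bold>\<in> P"
  unfolding way_below_def forces_simps by blast

lemma way_belowD:
  "q \<tturnstile> way_below P x y \<Longrightarrow> q \<tturnstile> directed P S \<Longrightarrow> q \<tturnstile> is_sup P S z \<Longrightarrow> q \<tturnstile> y \<sqsubseteq> z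
    \<Longrightarrow> q \<tturnstile> (\<^bold>\<exists>s. S s \<^bold>\<and> x \<sqsubseteq> s)"
  unfolding way_below_def forces_simps by blast

lemma way_belowI:
  assumes "q \<tturnstile> x \<^bold>\<in> P" "q \<tturnstile> y \<^bold>\<in> P"
    and "\<And>r S z. r \<le> q \<Longrightarrow> r \<tturnstile> directed P S \<Longrightarrow> r \<tturnstile> is_sup P S z \<Longrightarrow> r \<tturnstile> y \<sqsubseteq> z
      \<Longrightarrow> r \<tturnstile> (\<^bold>\<exists>s. S s \<^bold>\<and> x \<sqsubseteq> s)"
  shows "q \<tturnstile> way_below P x y"
  using assms unfolding way_below_def forces_simps by blast

lemma compact_mem: "q \<tturnstile> is_compact P c \<Longrightarrow> q \<tturnstile> c \<^bold>\<in> P"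
  by (simp add: is_compact_def way_below_memL)

lemma way_below_imp_le:
  assumes "q \<tturnstile> way_below P x y"
  shows "q \<tturnstile> x \<sqsubseteq> y"
proof -
  have y: "q \<tturnstile> y \<^bold>\<in> P"
    using assms by (rule way_below_memR)
  have "q \<tturnstile> (\<^bold>\<exists>s. s \<sqsubseteq> y \<^bold>\<and> x \<sqsubseteq> s)"
    using assms down_directed[OF y] down_sup[OF y] le_refl[OF y] by (rule way_belowD)
  then show ?thesis
    by (rule forces_exE) (auto intro: le_trans)
qed

lemma compact_le_imp_way_below:
  assumes "q \<tturnstile> is_compact P x" and "q \<tturnstile> x \<sqsubseteq> y"
  shows "q \<tturnstile> way_below P x y"
proof (rule way_belowI)
  show "q \<tturnstile> x \<^bold>\<in> P" "q \<tturnstile> y \<^bold>\<in> P"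
    using assms(2) by (rule le_memL, rule le_memR)
  fix r S z assume r: "r \<le> q" and "r \<tturnstile> directed P S" "r \<tturnstile> is_sup P S z" "r \<tturnstile> y \<sqsubseteq> z"
  then show "r \<tturnstile> (\<^bold>\<exists>s. S s \<^bold>\<and> x \<sqsubseteq> s)"
    using assms[THEN forces_mono[OF r]] unfolding is_compact_def
    by (blast intro: way_belowD le_trans)
qed

lemma compact_way_below_iff: "q \<tturnstile> is_compact P x \<Longrightarrow> q \<tturnstile> way_below P x y \<longleftrightarrow> q \<tturnstile> x \<sqsubseteq> y"
  by (blast intro: way_below_imp_le compact_le_imp_way_below)

lemma compactD:
  "q \<tturnstile> is_compact P x \<Longrightarrow> q \<tturnstile> directed P S \<Longrightarrow> q \<tturnstile> is_sup P S z \<Longrightarrow> q \<tturnstile> x \<sqsubseteq> z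
    \<Longrightarrow> q \<tturnstile> (\<^bold>\<exists>s. S s \<^bold>\<and> x \<sqsubseteq> s)"
  by (rule way_belowD[OF compact_le_imp_way_below[OF _ le_refl]])
    (auto intro: way_belowD compact_le_imp_way_below le_trans le_memL le_memR dest: compact_mem)

lemma compactI:
  assumes "q \<tturnstile> x \<^bold>\<in> P"
    and "\<And>r S z. r \<le> q \<Longrightarrow> r \<tturnstile> directed P S \<Longrightarrow> r \<tturnstile> is_sup P S z \<Longrightarrow> r \<tturnstile> x \<sqsubseteq> z
      \<Longrightarrow> r \<tturnstile> (\<^bold>\<exists>s. S s \<^bold>\<and> x \<sqsubseteq> s)"
  shows "q \<tturnstile> is_compact P x"
  unfolding is_compact_def using assms(1,1,2) by (rule way_belowI)

text \<open>Internal equality is not equality of HOL, so invariance under \<open>\<doteq>\<close>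
  needs an argument: a member of \<open>S\<close> above \<open>x\<close> is also above
  \<open>y\<close>.\<close>

lemma compact_cong:
  assumes "q \<tturnstile> is_compact P x" and "q \<tturnstile> x \<doteq> y"
  shows "q \<tturnstile> is_compact P y"
proof (rule compactI)
  show "q \<tturnstile> y \<^bold>\<in> P"
    using assms(2) by (rule eq_memR)
  fix r S z assume r: "r \<le> q" and S: "r \<tturnstile> directed P S" "r \<tturnstile> is_sup P S z" and "r \<tturnstile> y \<sqsubseteq> z"
  note c = forces_mono[OF r assms(1)] and eq = forces_mono[OF r assms(2)]
  have "r \<tturnstile> (\<^bold>\<exists>s. S s \<^bold>\<and> x \<sqsubseteq> s)"
    using c S le_trans[OF eq_le[OF eq] \<open>r \<tturnstile> y \<sqsubseteq> z\<close>] by (rule compactD)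
  then show "r \<tturnstile> (\<^bold>\<exists>s. S s \<^bold>\<and> y \<sqsubseteq> s)"
  proof (rule forces_exE)
    fix t s assume t: "t \<le> r" and "t \<tturnstile> (S s \<^bold>\<and> x \<sqsubseteq> s)"
    then show "t \<tturnstile> (\<^bold>\<exists>s. S s \<^bold>\<and> y \<sqsubseteq> s)"
      using forces_mono[OF t eq] by (intro forces_exI[of _ _ s]) (auto intro: le_trans eq_ge)
  qed
qed

text \<open>Kuratowski finite subsets are locally enumerated by finite subsets of the carrier type.\<close>

definition enumerates :: "'h \<Rightarrow> 'a set \<Rightarrow> ('a \<Rightarrow> 'h) \<Rightarrow> bool" where
  "enumerates q X S \<longleftrightarrow> finite X \<and> (\<forall>x\<in>X. q \<tturnstile> S x) \<and>
     (\<forall>r\<le>q. \<forall>y. r \<tturnstile> S y \<longrightarrow> r \<tturnstile> (SUP x\<in>X. x \<doteq> y))"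

lemma enumerates_mono: "r \<le> q \<Longrightarrow> enumerates q X S \<Longrightarrow> enumerates r X S"
  unfolding enumerates_def by (blast intro: forces_mono order_trans)

lemma enumerates_finite: "enumerates q X S \<Longrightarrow> finite X"
  by (simp add: enumerates_def)

lemma enumerates_member: "enumerates q X S \<Longrightarrow> x \<in> X \<Longrightarrow> q \<tturnstile> S x"
  by (simp add: enumerates_def)

lemma enumeratesE:
  assumes "enumerates q X S" and "q \<tturnstile> S y"
    and "\<And>r x. r \<le> q \<Longrightarrow> x \<in> X \<Longrightarrow> r \<tturnstile> x \<doteq> y \<Longrightarrow> r \<tturnstile> \<chi>"
  shows "q \<tturnstile> \<chi>"
proof -
  have "q \<tturnstile> (SUP x\<in>X. x \<doteq> y)"
    using assms(1,2) by (simp add: enumerates_def)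
  then show ?thesis
    by (rule forces_bexE) (rule assms(3))
qed

text \<open>A numbering \<open>f\<close> of \<open>X\<close> by the numbers below \<open>n\<close>
  becomes a surjection once its graph is saturated under internal equality. Members of
  \<open>S\<close> are reached only locally, which an internal existential permits.\<close>

lemma kuratowski_finiteI:
  assumes S: "q \<tturnstile> is_subset (eq P) S" and enum: "enumerates q X S"
  shows "q \<tturnstile> kuratowski_finite (eq P) S"
proof -
  from enum have "finite X"
    by (simp add: enumerates_def)
  then obtain n :: nat and f where X: "X = f ` {i. i < n}"
    by (blast dest: finite_imp_nat_seg_image_inj_on)
  \<comment> \<open>The values of index \<open>i\<close> form the whole class of \<open>f i\<close>;
    indices from \<open>n\<close> on receive \<open>bot\<close>, since they are not elements of the
    domain.\<close>
  define F where "F i y = (if i < n then f i \<doteq> y else bot)" for i y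
  \<comment> \<open>An impossible case shows up as a stage that forces \<open>bot\<close> and hence
    everything. Such a stage is no contradiction in HOL, so it is kept as the second
    disjunct.\<close>
  have F: "i < n \<and> r \<tturnstile> f i \<doteq> y \<or> (\<forall>\<chi>. r \<tturnstile> \<chi>)" if "r \<tturnstile> F i y" for r i y
    using that by (auto simp: F_def forces_botE split: if_splits)
  have fin: "i < n \<and> i = j \<or> (\<forall>\<chi>. r \<tturnstile> \<chi>)" if "r \<tturnstile> fin_eq n i j" for r i j
    using that by (auto simp: fin_eq_def forces_botE split: if_splits)
  have S_f: "r \<tturnstile> S (f i)" if "r \<le> q" "i < n" for r i
    using that enum by (auto simp: enumerates_def X intro: forces_mono)
  have mem: "r \<tturnstile> S y" if "r \<le> q" "i < n" "r \<tturnstile> f i \<doteq> y" for r i y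
    using forces_mono[OF that(1) S] S_f[OF that(1,2)] that(3) by (rule subset_cong)
  have "q \<tturnstile> is_function (fin_eq n) (\<lambda>x y. S x \<^bold>\<and> x \<doteq> y) F"
    unfolding is_function_def forces_simps
  proof (intro conjI ballI allI impI; (elim conjE)?)
    fix r i y assume r: "r \<le> q" and "r \<tturnstile> F i y"
    then show "r \<tturnstile> fin_eq n i i" "r \<tturnstile> S y" "r \<tturnstile> y \<doteq> y"
      using F[of r i y] mem[OF r] by (auto simp: fin_eq_def intro: eq_memR)
    fix j y' assume "r \<tturnstile> fin_eq n i j" "r \<tturnstile> y \<doteq> y'"
    then show "r \<tturnstile> F j y'"
      using F[OF \<open>r \<tturnstile> F i y\<close>] fin[of r i j] by (auto simp: F_def intro: eq_trans)
  next
    fix r i y y' assume r: "r \<le> q" and "r \<tturnstile> F i y" "r \<tturnstile> F i y'"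
    then show "r \<tturnstile> S y" "r \<tturnstile> y \<doteq> y'"
      using F[of r i y] F[of r i y'] mem[OF r] by (auto intro: eq_trans eq_sym)
  next
    fix i r assume r: "r \<le> q" and "r \<tturnstile> fin_eq n i i"
    then have "r \<tturnstile> F i (f i)"
      using fin[of r i i] subset_mem[OF forces_mono[OF r S] S_f[OF r]] by (auto simp: F_def)
    then show "r \<tturnstile> (\<^bold>\<exists>y. F i y)"
      by (rule forces_exI)
  qed
  moreover have "q \<tturnstile> (\<^bold>\<forall>y. S y \<^bold>\<longrightarrow> (\<^bold>\<exists>i. F i y))"
  proof (simp, intro allI impI)
    fix y r assume r: "r \<le> q" and "r \<tturnstile> S y"
    from enumerates_mono[OF r enum] this(2) show "r \<tturnstile> (\<^bold>\<exists>i. F i y)"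
    proof (rule enumeratesE)
      fix t x assume "x \<in> X" and "t \<tturnstile> x \<doteq> y"
      then obtain i where "i < n" "t \<tturnstile> f i \<doteq> y"
        by (auto simp: X)
      then show "t \<tturnstile> (\<^bold>\<exists>i. F i y)"
        by (intro forces_exI[of _ _ i]) (simp add: F_def)
    qed
  qed
  ultimately show ?thesis
    unfolding kuratowski_finite_def by (intro forces_exI[of _ _ n] forces_exI[of _ _ F]) simp
qed

text \<open>The surjection is a relation, so one value for each \<open>i < n\<close> has to be
  picked; finite choice does this at a smaller stage. The picked values enumerate \<open>S\<close>
  because any other value of the same index is internally equal to the picked one.\<close>

lemma kuratowski_finiteE:
  assumes fin: "q \<tturnstile> kuratowski_finite (eq P) S"
    and enum: "\<And>r X. r \<le> q \<Longrightarrow> enumerates r X S \<Longrightarrow> r \<tturnstile> \<chi>"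
  shows "q \<tturnstile> \<chi>"
  using fin unfolding kuratowski_finite_def
proof (elim forces_exE)
  fix q' n s F
  assume "q' \<le> q" and "s \<le> q'"
    and "s \<tturnstile> (is_function (fin_eq n) (\<lambda>x y. S x \<^bold>\<and> x \<doteq> y) F \<^bold>\<and> (\<^bold>\<forall>y. S y \<^bold>\<longrightarrow> (\<^bold>\<exists>i. F i y)))"
  then have s: "s \<le> q" and fn: "s \<tturnstile> is_function (fin_eq n) (\<lambda>x y. S x \<^bold>\<and> x \<doteq> y) F"
    and surj: "\<And>r y. r \<le> s \<Longrightarrow> r \<tturnstile> S y \<Longrightarrow> r \<tturnstile> (\<^bold>\<exists>i. F i y)"
    by auto
  have mem: "r \<tturnstile> fin_eq n i i" "r \<tturnstile> S y" if "r \<le> s" "r \<tturnstile> F i y" for r i y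
    using fn that unfolding is_function_def forces_simps by blast+
  have uniq: "r \<tturnstile> y \<doteq> y'" if "r \<le> s" "r \<tturnstile> F i y" "r \<tturnstile> F i y'" for r i y y'
    using fn that unfolding is_function_def forces_simps by blast
  have total: "s \<tturnstile> (\<^bold>\<exists>y. F i y)" if "i \<in> {..<n}" for i
  proof -
    have "s \<tturnstile> fin_eq n i i"
      using that by (simp add: fin_eq_def)
    then show ?thesis
      using fn unfolding is_function_def forces_simps by blast
  qed
  show "s \<tturnstile> \<chi>"
    using finite_lessThan[of n] total
  proof (rule forces_finite_choice)
    fix r f assume r: "r \<le> s" and f: "\<And>i. i \<in> {..<n} \<Longrightarrow> r \<tturnstile> F i (f i)"
    have "enumerates r (f ` {..<n}) S"
      unfolding enumerates_def
    proof (intro conjI ballI allI impI)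
      show "r \<tturnstile> S x" if "x \<in> f ` {..<n}" for x
        using that f mem(2)[OF r] by auto
      fix t y assume t: "t \<le> r" and "t \<tturnstile> S y"
      from surj[OF order_trans[OF t r] this(2)] show "t \<tturnstile> (SUP x\<in>f ` {..<n}. x \<doteq> y)"
      proof (rule forces_exE)
        fix v i assume v: "v \<le> t" and F: "v \<tturnstile> F i y"
        have vs: "v \<le> s" and vr: "v \<le> r"
          using v t r by auto
        show "v \<tturnstile> (SUP x\<in>f ` {..<n}. x \<doteq> y)"
        \<comment> \<open>The bound on \<open>i\<close> is a statement of HOL and may be split
          classically; for an index from \<open>n\<close> on, the stage forces
          \<open>bot\<close>.\<close>
        proof (cases "i < n")
          case True
          then have "v \<tturnstile> f i \<doteq> y"
            using uniq[OF vs forces_mono[OF vr f] F] by simp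
          with True show ?thesis
            by (intro forces_bexI) auto
        next
          case False
          then show ?thesis
            using mem(1)[OF vs F] by (simp add: fin_eq_def forces_botE)
        qed
      qed
    qed simp
    then show "r \<tturnstile> \<chi>"
      using r s by (blast intro: enum order_trans)
  qed
qed

section \<open>Suprema of finite families\<close>

text \<open>Members of \<open>X\<close> lie in \<open>S\<close>, and each member of \<open>S\<close>
  is locally equal to one of \<open>X\<close>, so both have the same upper bounds. The right side is
  a meet over a finite set, the form that compactness and decidability proofs can use.\<close>

lemma enumerated_sup_le_iff:
  assumes "enumerates q X S" and "q \<tturnstile> is_sup P S z" and "q \<tturnstile> y \<^bold>\<in> P"
  shows "q \<tturnstile> z \<sqsubseteq> y \<longleftrightarrow> q \<tturnstile> (INF x\<in>X. x \<sqsubseteq> y)"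
proof
  assume "q \<tturnstile> z \<sqsubseteq> y"
  then show "q \<tturnstile> (INF x\<in>X. x \<sqsubseteq> y)"
    using le_trans[OF is_sup_upper[OF assms(2) enumerates_member[OF assms(1)]]] by simp
next
  assume X: "q \<tturnstile> (INF x\<in>X. x \<sqsubseteq> y)"
  show "q \<tturnstile> z \<sqsubseteq> y"
    using assms(2,3)
  proof (rule is_sup_least)
    fix r x assume r: "r \<le> q" and "r \<tturnstile> S x"
    from enumerates_mono[OF r assms(1)] this(2) show "r \<tturnstile> x \<sqsubseteq> y"
    proof (rule enumeratesE)
      fix s x' assume s: "s \<le> r" and "x' \<in> X" and "s \<tturnstile> x' \<doteq> x"
      moreover from X \<open>x' \<in> X\<close> have "s \<tturnstile> x' \<sqsubseteq> y"
        using forces_mono[OF order_trans[OF s r]] by simp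
      ultimately show "s \<tturnstile> x \<sqsubseteq> y"
        by (blast intro: le_trans eq_ge)
    qed
  qed
qed

text \<open>Bounds are merged one at a time by directedness; the empty case is where inhabitedness
  is used.\<close>

lemma finite_directed_upper:
  assumes "finite X" and dir: "q \<tturnstile> directed P T" and "\<And>x. x \<in> X \<Longrightarrow> q \<tturnstile> (\<^bold>\<exists>s. T s \<^bold>\<and> x \<sqsubseteq> s)"
  shows "q \<tturnstile> (\<^bold>\<exists>s. T s \<^bold>\<and> (INF x\<in>X. x \<sqsubseteq> s))"
  using assms(1,3)
proof (induction X rule: finite_induct)
  case empty
  then show ?case
    using directed_inhabited[OF dir] by simp
next
  case (insert a X)
  have "q \<tturnstile> (\<^bold>\<exists>s. T s \<^bold>\<and> (INF x\<in>X. x \<sqsubseteq> s))"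
    using insert by simp
  then show ?case
  proof (rule forces_exE)
    fix r s assume r: "r \<le> q" and s: "r \<tturnstile> (T s \<^bold>\<and> (INF x\<in>X. x \<sqsubseteq> s))"
    have "r \<tturnstile> (\<^bold>\<exists>s. T s \<^bold>\<and> a \<sqsubseteq> s)"
      by (rule forces_mono[OF r insert.prems]) simp
    then show "r \<tturnstile> (\<^bold>\<exists>s. T s \<^bold>\<and> (INF x\<in>insert a X. x \<sqsubseteq> s))"
    proof (rule forces_exE)
      fix r' s' assume r': "r' \<le> r" and s': "r' \<tturnstile> (T s' \<^bold>\<and> a \<sqsubseteq> s')"
      have "r' \<tturnstile> (\<^bold>\<exists>t. T t \<^bold>\<and> s \<sqsubseteq> t \<^bold>\<and> s' \<sqsubseteq> t)"
        using s' forces_mono[OF r' s] forces_mono[OF order_trans[OF r' r] dir]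
        by (intro directed_upper) auto
      then show "r' \<tturnstile> (\<^bold>\<exists>s. T s \<^bold>\<and> (INF x\<in>insert a X. x \<sqsubseteq> s))"
      proof (rule forces_exE)
        fix v t assume v: "v \<le> r'" and "v \<tturnstile> (T t \<^bold>\<and> s \<sqsubseteq> t \<^bold>\<and> s' \<sqsubseteq> t)"
        then show "v \<tturnstile> (\<^bold>\<exists>s. T s \<^bold>\<and> (INF x\<in>insert a X. x \<sqsubseteq> s))"
          using forces_mono[OF order_trans[OF v r'] s] forces_mono[OF v s']
          by (intro forces_exI[of _ _ t]) (auto intro: le_trans)
      qed
    qed
  qed
qed

text \<open>Each of the finitely many \<open>x\<close> falls below a member of \<open>T\<close>; a
  common bound inside \<open>T\<close> is then above \<open>z\<close>.\<close>

lemma enumerated_sup_compact: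
  assumes enum: "enumerates q X S" and sup: "q \<tturnstile> is_sup P S z"
    and compact: "\<And>x. x \<in> X \<Longrightarrow> q \<tturnstile> is_compact P x"
  shows "q \<tturnstile> is_compact P z"
proof (rule compactI)
  show "q \<tturnstile> z \<^bold>\<in> P"
    using sup by (rule is_sup_mem)
  fix r T t assume r: "r \<le> q" and T: "r \<tturnstile> directed P T" "r \<tturnstile> is_sup P T t" and z: "r \<tturnstile> z \<sqsubseteq> t"
  note enum = enumerates_mono[OF r enum] and sup = forces_mono[OF r sup]
  have "r \<tturnstile> (\<^bold>\<exists>s. T s \<^bold>\<and> (INF x\<in>X. x \<sqsubseteq> s))"
  proof (rule finite_directed_upper[OF _ T(1)])
    show "finite X"
      using enum by (rule enumerates_finite)
    fix x assume x: "x \<in> X"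
    have "r \<tturnstile> x \<sqsubseteq> t"
      using is_sup_upper[OF sup enumerates_member[OF enum x]] z by (blast intro: le_trans)
    then show "r \<tturnstile> (\<^bold>\<exists>s. T s \<^bold>\<and> x \<sqsubseteq> s)"
      using forces_mono[OF r compact[OF x]] T by (blast intro: compactD)
  qed
  then show "r \<tturnstile> (\<^bold>\<exists>s. T s \<^bold>\<and> z \<sqsubseteq> s)"
  proof (rule forces_exE)
    fix v s assume v: "v \<le> r" and s: "v \<tturnstile> (T s \<^bold>\<and> (INF x\<in>X. x \<sqsubseteq> s))"
    then have "v \<tturnstile> z \<sqsubseteq> s"
      using enumerated_sup_le_iff[OF enumerates_mono[OF v enum] forces_mono[OF v sup]]
        subset_mem[OF directed_subset[OF forces_mono[OF v T(1)]]] by auto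
    with s show "v \<tturnstile> (\<^bold>\<exists>s. T s \<^bold>\<and> z \<sqsubseteq> s)"
      by (intro forces_exI[of _ _ s]) simp
  qed
qed

section \<open>Closure of finite families under unions\<close>

lemma enumerates_empty: "enumerates q {} (\<lambda>_. bot)"
  by (auto simp: enumerates_def forces_botE)

lemma enumerates_singleton: "q \<tturnstile> x \<^bold>\<in> P \<Longrightarrow> enumerates q {x} (\<lambda>y. x \<doteq> y)"
  by (simp add: enumerates_def)

lemma enumerates_union:
  assumes X: "enumerates q X S" and Y: "enumerates q Y T"
  shows "enumerates q (X \<union> Y) (\<lambda>x. S x \<^bold>\<or> T x)"
  unfolding enumerates_def
proof (intro conjI ballI allI impI)
  show "finite (X \<union> Y)"
    using X Y by (simp add: enumerates_finite)
  show "q \<tturnstile> (S x \<^bold>\<or> T x)" if "x \<in> X \<union> Y" for x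
    using that X Y by (blast intro: forces_disjI1 forces_disjI2 enumerates_member)
  fix r y assume r: "r \<le> q" and "r \<tturnstile> (S y \<^bold>\<or> T y)"
  from this(2) show "r \<tturnstile> (SUP x\<in>X \<union> Y. x \<doteq> y)"
  proof (rule forces_disjE)
    fix s assume "s \<le> r"
    then have s: "s \<le> q"
      using r by simp
    show "s \<tturnstile> (SUP x\<in>X \<union> Y. x \<doteq> y)" if "s \<tturnstile> S y"
      using enumerates_mono[OF s X] that by (rule enumeratesE) (blast intro: forces_bexI)
    show "s \<tturnstile> (SUP x\<in>X \<union> Y. x \<doteq> y)" if "s \<tturnstile> T y"
      using enumerates_mono[OF s Y] that by (rule enumeratesE) (blast intro: forces_bexI)
  qed
qed

lemma subset_union:
  assumes "q \<tturnstile> is_subset (eq P) S" and "q \<tturnstile> is_subset (eq P) T"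
  shows "q \<tturnstile> is_subset (eq P) (\<lambda>x. S x \<^bold>\<or> T x)"
proof (rule is_subsetI)
  fix r x assume r: "r \<le> q" and x: "r \<tturnstile> (S x \<^bold>\<or> T x)"
  note S = assms(1)[THEN forces_mono[OF r]] and T = assms(2)[THEN forces_mono[OF r]]
  show "r \<tturnstile> x \<^bold>\<in> P"
    using x by (rule forces_disjE) (blast intro: forces_mono S T subset_mem)+
  fix y assume eq: "r \<tturnstile> x \<doteq> y"
  from x show "r \<tturnstile> (S y \<^bold>\<or> T y)"
  proof (rule forces_disjE)
    fix s assume s: "s \<le> r"
    show "s \<tturnstile> (S y \<^bold>\<or> T y)" if "s \<tturnstile> S x"
      using subset_cong[OF forces_mono[OF s S] that forces_mono[OF s eq]] by (rule forces_disjI1)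
    show "s \<tturnstile> (S y \<^bold>\<or> T y)" if "s \<tturnstile> T x"
      using subset_cong[OF forces_mono[OF s T] that forces_mono[OF s eq]] by (rule forces_disjI2)
  qed
qed

lemma ub_union:
  assumes "q \<tturnstile> is_ub P S u" and "q \<tturnstile> is_ub P T u"
  shows "q \<tturnstile> is_ub P (\<lambda>x. S x \<^bold>\<or> T x) u"
proof (rule is_ubI)
  show "q \<tturnstile> u \<^bold>\<in> P"
    using assms(1) by (rule is_ub_mem)
  fix r x assume r: "r \<le> q" and x: "r \<tturnstile> (S x \<^bold>\<or> T x)"
  show "r \<tturnstile> x \<sqsubseteq> u"
    using x by (rule forces_disjE) (blast intro: forces_mono[OF r] forces_mono is_ub_upper assms)+
qed

text \<open>The enumerations of \<open>S\<close> and \<open>T\<close> live at stages of their own.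
  At a common smaller stage they combine to one of the union, and finiteness, being a forced
  proposition, is carried back to \<open>q\<close>.\<close>

lemma kuratowski_finite_union:
  assumes S: "q \<tturnstile> is_subset (eq P) S" "q \<tturnstile> kuratowski_finite (eq P) S"
    and T: "q \<tturnstile> is_subset (eq P) T" "q \<tturnstile> kuratowski_finite (eq P) T"
  shows "q \<tturnstile> kuratowski_finite (eq P) (\<lambda>x. S x \<^bold>\<or> T x)"
  using S(2)
proof (rule kuratowski_finiteE)
  fix r X assume r: "r \<le> q" and X: "enumerates r X S"
  from forces_mono[OF r T(2)] show "r \<tturnstile> kuratowski_finite (eq P) (\<lambda>x. S x \<^bold>\<or> T x)"
  proof (rule kuratowski_finiteE)
    fix s Y assume s: "s \<le> r" and Y: "enumerates s Y T"
    have sq: "s \<le> q"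
      using s r by simp
    show "s \<tturnstile> kuratowski_finite (eq P) (\<lambda>x. S x \<^bold>\<or> T x)"
      using subset_union[OF S(1)[THEN forces_mono[OF sq]] T(1)[THEN forces_mono[OF sq]]]
        enumerates_union[OF enumerates_mono[OF s X] Y]
      by (rule kuratowski_finiteI)
  qed
qed

end

section \<open>Compactly generated posets\<close>

text \<open>The generators \<open>C\<close> stand for the step functions. Density asks for a
  supremum and not for a directed set, which is what step functions offer directly. The assumptions
  are indexed by a free stage because for the exponential they are themselves derived by
  forcing.\<close>

locale compactly_generated = forced_poset h P
  for h :: "'h::complete_heyting_algebra" and P :: "('a, 'h) hposet" (structure) +
  fixes C :: "'a \<Rightarrow> 'h"
  assumes dcpo: "q \<tturnstile> dcpo P"
    and bounded_complete: "q \<tturnstile> bounded_complete P"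
    and generator_compact: "q \<tturnstile> C c \<Longrightarrow> q \<tturnstile> is_compact P c"
    and generator_cong: "q \<tturnstile> C c \<Longrightarrow> q \<tturnstile> c \<doteq> c' \<Longrightarrow> q \<tturnstile> C c'"
    and generator_dense: "q \<tturnstile> x \<^bold>\<in> P \<Longrightarrow> q \<tturnstile> is_sup P (\<lambda>c. C c \<^bold>\<and> c \<sqsubseteq> x) x"
begin

section \<open>Finite suprema of generators as a basis\<close>

definition generator_family :: "('a \<Rightarrow> 'h) \<Rightarrow> 'h" where
  "generator_family S =
     (is_subset (eq P) S \<^bold>\<and> is_bounded P S \<^bold>\<and> kuratowski_finite (eq P) S \<^bold>\<and>
      (\<^bold>\<forall>s. S s \<^bold>\<longrightarrow> C s))"

text \<open>This is the abstract form of the set \<open>B\<close>, identified with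
  \<open>step_basis\<close> in \<open>step_basis_eq\<close>.\<close>

definition generated :: "'a \<Rightarrow> 'h" where
  "generated f = (\<^bold>\<exists>S. generator_family S \<^bold>\<and> is_sup P S f)"

lemma bounded_sup:
  "q \<tturnstile> is_subset (eq P) S \<Longrightarrow> q \<tturnstile> is_bounded P S \<Longrightarrow> q \<tturnstile> (\<^bold>\<exists>z. is_sup P S z)"
  using bounded_complete[of q] unfolding bounded_complete_def forces_simps
  by (meson UNIV_I order_refl)

lemma family_sup: "q \<tturnstile> generator_family S \<Longrightarrow> q \<tturnstile> (\<^bold>\<exists>z. is_sup P S z)"
  unfolding generator_family_def forces_conj by (blast intro: bounded_sup)

lemma generatedE:
  assumes "q \<tturnstile> generated f"
    and "\<And>r S X. r \<le> q \<Longrightarrow> r \<tturnstile> generator_family S \<Longrightarrow> r \<tturnstile> is_sup P S f \<Longrightarrow> enumerates r X S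
      \<Longrightarrow> (\<And>x. x \<in> X \<Longrightarrow> r \<tturnstile> C x) \<Longrightarrow> r \<tturnstile> \<chi>"
  shows "q \<tturnstile> \<chi>"
  using assms(1) unfolding generated_def
proof (rule forces_exE)
  fix r S assume r: "r \<le> q" and S: "r \<tturnstile> (generator_family S \<^bold>\<and> is_sup P S f)"
  then have "r \<tturnstile> kuratowski_finite (eq P) S"
    by (simp add: generator_family_def)
  then show "r \<tturnstile> \<chi>"
  proof (rule kuratowski_finiteE)
    fix s X assume s: "s \<le> r" and X: "enumerates s X S"
    show "s \<tturnstile> \<chi>"
    proof (rule assms(2))
      show "s \<le> q"
        using s r by simp
      show S': "s \<tturnstile> generator_family S" "s \<tturnstile> is_sup P S f"
        using forces_mono[OF s S] by simp_all
      show "s \<tturnstile> C x" if "x \<in> X" for x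
        using S'(1) enumerates_member[OF X that] unfolding generator_family_def forces_simps by blast
    qed (rule X)
  qed
qed

lemma generated_compact: "q \<tturnstile> generated f \<Longrightarrow> q \<tturnstile> is_compact P f"
  by (erule generatedE) (blast intro: enumerated_sup_compact generator_compact)

lemma generated_cong:
  assumes "q \<tturnstile> generated f" and "q \<tturnstile> f \<doteq> g"
  shows "q \<tturnstile> generated g"
  using assms(1) unfolding generated_def
proof (rule forces_exE)
  fix r S assume r: "r \<le> q" and "r \<tturnstile> (generator_family S \<^bold>\<and> is_sup P S f)"
  then show "r \<tturnstile> (\<^bold>\<exists>S. generator_family S \<^bold>\<and> is_sup P S g)"
    using is_sup_eq[OF _ forces_mono[OF r assms(2)]] by (intro forces_exI[of _ _ S]) simp
qed

text \<open>The bound \<open>u\<close> makes the supremum of \<open>S\<close> exist and keeps it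
  below \<open>u\<close>. Applied to the empty family and to unions, this gives both halves of
  directedness.\<close>

lemma generated_upper:
  assumes S: "q \<tturnstile> is_subset (eq P) S" and u: "q \<tturnstile> is_ub P S u"
    and fin: "q \<tturnstile> kuratowski_finite (eq P) S" and C: "\<And>r s. r \<le> q \<Longrightarrow> r \<tturnstile> S s \<Longrightarrow> r \<tturnstile> C s"
  shows "q \<tturnstile> (\<^bold>\<exists>z. (generated z \<^bold>\<and> z \<sqsubseteq> u) \<^bold>\<and> is_ub P S z)"
proof -
  have "q \<tturnstile> is_bounded P S"
    unfolding is_bounded_def using u by (rule forces_exI)
  with S fin C have fam: "q \<tturnstile> generator_family S"
    by (simp add: generator_family_def)
  from family_sup[OF fam] show ?thesis
  proof (rule forces_exE)
    fix r z assume r: "r \<le> q" and z: "r \<tturnstile> is_sup P S z"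
    have "r \<tturnstile> generated z"
      unfolding generated_def using z forces_mono[OF r fam]
      by (intro forces_exI[of _ _ S]) simp
    moreover have "r \<tturnstile> z \<sqsubseteq> u"
      using z forces_mono[OF r u] unfolding is_sup_def forces_simps by blast
    ultimately show "r \<tturnstile> (\<^bold>\<exists>z. (generated z \<^bold>\<and> z \<sqsubseteq> u) \<^bold>\<and> is_ub P S z)"
      using is_sup_ub[OF z] by (intro forces_exI[of _ _ z]) simp
  qed
qed

text \<open>The family is the class of \<open>c\<close> under internal equality: an internal
  singleton with supremum \<open>c\<close>.\<close>

lemma generator_generated:
  assumes "q \<tturnstile> C c"
  shows "q \<tturnstile> generated c"
proof -
  have c: "q \<tturnstile> c \<^bold>\<in> P"
    using assms by (blast intro: generator_compact compact_mem)
  have S: "q \<tturnstile> is_subset (eq P) (\<lambda>x. c \<doteq> x)"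
    by (rule is_subsetI) (blast intro: eq_memR eq_trans)+
  have sup: "q \<tturnstile> is_sup P (\<lambda>x. c \<doteq> x) c"
    using c by (intro is_supI) (blast intro: eq_ge is_ub_upper forces_mono)+
  have "q \<tturnstile> is_bounded P (\<lambda>x. c \<doteq> x)"
    unfolding is_bounded_def using is_sup_ub[OF sup] by (rule forces_exI)
  moreover have "q \<tturnstile> kuratowski_finite (eq P) (\<lambda>x. c \<doteq> x)"
    using S enumerates_singleton[OF c] by (rule kuratowski_finiteI)
  moreover have "q \<tturnstile> (\<^bold>\<forall>x. c \<doteq> x \<^bold>\<longrightarrow> C x)"
    unfolding forces_simps using forces_mono[OF _ assms] by (blast intro: generator_cong)
  ultimately show ?thesis
    unfolding generated_def generator_family_def using S sup
    by (intro forces_exI[of _ _ "\<lambda>x. c \<doteq> x"]) simp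
qed

text \<open>The empty family supplies an inhabitant; the union of the families behind
  \<open>x\<close> and \<open>y\<close> supplies an upper bound of the two that is still below
  \<open>f\<close>.\<close>

lemma generated_below_directed:
  assumes f: "q \<tturnstile> f \<^bold>\<in> P"
  shows "q \<tturnstile> directed P (\<lambda>c. generated c \<^bold>\<and> c \<sqsubseteq> f)"
proof (rule directedI)
  show "q \<tturnstile> is_subset (eq P) (\<lambda>c. generated c \<^bold>\<and> c \<sqsubseteq> f)"
    by (rule is_subsetI)
      (auto intro: le_memL generated_cong subset_cong[OF down_subset])
  have "q \<tturnstile> (\<^bold>\<exists>z. (generated z \<^bold>\<and> z \<sqsubseteq> f) \<^bold>\<and> is_ub P (\<lambda>_. bot) z)"
  proof (rule generated_upper)
    show S: "q \<tturnstile> is_subset (eq P) (\<lambda>_. bot)"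
      by (rule is_subsetI) (blast intro: forces_botE)+
    show "q \<tturnstile> is_ub P (\<lambda>_. bot) f"
      using f by (rule is_ubI) (blast intro: forces_botE)
    show "q \<tturnstile> kuratowski_finite (eq P) (\<lambda>_. bot)"
      using S enumerates_empty by (rule kuratowski_finiteI)
  qed (rule forces_botE)
  then show "q \<tturnstile> (\<^bold>\<exists>z. generated z \<^bold>\<and> z \<sqsubseteq> f)"
  proof (rule forces_exE)
    fix r z assume "r \<tturnstile> ((generated z \<^bold>\<and> z \<sqsubseteq> f) \<^bold>\<and> is_ub P (\<lambda>_. bot) z)"
    then show "r \<tturnstile> (\<^bold>\<exists>z. generated z \<^bold>\<and> z \<sqsubseteq> f)"
      by (intro forces_exI[of _ _ z]) simp
  qed
  fix r x y
  assume r: "r \<le> q" and x: "r \<tturnstile> (generated x \<^bold>\<and> x \<sqsubseteq> f)" and y: "r \<tturnstile> (generated y \<^bold>\<and> y \<sqsubseteq> f)"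
  from x have "r \<tturnstile> generated x"
    by simp
  then show "r \<tturnstile> (\<^bold>\<exists>z. (generated z \<^bold>\<and> z \<sqsubseteq> f) \<^bold>\<and> x \<sqsubseteq> z \<^bold>\<and> y \<sqsubseteq> z)"
    unfolding generated_def[of x]
  proof (rule forces_exE)
    fix s S assume s: "s \<le> r" and S: "s \<tturnstile> (generator_family S \<^bold>\<and> is_sup P S x)"
    have "s \<tturnstile> generated y"
      using forces_mono[OF s y] by simp
    then show "s \<tturnstile> (\<^bold>\<exists>z. (generated z \<^bold>\<and> z \<sqsubseteq> f) \<^bold>\<and> x \<sqsubseteq> z \<^bold>\<and> y \<sqsubseteq> z)"
      unfolding generated_def[of y]
    proof (rule forces_exE)
      fix t T assume t: "t \<le> s" and T: "t \<tturnstile> (generator_family T \<^bold>\<and> is_sup P T y)"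
      have tr: "t \<le> r" and tq: "t \<le> q"
        using t s r by auto
      have S': "t \<tturnstile> is_subset (eq P) S" "t \<tturnstile> kuratowski_finite (eq P) S" "t \<tturnstile> is_sup P S x"
          "t \<tturnstile> (\<^bold>\<forall>c. S c \<^bold>\<longrightarrow> C c)"
        using forces_mono[OF t S] by (simp_all add: generator_family_def)
      have T': "t \<tturnstile> is_subset (eq P) T" "t \<tturnstile> kuratowski_finite (eq P) T" "t \<tturnstile> is_sup P T y"
          "t \<tturnstile> (\<^bold>\<forall>c. T c \<^bold>\<longrightarrow> C c)"
        using T by (simp_all add: generator_family_def)
      \<comment> \<open>A common bound is what gives the union a supremum: its members are below
        \<open>x\<close> or \<open>y\<close>, hence below \<open>f\<close>.\<close>
      have ub: "t \<tturnstile> is_ub P S f" "t \<tturnstile> is_ub P T f"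
      proof -
        have "t \<tturnstile> f \<^bold>\<in> P" "t \<tturnstile> x \<sqsubseteq> f" "t \<tturnstile> y \<sqsubseteq> f"
          using f x y tq tr by (auto intro: forces_mono)
        then show "t \<tturnstile> is_ub P S f" "t \<tturnstile> is_ub P T f"
          using S'(3) T'(3) by (blast intro: is_ubI le_trans is_sup_upper forces_mono)+
      qed
      have "t \<tturnstile> (\<^bold>\<exists>z. (generated z \<^bold>\<and> z \<sqsubseteq> f) \<^bold>\<and> is_ub P (\<lambda>c. S c \<^bold>\<or> T c) z)"
        using subset_union[OF S'(1) T'(1)] ub_union[OF ub]
          kuratowski_finite_union[OF S'(1,2) T'(1,2)]
      proof (rule generated_upper)
        fix v c assume v: "v \<le> t" and "v \<tturnstile> (S c \<^bold>\<or> T c)"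
        from this(2) show "v \<tturnstile> C c"
          by (rule forces_disjE) (use S'(4) T'(4) v in \<open>auto dest: order_trans\<close>)
      qed
      then show "t \<tturnstile> (\<^bold>\<exists>z. (generated z \<^bold>\<and> z \<sqsubseteq> f) \<^bold>\<and> x \<sqsubseteq> z \<^bold>\<and> y \<sqsubseteq> z)"
      proof (rule forces_exE)
        fix v z
        assume v: "v \<le> t" and z: "v \<tturnstile> ((generated z \<^bold>\<and> z \<sqsubseteq> f) \<^bold>\<and> is_ub P (\<lambda>c. S c \<^bold>\<or> T c) z)"
        have ub: "w \<tturnstile> is_ub P (\<lambda>c. S c \<^bold>\<or> T c) z" if "w \<le> v" for w
          using forces_mono[OF that z] by simp
        have "v \<tturnstile> z \<^bold>\<in> P"
          using ub[OF order_refl] by (rule is_ub_mem)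
        then have "v \<tturnstile> x \<sqsubseteq> z" "v \<tturnstile> y \<sqsubseteq> z"
          using S'(3)[THEN forces_mono[OF v]] T'(3)[THEN forces_mono[OF v]] ub
          by (blast intro: is_sup_least is_ub_upper forces_disjI1 forces_disjI2)+
        then show "v \<tturnstile> (\<^bold>\<exists>z. (generated z \<^bold>\<and> z \<sqsubseteq> f) \<^bold>\<and> x \<sqsubseteq> z \<^bold>\<and> y \<sqsubseteq> z)"
          using z by (intro forces_exI[of _ _ z]) simp
      qed
    qed
  qed
qed

text \<open>Generators are themselves \<open>generated\<close>, so an upper bound of the larger set
  bounds the generators below \<open>f\<close>, whose supremum is \<open>f\<close>.\<close>

lemma generated_below_sup:
  assumes f: "q \<tturnstile> f \<^bold>\<in> P"
  shows "q \<tturnstile> is_sup P (\<lambda>c. generated c \<^bold>\<and> c \<sqsubseteq> f) f"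
proof (rule is_supI)
  fix r u assume r: "r \<le> q" and u: "r \<tturnstile> is_ub P (\<lambda>c. generated c \<^bold>\<and> c \<sqsubseteq> f) u"
  show "r \<tturnstile> f \<sqsubseteq> u"
    using generator_dense[OF forces_mono[OF r f]] is_ub_mem[OF u]
  proof (rule is_sup_least)
    fix s c assume s: "s \<le> r" and "s \<tturnstile> (C c \<^bold>\<and> c \<sqsubseteq> f)"
    then show "s \<tturnstile> c \<sqsubseteq> u"
      by (intro is_ub_upper[OF forces_mono[OF s u]]) (simp add: generator_generated)
  qed
qed (use f in simp_all)

text \<open>Compactness of \<open>f\<close>, tested on the directed set of \<open>generated\<close>
  elements below it, puts \<open>f\<close> under one of them; by antisymmetry the two are
  equal.\<close>

lemma compact_generated:
  assumes "q \<tturnstile> is_compact P f"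
  shows "q \<tturnstile> generated f"
proof -
  have f: "q \<tturnstile> f \<^bold>\<in> P"
    using assms by (rule compact_mem)
  have "q \<tturnstile> (\<^bold>\<exists>c. (generated c \<^bold>\<and> c \<sqsubseteq> f) \<^bold>\<and> f \<sqsubseteq> c)"
    using assms generated_below_directed[OF f] generated_below_sup[OF f] le_refl[OF f]
    by (rule compactD)
  then show ?thesis
    by (rule forces_exE) (auto intro: generated_cong le_antisym)
qed

theorem generated_iff_compact: "q \<tturnstile> generated f \<longleftrightarrow> q \<tturnstile> is_compact P f"
  by (blast intro: generated_compact compact_generated)

theorem algebraic: "q \<tturnstile> algebraic_dcpo P"
  unfolding algebraic_dcpo_def forces_simps
proof (intro conjI ballI allI impI)
  fix f r assume f: "r \<tturnstile> f \<^bold>\<in> P"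
  show "r \<tturnstile> directed P (\<lambda>c. is_compact P c \<^bold>\<and> c \<sqsubseteq> f)"
    using generated_below_directed[OF f]
    by (rule directed_cong[rotated]) (simp add: generated_iff_compact)
  show "r \<tturnstile> is_sup P (\<lambda>c. is_compact P c \<^bold>\<and> c \<sqsubseteq> f) f"
    using generated_below_sup[OF f]
    by (rule is_sup_cong[rotated]) (simp add: generated_iff_compact)
qed (rule dcpo)

end

section \<open>Exponentials\<close>

locale forced_exponential = heyting_context h + D: forced_poset h D + E: forced_poset h E
  for h :: "'h::complete_heyting_algebra"
    and D :: "('a, 'h) hposet" and E :: "('b, 'h) hposet" +
  assumes D_algebraic: "h \<le> algebraic_dcpo D" and E_algebraic: "h \<le> algebraic_dcpo E"
    and E_bounded_complete: "h \<le> bounded_complete E" and E_pointed: "h \<le> pointed E"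
begin

abbreviation fn_space :: "('a \<Rightarrow> 'b \<Rightarrow> 'h, 'h) hposet"
  where "fn_space \<equiv> exponential D E"

abbreviation continuous :: "('a \<Rightarrow> 'b \<Rightarrow> 'h) \<Rightarrow> 'h"
  where "continuous \<equiv> scott_continuous D E"

lemma D_basis:
  assumes "q \<tturnstile> x \<^bold>\<in> D"
  shows "q \<tturnstile> directed D (\<lambda>c. is_compact D c \<^bold>\<and> c \<sqsubseteq>\<^bsub>D\<^esub> x)"
    and "q \<tturnstile> is_sup D (\<lambda>c. is_compact D c \<^bold>\<and> c \<sqsubseteq>\<^bsub>D\<^esub> x) x"
  using forces_if_le[OF D_algebraic, of q] assms unfolding algebraic_dcpo_def forces_simps by blast+

lemma E_basis:
  assumes "q \<tturnstile> x \<^bold>\<in> E"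
  shows "q \<tturnstile> is_sup E (\<lambda>c. is_compact E c \<^bold>\<and> c \<sqsubseteq>\<^bsub>E\<^esub> x) x"
  using forces_if_le[OF E_algebraic, of q] assms unfolding algebraic_dcpo_def forces_simps by blast

lemma E_directed_sup: "q \<tturnstile> directed E S \<Longrightarrow> q \<tturnstile> (\<^bold>\<exists>z. is_sup E S z)"
  using forces_if_le[OF E_algebraic, of q] unfolding algebraic_dcpo_def dcpo_def forces_simps
  by blast

lemma E_bounded_sup:
  assumes "q \<tturnstile> is_subset (eq E) S" and "q \<tturnstile> is_ub E S u"
  shows "q \<tturnstile> (\<^bold>\<exists>z. is_sup E S z)"
proof -
  have "q \<tturnstile> is_bounded E S"
    unfolding is_bounded_def using assms(2) by (rule forces_exI)
  then show ?thesis
    using forces_if_le[OF E_bounded_complete, of q] assms(1)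
    unfolding bounded_complete_def forces_simps by blast
qed

section \<open>Continuous functions as relations\<close>

lemma cont_memL: "q \<tturnstile> continuous F \<Longrightarrow> q \<tturnstile> F x y \<Longrightarrow> q \<tturnstile> x \<^bold>\<in> D"
  unfolding scott_continuous_def is_function_def forces_simps by blast

lemma cont_memR: "q \<tturnstile> continuous F \<Longrightarrow> q \<tturnstile> F x y \<Longrightarrow> q \<tturnstile> y \<^bold>\<in> E"
  unfolding scott_continuous_def is_function_def forces_simps by blast

lemma cont_cong:
  "q \<tturnstile> continuous F \<Longrightarrow> q \<tturnstile> F x y \<Longrightarrow> q \<tturnstile> x \<doteq>\<^bsub>D\<^esub> x' \<Longrightarrow> q \<tturnstile> y \<doteq>\<^bsub>E\<^esub> y' \<Longrightarrow> q \<tturnstile> F x' y'"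
  unfolding scott_continuous_def is_function_def forces_simps by (meson UNIV_I order_refl)

lemma cont_unique: "q \<tturnstile> continuous F \<Longrightarrow> q \<tturnstile> F x y \<Longrightarrow> q \<tturnstile> F x y' \<Longrightarrow> q \<tturnstile> y \<doteq>\<^bsub>E\<^esub> y'"
  unfolding scott_continuous_def is_function_def forces_simps by (meson UNIV_I order_refl)

lemma cont_total: "q \<tturnstile> continuous F \<Longrightarrow> q \<tturnstile> x \<^bold>\<in> D \<Longrightarrow> q \<tturnstile> (\<^bold>\<exists>y. F x y)"
  unfolding scott_continuous_def is_function_def forces_simps by blast

lemma cont_sup:
  "q \<tturnstile> continuous F \<Longrightarrow> q \<tturnstile> directed D S \<Longrightarrow> q \<tturnstile> is_sup D S z \<Longrightarrow> q \<tturnstile> F z y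
    \<Longrightarrow> q \<tturnstile> is_sup E (\<lambda>w. \<^bold>\<exists>x. S x \<^bold>\<and> F x w) y"
  unfolding scott_continuous_def forces_simps by blast

text \<open>Continuity is applied to the principal lower set of \<open>x'\<close>, which is directed
  with supremum \<open>x'\<close>; \<open>y\<close> is one of the values taken on it.\<close>

lemma cont_mono:
  assumes F: "q \<tturnstile> continuous F" and le: "q \<tturnstile> x \<sqsubseteq>\<^bsub>D\<^esub> x'" and y: "q \<tturnstile> F x y" and y': "q \<tturnstile> F x' y'"
  shows "q \<tturnstile> y \<sqsubseteq>\<^bsub>E\<^esub> y'"
proof (rule E.is_sup_upper)
  have x': "q \<tturnstile> x' \<^bold>\<in> D"
    using le by (rule D.le_memR)
  show "q \<tturnstile> is_sup E (\<lambda>w. \<^bold>\<exists>x. x \<sqsubseteq>\<^bsub>D\<^esub> x' \<^bold>\<and> F x w) y'"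
    using F D.down_directed[OF x'] D.down_sup[OF x'] y' by (rule cont_sup)
  show "q \<tturnstile> (\<^bold>\<exists>x. x \<sqsubseteq>\<^bsub>D\<^esub> x' \<^bold>\<and> F x y)"
    using le y by (intro forces_exI[of _ _ x]) simp
qed

lemma continuousI:
  assumes "\<And>r x y. r \<le> q \<Longrightarrow> r \<tturnstile> F x y \<Longrightarrow> r \<tturnstile> x \<^bold>\<in> D"
    and "\<And>r x y. r \<le> q \<Longrightarrow> r \<tturnstile> F x y \<Longrightarrow> r \<tturnstile> y \<^bold>\<in> E"
    and "\<And>r x x' y y'. r \<le> q \<Longrightarrow> r \<tturnstile> F x y \<Longrightarrow> r \<tturnstile> x \<doteq>\<^bsub>D\<^esub> x' \<Longrightarrow> r \<tturnstile> y \<doteq>\<^bsub>E\<^esub> y' \<Longrightarrow> r \<tturnstile> F x' y'"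
    and "\<And>r x y y'. r \<le> q \<Longrightarrow> r \<tturnstile> F x y \<Longrightarrow> r \<tturnstile> F x y' \<Longrightarrow> r \<tturnstile> y \<doteq>\<^bsub>E\<^esub> y'"
    and "\<And>r x. r \<le> q \<Longrightarrow> r \<tturnstile> x \<^bold>\<in> D \<Longrightarrow> r \<tturnstile> (\<^bold>\<exists>y. F x y)"
    and "\<And>r S z y. r \<le> q \<Longrightarrow> r \<tturnstile> directed D S \<Longrightarrow> r \<tturnstile> is_sup D S z \<Longrightarrow> r \<tturnstile> F z y
      \<Longrightarrow> r \<tturnstile> is_sup E (\<lambda>w. \<^bold>\<exists>x. S x \<^bold>\<and> F x w) y"
  shows "q \<tturnstile> continuous F"
  unfolding scott_continuous_def is_function_def forces_simps
  by (intro conjI ballI allI impI; (elim conjE)?) (rule assms; assumption)+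

section \<open>The order of the exponential\<close>

lemma exp_mem_iff: "q \<tturnstile> F \<^bold>\<in> fn_space \<longleftrightarrow> q \<tturnstile> continuous F"
  by (auto simp: exponential_def)

lemma exp_eq_iff: "q \<tturnstile> F \<doteq>\<^bsub>fn_space\<^esub> G \<longleftrightarrow>
    q \<tturnstile> continuous F \<and> q \<tturnstile> continuous G \<and> (\<forall>r\<le>q. \<forall>x y. r \<tturnstile> F x y \<longleftrightarrow> r \<tturnstile> G x y)"
  by (auto simp: exponential_def)

lemma exp_le_iff: "q \<tturnstile> F \<sqsubseteq>\<^bsub>fn_space\<^esub> G \<longleftrightarrow> q \<tturnstile> continuous F \<and> q \<tturnstile> continuous G \<and>
    (\<forall>r\<le>q. \<forall>x y y'. r \<tturnstile> F x y \<longrightarrow> r \<tturnstile> G x y' \<longrightarrow> r \<tturnstile> y \<sqsubseteq>\<^bsub>E\<^esub> y')"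
  by (auto simp: exponential_def)

lemma exp_leI:
  "q \<tturnstile> continuous F \<Longrightarrow> q \<tturnstile> continuous G
    \<Longrightarrow> (\<And>r x y y'. r \<le> q \<Longrightarrow> r \<tturnstile> F x y \<Longrightarrow> r \<tturnstile> G x y' \<Longrightarrow> r \<tturnstile> y \<sqsubseteq>\<^bsub>E\<^esub> y')
    \<Longrightarrow> q \<tturnstile> F \<sqsubseteq>\<^bsub>fn_space\<^esub> G"
  unfolding exp_le_iff by blast

lemma exp_leD: "q \<tturnstile> F \<sqsubseteq>\<^bsub>fn_space\<^esub> G \<Longrightarrow> q \<tturnstile> F x y \<Longrightarrow> q \<tturnstile> G x y' \<Longrightarrow> q \<tturnstile> y \<sqsubseteq>\<^bsub>E\<^esub> y'"
  unfolding exp_le_iff by blast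

lemma exp_eqD: "q \<tturnstile> F \<doteq>\<^bsub>fn_space\<^esub> G \<Longrightarrow> q \<tturnstile> F x y \<Longrightarrow> q \<tturnstile> G x y"
  unfolding exp_eq_iff by blast

text \<open>The values \<open>y\<close> of \<open>F\<close> and \<open>z\<close> of \<open>H\<close>
  are related only through a value of \<open>G\<close> at \<open>x\<close>, which totality of
  \<open>G\<close> supplies at a smaller stage.\<close>

lemma exp_le_trans:
  assumes FG: "q \<tturnstile> F \<sqsubseteq>\<^bsub>fn_space\<^esub> G" and GH: "q \<tturnstile> G \<sqsubseteq>\<^bsub>fn_space\<^esub> H"
  shows "q \<tturnstile> F \<sqsubseteq>\<^bsub>fn_space\<^esub> H"
proof (rule exp_leI)
  show "q \<tturnstile> continuous F" "q \<tturnstile> continuous H"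
    using FG GH by (simp_all only: exp_le_iff)
  fix r x y z assume r: "r \<le> q" and y: "r \<tturnstile> F x y" and z: "r \<tturnstile> H x z"
  note FG = forces_mono[OF r FG] and GH = forces_mono[OF r GH]
  have "r \<tturnstile> continuous F" "r \<tturnstile> continuous G"
    using FG by (simp_all only: exp_le_iff)
  then have "r \<tturnstile> (\<^bold>\<exists>v. G x v)"
    using y by (blast intro: cont_total cont_memL)
  then show "r \<tturnstile> y \<sqsubseteq>\<^bsub>E\<^esub> z"
  proof (rule forces_exE)
    fix s v assume s: "s \<le> r" and v: "s \<tturnstile> G x v"
    show "s \<tturnstile> y \<sqsubseteq>\<^bsub>E\<^esub> z"
      using exp_leD[OF forces_mono[OF s FG] forces_mono[OF s y] v]
        exp_leD[OF forces_mono[OF s GH] v forces_mono[OF s z]] by (rule E.le_trans)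
  qed
qed

text \<open>Equality asks for the same graph: a value of \<open>G\<close> at \<open>x\<close>, found
  by totality, equals the given value of \<open>F\<close> by antisymmetry in \<open>E\<close>, and
  the graph of \<open>G\<close> is closed under this equality.\<close>

lemma exp_le_antisym:
  assumes FG: "q \<tturnstile> F \<sqsubseteq>\<^bsub>fn_space\<^esub> G" and GF: "q \<tturnstile> G \<sqsubseteq>\<^bsub>fn_space\<^esub> F"
  shows "q \<tturnstile> F \<doteq>\<^bsub>fn_space\<^esub> G"
proof -
  \<comment> \<open>\<open>F\<close> and \<open>G\<close> are generalised because the inclusion of
    graphs is applied in both directions.\<close>
  have *: "r \<tturnstile> G x y"
    if r: "r \<le> q" and y: "r \<tturnstile> F x y"
      and FG: "q \<tturnstile> F \<sqsubseteq>\<^bsub>fn_space\<^esub> G" and GF: "q \<tturnstile> G \<sqsubseteq>\<^bsub>fn_space\<^esub> F" for F G r x y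
  proof -
    note FG = forces_mono[OF r FG] and GF = forces_mono[OF r GF]
    have F: "r \<tturnstile> continuous F" and G: "r \<tturnstile> continuous G"
      using FG by (simp_all only: exp_le_iff)
    have x: "r \<tturnstile> x \<^bold>\<in> D"
      using F y by (rule cont_memL)
    from cont_total[OF G x] show ?thesis
    proof (rule forces_exE)
      fix s v assume s: "s \<le> r" and v: "s \<tturnstile> G x v"
      have "s \<tturnstile> v \<doteq>\<^bsub>E\<^esub> y"
        using exp_leD[OF forces_mono[OF s GF] v forces_mono[OF s y]]
          exp_leD[OF forces_mono[OF s FG] forces_mono[OF s y] v] by (rule E.le_antisym)
      then show "s \<tturnstile> G x y"
        by (rule cont_cong[OF forces_mono[OF s G] v forces_mono[OF s x]])
    qed
  qed
  show ?thesis
    unfolding exp_eq_iff using FG GF *[OF _ _ FG GF] *[OF _ _ GF FG] by (auto simp: exp_le_iff)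
qed

lemma exp_eq_le: "q \<tturnstile> F \<doteq>\<^bsub>fn_space\<^esub> G \<Longrightarrow> q \<tturnstile> F \<sqsubseteq>\<^bsub>fn_space\<^esub> G"
  unfolding exp_eq_iff exp_le_iff by (blast intro: E.eq_le cont_unique forces_mono)

lemma exp_eq_sym: "q \<tturnstile> F \<doteq>\<^bsub>fn_space\<^esub> G \<Longrightarrow> q \<tturnstile> G \<doteq>\<^bsub>fn_space\<^esub> F"
  unfolding exp_eq_iff by blast

lemma exp_poset: "h \<le> poset fn_space"
proof -
  \<comment> \<open>At stage \<open>top\<close>, forcing is exactly the inequality with
    \<open>h\<close> that \<open>forced_poset\<close> expects.\<close>
  have "top \<tturnstile> poset fn_space"
    unfolding poset_def is_set_def forces_simps
  proof (intro conjI ballI allI impI; (elim conjE)?)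
    fix q F G H H'
    show "q \<tturnstile> F \<doteq>\<^bsub>fn_space\<^esub> G \<Longrightarrow> q \<tturnstile> G \<doteq>\<^bsub>fn_space\<^esub> F"
      by (rule exp_eq_sym)
    show "q \<tturnstile> F \<doteq>\<^bsub>fn_space\<^esub> G \<Longrightarrow> q \<tturnstile> G \<doteq>\<^bsub>fn_space\<^esub> H \<Longrightarrow> q \<tturnstile> F \<doteq>\<^bsub>fn_space\<^esub> H"
      unfolding exp_eq_iff by blast
    show "q \<tturnstile> F \<sqsubseteq>\<^bsub>fn_space\<^esub> G \<Longrightarrow> q \<tturnstile> F \<^bold>\<in> fn_space" "q \<tturnstile> F \<sqsubseteq>\<^bsub>fn_space\<^esub> G \<Longrightarrow> q \<tturnstile> G \<^bold>\<in> fn_space"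
      unfolding exp_mem_iff exp_le_iff by blast+
    show "q \<tturnstile> F \<sqsubseteq>\<^bsub>fn_space\<^esub> G \<Longrightarrow> q \<tturnstile> F \<doteq>\<^bsub>fn_space\<^esub> H \<Longrightarrow> q \<tturnstile> G \<doteq>\<^bsub>fn_space\<^esub> H' \<Longrightarrow> q \<tturnstile> H \<sqsubseteq>\<^bsub>fn_space\<^esub> H'"
      by (meson exp_eq_le exp_eq_sym exp_le_trans)
    show "q \<tturnstile> F \<^bold>\<in> fn_space \<Longrightarrow> q \<tturnstile> F \<sqsubseteq>\<^bsub>fn_space\<^esub> F"
      by (rule exp_eq_le)
    show "q \<tturnstile> F \<sqsubseteq>\<^bsub>fn_space\<^esub> G \<Longrightarrow> q \<tturnstile> G \<sqsubseteq>\<^bsub>fn_space\<^esub> H \<Longrightarrow> q \<tturnstile> F \<sqsubseteq>\<^bsub>fn_space\<^esub> H"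
      by (rule exp_le_trans)
    show "q \<tturnstile> F \<sqsubseteq>\<^bsub>fn_space\<^esub> G \<Longrightarrow> q \<tturnstile> G \<sqsubseteq>\<^bsub>fn_space\<^esub> F \<Longrightarrow> q \<tturnstile> F \<doteq>\<^bsub>fn_space\<^esub> G"
      by (rule exp_le_antisym)
  qed
  then show ?thesis
    by (simp add: forces_def)
qed

end

sublocale forced_exponential \<subseteq> exp: forced_poset h "exponential D E"
  by unfold_locales (rule exp_poset)

context forced_exponential
begin

section \<open>Pointwise suprema of families of functions\<close>

definition vals :: "(('a \<Rightarrow> 'b \<Rightarrow> 'h) \<Rightarrow> 'h) \<Rightarrow> 'a \<Rightarrow> 'b \<Rightarrow> 'h" where
  "vals S x y = (\<^bold>\<exists>s. S s \<^bold>\<and> s x y)"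

text \<open>The first conjunct keeps the graph inside \<open>D\<close>: outside it no continuous
  function has a value, yet the empty set of values would still have a supremum.\<close>

definition pointwise_sup :: "(('a \<Rightarrow> 'b \<Rightarrow> 'h) \<Rightarrow> 'h) \<Rightarrow> 'a \<Rightarrow> 'b \<Rightarrow> 'h" where
  "pointwise_sup S x y = (x \<^bold>\<in> D \<^bold>\<and> is_sup E (vals S x) y)"

lemma valsI: "q \<tturnstile> S s \<Longrightarrow> q \<tturnstile> s x y \<Longrightarrow> q \<tturnstile> vals S x y"
  unfolding vals_def by (rule forces_exI[of _ _ s]) simp

lemma valsE:
  assumes "q \<tturnstile> vals S x y" and "\<And>r s. r \<le> q \<Longrightarrow> r \<tturnstile> S s \<Longrightarrow> r \<tturnstile> s x y \<Longrightarrow> r \<tturnstile> \<chi>"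
  shows "q \<tturnstile> \<chi>"
  using assms(1) unfolding vals_def by (rule forces_exE) (auto intro: assms(2))

lemma subset_cont: "q \<tturnstile> is_subset (eq fn_space) S \<Longrightarrow> q \<tturnstile> S s \<Longrightarrow> q \<tturnstile> continuous s"
  using exp.subset_mem exp_mem_iff by blast

lemma vals_cong:
  assumes S: "q \<tturnstile> is_subset (eq fn_space) S" and x: "q \<tturnstile> x \<doteq>\<^bsub>D\<^esub> x'" and y: "q \<tturnstile> y \<doteq>\<^bsub>E\<^esub> y'"
    and "q \<tturnstile> vals S x y"
  shows "q \<tturnstile> vals S x' y'"
  using assms(4)
proof (rule valsE)
  fix r s assume r: "r \<le> q" and s: "r \<tturnstile> S s" "r \<tturnstile> s x y"
  show "r \<tturnstile> vals S x' y'"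
    using subset_cont[OF forces_mono[OF r S] s(1)] s(2) forces_mono[OF r x] forces_mono[OF r y]
    by (intro valsI[of _ S s, OF s(1)]) (rule cont_cong)
qed

lemma vals_memL:
  assumes "q \<tturnstile> is_subset (eq fn_space) S" and "q \<tturnstile> vals S x y"
  shows "q \<tturnstile> x \<^bold>\<in> D"
  using assms(2) by (rule valsE) (blast intro: cont_memL subset_cont forces_mono[OF _ assms(1)])

lemma vals_memR:
  assumes "q \<tturnstile> is_subset (eq fn_space) S" and "q \<tturnstile> vals S x y"
  shows "q \<tturnstile> y \<^bold>\<in> E"
  using assms(2) by (rule valsE) (blast intro: cont_memR subset_cont forces_mono[OF _ assms(1)])

lemma vals_subset:
  assumes "q \<tturnstile> is_subset (eq fn_space) S"
  shows "q \<tturnstile> is_subset (eq E) (vals S x)"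
proof (rule E.is_subsetI)
  fix r y y' assume r: "r \<le> q" and y: "r \<tturnstile> vals S x y"
  note S = forces_mono[OF r assms]
  show "r \<tturnstile> y \<^bold>\<in> E"
    using S y by (rule vals_memR)
  show "r \<tturnstile> vals S x y'" if "r \<tturnstile> y \<doteq>\<^bsub>E\<^esub> y'"
    using S vals_memL[OF S y] that y by (rule vals_cong)
qed

lemma pointwise_sup_sup: "q \<tturnstile> pointwise_sup S x y \<Longrightarrow> q \<tturnstile> is_sup E (vals S x) y"
  by (simp add: pointwise_sup_def)

lemma pointwise_sup_memL: "q \<tturnstile> pointwise_sup S x y \<Longrightarrow> q \<tturnstile> x \<^bold>\<in> D"
  by (simp add: pointwise_sup_def)

text \<open>Two suprema are interchanged, one over \<open>s\<close> in \<open>S\<close> and one over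
  \<open>x\<close> in the directed set \<open>T\<close>. Existence of the suprema of values is a
  premise so that directed, bounded and empty families can share the lemma.\<close>

lemma pointwise_sup_continuous:
  assumes S: "q \<tturnstile> is_subset (eq fn_space) S"
    and ex: "\<And>r x. r \<le> q \<Longrightarrow> r \<tturnstile> x \<^bold>\<in> D \<Longrightarrow> r \<tturnstile> (\<^bold>\<exists>y. is_sup E (vals S x) y)"
  shows "q \<tturnstile> continuous (pointwise_sup S)"
proof -
  have total: "r \<tturnstile> (\<^bold>\<exists>y. pointwise_sup S x y)" if r: "r \<le> q" and x: "r \<tturnstile> x \<^bold>\<in> D" for r x
    using ex[OF r x]
  proof (rule forces_exE)
    fix s y assume s: "s \<le> r" and "s \<tturnstile> is_sup E (vals S x) y"
    then show "s \<tturnstile> (\<^bold>\<exists>y. pointwise_sup S x y)"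
      using forces_mono[OF s x] unfolding pointwise_sup_def by (intro forces_exI[of _ _ y]) simp
  qed
  show ?thesis
  proof (rule continuousI)
    fix r x y assume r: "r \<le> q" and y: "r \<tturnstile> pointwise_sup S x y"
    note sup = pointwise_sup_sup[OF y]
    show "r \<tturnstile> x \<^bold>\<in> D"
      using y by (rule pointwise_sup_memL)
    show "r \<tturnstile> y \<^bold>\<in> E"
      using sup by (rule E.is_sup_mem)
    show "r \<tturnstile> y \<doteq>\<^bsub>E\<^esub> y'" if "r \<tturnstile> pointwise_sup S x y'" for y'
      using sup pointwise_sup_sup[OF that] by (rule E.is_sup_unique)
    fix x' y' assume x': "r \<tturnstile> x \<doteq>\<^bsub>D\<^esub> x'" and y': "r \<tturnstile> y \<doteq>\<^bsub>E\<^esub> y'"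
    have iff: "t \<tturnstile> vals S x v \<longleftrightarrow> t \<tturnstile> vals S x' v" if t: "t \<le> r" for t v
    proof -
      have "t \<le> q"
        using t r by simp
      note S = forces_mono[OF this S]
      note x' = forces_mono[OF t x']
      show ?thesis
        by (meson S x' vals_memR vals_cong D.eq_sym)
    qed
    have "r \<tturnstile> is_sup E (vals S x') y'"
      using iff E.is_sup_eq[OF sup y'] by (rule E.is_sup_cong)
    then show "r \<tturnstile> pointwise_sup S x' y'"
      using D.eq_memR[OF x'] by (simp add: pointwise_sup_def)
  next
    fix r T z y
    assume r: "r \<le> q" and T: "r \<tturnstile> directed D T" "r \<tturnstile> is_sup D T z" and y: "r \<tturnstile> pointwise_sup S z y"
    note sup = pointwise_sup_sup[OF y] and S = forces_mono[OF r S]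
    note z = pointwise_sup_memL[OF y]
    show "r \<tturnstile> is_sup E (\<lambda>w. \<^bold>\<exists>x. T x \<^bold>\<and> pointwise_sup S x w) y"
    proof (rule E.is_supI)
      show "r \<tturnstile> y \<^bold>\<in> E"
        using sup by (rule E.is_sup_mem)
      fix t w assume t: "t \<le> r" and "t \<tturnstile> (\<^bold>\<exists>x. T x \<^bold>\<and> pointwise_sup S x w)"
      from this(2) show "t \<tturnstile> w \<sqsubseteq>\<^bsub>E\<^esub> y"
      proof (rule forces_exE)
        fix v x assume v: "v \<le> t" and x: "v \<tturnstile> (T x \<^bold>\<and> pointwise_sup S x w)"
        have vr: "v \<le> r"
          using v t by simp
        have "v \<tturnstile> is_sup E (vals S x) w"
          using x by (simp add: pointwise_sup_def)
        moreover have "v \<tturnstile> y \<^bold>\<in> E"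
          using forces_mono[OF vr sup] by (rule E.is_sup_mem)
        ultimately show "v \<tturnstile> w \<sqsubseteq>\<^bsub>E\<^esub> y"
        proof (rule E.is_sup_least)
          fix u a assume u: "u \<le> v" and "u \<tturnstile> vals S x a"
          from this(2) show "u \<tturnstile> a \<sqsubseteq>\<^bsub>E\<^esub> y"
          proof (rule valsE)
            fix k s assume k: "k \<le> u" and s: "k \<tturnstile> S s" "k \<tturnstile> s x a"
            have kv: "k \<le> v" and kr: "k \<le> r"
              using k u vr by auto
            have cont: "k \<tturnstile> continuous s"
              using forces_mono[OF kr S] s(1) by (rule subset_cont)
            \<comment> \<open>The comparison goes through the value \<open>b\<close> of the same
              \<open>s\<close> at \<open>z\<close>: monotonicity of \<open>s\<close> gives
              \<open>a \<sqsubseteq> b\<close>, and \<open>b\<close> is among the values with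
              supremum \<open>y\<close>.\<close>
            from cont_total[OF cont forces_mono[OF kr z]] show "k \<tturnstile> a \<sqsubseteq>\<^bsub>E\<^esub> y"
            proof (rule forces_exE)
              fix l b assume l: "l \<le> k" and b: "l \<tturnstile> s z b"
              have lr: "l \<le> r" and lv: "l \<le> v"
                using l kr kv by auto
              have "l \<tturnstile> x \<sqsubseteq>\<^bsub>D\<^esub> z"
                using forces_mono[OF lr T(2)] forces_mono[OF lv x] by (auto intro: D.is_sup_upper)
              then have "l \<tturnstile> a \<sqsubseteq>\<^bsub>E\<^esub> b"
                using forces_mono[OF l s(2)] b by (rule cont_mono[OF forces_mono[OF l cont]])
              moreover have "l \<tturnstile> b \<sqsubseteq>\<^bsub>E\<^esub> y"
                using forces_mono[OF lr sup] valsI[of _ S s z b, OF forces_mono[OF l s(1)]] b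
                by (blast intro: E.is_sup_upper)
              ultimately show "l \<tturnstile> a \<sqsubseteq>\<^bsub>E\<^esub> y"
                by (rule E.le_trans)
            qed
          qed
        qed
      qed
    next
      fix t u assume t: "t \<le> r" and u: "t \<tturnstile> is_ub E (\<lambda>w. \<^bold>\<exists>x. T x \<^bold>\<and> pointwise_sup S x w) u"
      show "t \<tturnstile> y \<sqsubseteq>\<^bsub>E\<^esub> u"
        using forces_mono[OF t sup] E.is_ub_mem[OF u]
      proof (rule E.is_sup_least)
        fix v a assume v: "v \<le> t" and "v \<tturnstile> vals S z a"
        from this(2) show "v \<tturnstile> a \<sqsubseteq>\<^bsub>E\<^esub> u"
        proof (rule valsE)
          fix k s assume k: "k \<le> v" and s: "k \<tturnstile> S s" "k \<tturnstile> s z a"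
          have kt: "k \<le> t" and kr: "k \<le> r"
            using k v t by auto
          have cont: "k \<tturnstile> continuous s"
            using forces_mono[OF kr S] s(1) by (rule subset_cont)
          \<comment> \<open>In the other direction, continuity of each single \<open>s\<close>
            reduces its value at \<open>z\<close> to its values on \<open>T\<close>.\<close>
          have "k \<tturnstile> is_sup E (\<lambda>w. \<^bold>\<exists>x. T x \<^bold>\<and> s x w) a"
            using cont T[THEN forces_mono[OF kr]] s(2) by (rule cont_sup)
          moreover have "k \<tturnstile> u \<^bold>\<in> E"
            using forces_mono[OF kt u] by (rule E.is_ub_mem)
          ultimately show "k \<tturnstile> a \<sqsubseteq>\<^bsub>E\<^esub> u"
          proof (rule E.is_sup_least)
            fix l b assume l: "l \<le> k" and "l \<tturnstile> (\<^bold>\<exists>x. T x \<^bold>\<and> s x b)"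
            from this(2) show "l \<tturnstile> b \<sqsubseteq>\<^bsub>E\<^esub> u"
            proof (rule forces_exE)
              fix m x assume m: "m \<le> l" and x: "m \<tturnstile> (T x \<^bold>\<and> s x b)"
              have mk: "m \<le> k" and mq: "m \<le> q"
                using m l kr r by auto
              have "m \<tturnstile> x \<^bold>\<in> D"
                using forces_mono[OF mk cont] x by (auto intro: cont_memL)
              \<comment> \<open>The value \<open>c\<close> of the pointwise supremum at
                \<open>x\<close> lies between \<open>b\<close> and \<open>u\<close>.\<close>
              from total[OF mq this] show "m \<tturnstile> b \<sqsubseteq>\<^bsub>E\<^esub> u"
              proof (rule forces_exE)
                fix n c assume n: "n \<le> m" and c: "n \<tturnstile> pointwise_sup S x c"
                have nk: "n \<le> k" and nt: "n \<le> t"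
                  using n mk kt by auto
                have "n \<tturnstile> vals S x b"
                  using forces_mono[OF n x] by (intro valsI[of _ S s, OF forces_mono[OF nk s(1)]]) simp
                then have "n \<tturnstile> b \<sqsubseteq>\<^bsub>E\<^esub> c"
                  by (rule E.is_sup_upper[OF pointwise_sup_sup[OF c]])
                moreover have "n \<tturnstile> c \<sqsubseteq>\<^bsub>E\<^esub> u"
                  using c forces_mono[OF n x]
                  by (intro E.is_ub_upper[OF forces_mono[OF nt u]] forces_exI[of _ _ x]) simp
                ultimately show "n \<tturnstile> b \<sqsubseteq>\<^bsub>E\<^esub> u"
                  by (rule E.le_trans)
              qed
            qed
          qed
        qed
      qed
    qed
  qed (rule total)
qed

lemma pointwise_sup_is_sup:
  assumes S: "q \<tturnstile> is_subset (eq fn_space) S"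
    and ex: "\<And>r x. r \<le> q \<Longrightarrow> r \<tturnstile> x \<^bold>\<in> D \<Longrightarrow> r \<tturnstile> (\<^bold>\<exists>y. is_sup E (vals S x) y)"
  shows "q \<tturnstile> is_sup fn_space S (pointwise_sup S)"
proof (rule exp.is_supI)
  have cont: "q \<tturnstile> continuous (pointwise_sup S)"
    using S ex by (rule pointwise_sup_continuous)
  then show "q \<tturnstile> pointwise_sup S \<^bold>\<in> fn_space"
    by (simp only: exp_mem_iff)
  fix r assume r: "r \<le> q"
  note S = forces_mono[OF r S] and cont = forces_mono[OF r cont]
  show "r \<tturnstile> s \<sqsubseteq>\<^bsub>fn_space\<^esub> pointwise_sup S" if s: "r \<tturnstile> S s" for s
    using subset_cont[OF S s] cont
  proof (rule exp_leI)
    fix t x y y' assume t: "t \<le> r" and "t \<tturnstile> s x y" and "t \<tturnstile> pointwise_sup S x y'"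
    then show "t \<tturnstile> y \<sqsubseteq>\<^bsub>E\<^esub> y'"
      using valsI[of _ S s, OF forces_mono[OF t s]] by (blast intro: E.is_sup_upper pointwise_sup_sup)
  qed
  fix G assume G: "r \<tturnstile> is_ub fn_space S G"
  have G': "r \<tturnstile> continuous G"
    using exp.is_ub_mem[OF G] by (simp only: exp_mem_iff)
  show "r \<tturnstile> pointwise_sup S \<sqsubseteq>\<^bsub>fn_space\<^esub> G"
    using cont G'
  proof (rule exp_leI)
    fix t x y v assume t: "t \<le> r" and y: "t \<tturnstile> pointwise_sup S x y" and v: "t \<tturnstile> G x v"
    show "t \<tturnstile> y \<sqsubseteq>\<^bsub>E\<^esub> v"
      using pointwise_sup_sup[OF y] cont_memR[OF forces_mono[OF t G'] v]
    proof (rule E.is_sup_least)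
      fix u a assume u: "u \<le> t" and "u \<tturnstile> vals S x a"
      from this(2) show "u \<tturnstile> a \<sqsubseteq>\<^bsub>E\<^esub> v"
      proof (rule valsE)
        fix k s assume k: "k \<le> u" and s: "k \<tturnstile> S s" "k \<tturnstile> s x a"
        have kt: "k \<le> t" and kr: "k \<le> r"
          using k u t by auto
        show "k \<tturnstile> a \<sqsubseteq>\<^bsub>E\<^esub> v"
          using exp.is_ub_upper[OF forces_mono[OF kr G] s(1)] s(2) forces_mono[OF kt v]
          by (rule exp_leD)
      qed
    qed
  qed
qed

text \<open>The members of \<open>S\<close> that provide \<open>y\<close> and \<open>y'\<close> have
  an upper bound \<open>g\<close> in \<open>S\<close>; its value at \<open>x\<close>, which exists
  locally, is above both.\<close>

lemma directed_vals:
  assumes S: "q \<tturnstile> directed fn_space S" and x: "q \<tturnstile> x \<^bold>\<in> D"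
  shows "q \<tturnstile> directed E (vals S x)"
proof (rule E.directedI)
  note sub = exp.directed_subset[OF S]
  show "q \<tturnstile> is_subset (eq E) (vals S x)"
    using sub by (rule vals_subset)
  show "q \<tturnstile> (\<^bold>\<exists>y. vals S x y)"
    using exp.directed_inhabited[OF S]
  proof (rule forces_exE)
    fix r s assume r: "r \<le> q" and s: "r \<tturnstile> S s"
    from cont_total[OF subset_cont[OF forces_mono[OF r sub] s] forces_mono[OF r x]]
    show "r \<tturnstile> (\<^bold>\<exists>y. vals S x y)"
      by (rule forces_exE) (blast intro: forces_exI valsI forces_mono[OF _ s])
  qed
  fix r y y' assume r: "r \<le> q" and y: "r \<tturnstile> vals S x y" and y': "r \<tturnstile> vals S x y'"
  from y show "r \<tturnstile> (\<^bold>\<exists>z. vals S x z \<^bold>\<and> y \<sqsubseteq>\<^bsub>E\<^esub> z \<^bold>\<and> y' \<sqsubseteq>\<^bsub>E\<^esub> z)"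
  proof (rule valsE)
    fix t s assume t: "t \<le> r" and s: "t \<tturnstile> S s" "t \<tturnstile> s x y"
    from forces_mono[OF t y'] show "t \<tturnstile> (\<^bold>\<exists>z. vals S x z \<^bold>\<and> y \<sqsubseteq>\<^bsub>E\<^esub> z \<^bold>\<and> y' \<sqsubseteq>\<^bsub>E\<^esub> z)"
    proof (rule valsE)
      fix v s' assume v: "v \<le> t" and s': "v \<tturnstile> S s'" "v \<tturnstile> s' x y'"
      have vq: "v \<le> q"
        using v t r by simp
      from forces_mono[OF vq S] forces_mono[OF v s(1)] s'(1)
      have "v \<tturnstile> (\<^bold>\<exists>g. S g \<^bold>\<and> s \<sqsubseteq>\<^bsub>fn_space\<^esub> g \<^bold>\<and> s' \<sqsubseteq>\<^bsub>fn_space\<^esub> g)"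
        by (rule exp.directed_upper)
      then show "v \<tturnstile> (\<^bold>\<exists>z. vals S x z \<^bold>\<and> y \<sqsubseteq>\<^bsub>E\<^esub> z \<^bold>\<and> y' \<sqsubseteq>\<^bsub>E\<^esub> z)"
      proof (rule forces_exE)
        fix k g
        assume k: "k \<le> v" and "k \<tturnstile> (S g \<^bold>\<and> s \<sqsubseteq>\<^bsub>fn_space\<^esub> g \<^bold>\<and> s' \<sqsubseteq>\<^bsub>fn_space\<^esub> g)"
        then have g: "k \<tturnstile> S g" "k \<tturnstile> s \<sqsubseteq>\<^bsub>fn_space\<^esub> g" "k \<tturnstile> s' \<sqsubseteq>\<^bsub>fn_space\<^esub> g"
          by auto
        have kq: "k \<le> q" and kt: "k \<le> t"
          using k vq v by auto
        from cont_total[OF subset_cont[OF forces_mono[OF kq sub] g(1)] forces_mono[OF kq x]]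
        show "k \<tturnstile> (\<^bold>\<exists>z. vals S x z \<^bold>\<and> y \<sqsubseteq>\<^bsub>E\<^esub> z \<^bold>\<and> y' \<sqsubseteq>\<^bsub>E\<^esub> z)"
        proof (rule forces_exE)
          fix l z assume l: "l \<le> k" and z: "l \<tturnstile> g x z"
          have lt: "l \<le> t" and lv: "l \<le> v"
            using l kt k by auto
          show "l \<tturnstile> (\<^bold>\<exists>z. vals S x z \<^bold>\<and> y \<sqsubseteq>\<^bsub>E\<^esub> z \<^bold>\<and> y' \<sqsubseteq>\<^bsub>E\<^esub> z)"
            using valsI[of _ S g, OF forces_mono[OF l g(1)] z]
              exp_leD[OF forces_mono[OF l g(2)] forces_mono[OF lt s(2)] z]
              exp_leD[OF forces_mono[OF l g(3)] forces_mono[OF lv s'(2)] z]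
            by (intro forces_exI[of _ _ z]) simp
        qed
      qed
    qed
  qed
qed

lemma directed_vals_sup:
  assumes "q \<tturnstile> directed fn_space S" and "r \<le> q" and "r \<tturnstile> x \<^bold>\<in> D"
  shows "r \<tturnstile> (\<^bold>\<exists>y. is_sup E (vals S x) y)"
  using forces_mono[OF assms(2,1)] assms(3) by (intro E_directed_sup directed_vals)

text \<open>The value at \<open>x\<close> of an upper bound \<open>G\<close> bounds all the values
  at \<open>x\<close>, so bounded completeness of \<open>E\<close> applies.\<close>

lemma bounded_vals_sup:
  assumes S: "q \<tturnstile> is_subset (eq fn_space) S" "q \<tturnstile> is_bounded fn_space S"
    and r: "r \<le> q" and x: "r \<tturnstile> x \<^bold>\<in> D"
  shows "r \<tturnstile> (\<^bold>\<exists>y. is_sup E (vals S x) y)"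
  using forces_mono[OF r S(2)] unfolding is_bounded_def
proof (rule forces_exE)
  fix t G assume t: "t \<le> r" and G: "t \<tturnstile> is_ub fn_space S G"
  have tq: "t \<le> q"
    using t r by simp
  have cont: "t \<tturnstile> continuous G"
    using exp.is_ub_mem[OF G] by (simp only: exp_mem_iff)
  from cont_total[OF cont forces_mono[OF t x]] show "t \<tturnstile> (\<^bold>\<exists>y. is_sup E (vals S x) y)"
  proof (rule forces_exE)
    fix v g assume v: "v \<le> t" and g: "v \<tturnstile> G x g"
    have vq: "v \<le> q"
      using v tq by simp
    have "v \<tturnstile> is_ub E (vals S x) g"
    proof (rule E.is_ubI)
      show "v \<tturnstile> g \<^bold>\<in> E"
        using forces_mono[OF v cont] g by (rule cont_memR)
      fix k y assume k: "k \<le> v" and "k \<tturnstile> vals S x y"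
      from this(2) show "k \<tturnstile> y \<sqsubseteq>\<^bsub>E\<^esub> g"
      proof (rule valsE)
        fix l s assume l: "l \<le> k" and s: "l \<tturnstile> S s" "l \<tturnstile> s x y"
        have lv: "l \<le> v" and lt: "l \<le> t"
          using l k v by auto
        show "l \<tturnstile> y \<sqsubseteq>\<^bsub>E\<^esub> g"
          using exp.is_ub_upper[OF forces_mono[OF lt G] s(1)] s(2) forces_mono[OF lv g]
          by (rule exp_leD)
      qed
    qed
    with vals_subset[OF forces_mono[OF vq S(1)]] show "v \<tturnstile> (\<^bold>\<exists>y. is_sup E (vals S x) y)"
      by (rule E_bounded_sup)
  qed
qed

text \<open>Suprema are unique up to internal equality, so an arbitrary supremum \<open>F\<close>
  has the graph of the pointwise one.\<close>

lemma sup_vals: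
  assumes S: "q \<tturnstile> is_subset (eq fn_space) S"
    and ex: "\<And>r x. r \<le> q \<Longrightarrow> r \<tturnstile> x \<^bold>\<in> D \<Longrightarrow> r \<tturnstile> (\<^bold>\<exists>y. is_sup E (vals S x) y)"
    and F: "q \<tturnstile> is_sup fn_space S F" and y: "q \<tturnstile> F x y"
  shows "q \<tturnstile> is_sup E (vals S x) y"
  using exp_eqD[OF exp.is_sup_unique[OF F pointwise_sup_is_sup[OF S ex]] y]
  by (rule pointwise_sup_sup)

lemma exp_dcpo: "q \<tturnstile> dcpo fn_space"
  unfolding dcpo_def forces_simps
proof (intro conjI ballI allI impI)
  fix S r assume S: "r \<tturnstile> directed fn_space S"
  show "r \<tturnstile> (\<^bold>\<exists>z. is_sup fn_space S z)"
    by (rule forces_exI, rule pointwise_sup_is_sup[OF exp.directed_subset[OF S]])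
      (rule directed_vals_sup[OF S])
qed (rule exp.forces_poset)

lemma exp_bounded_complete: "q \<tturnstile> bounded_complete fn_space"
  unfolding bounded_complete_def forces_simps
proof (intro conjI ballI allI impI; (elim conjE)?)
  fix S r assume S: "r \<tturnstile> is_subset (eq fn_space) S" "r \<tturnstile> is_bounded fn_space S"
  show "r \<tturnstile> (\<^bold>\<exists>z. is_sup fn_space S z)"
    by (rule forces_exI, rule pointwise_sup_is_sup[OF S(1)]) (rule bounded_vals_sup[OF S])
qed (rule exp.forces_poset)

end

section \<open>Step functions\<close>

context forced_poset
begin

section \<open>Least elements and comparisons of compact elements\<close>

lemma is_least_mem: "q \<tturnstile> is_least P z \<Longrightarrow> q \<tturnstile> z \<^bold>\<in> P"
  by (simp add: is_least_def)

lemma is_least_le: "q \<tturnstile> is_least P z \<Longrightarrow> q \<tturnstile> x \<^bold>\<in> P \<Longrightarrow> q \<tturnstile> z \<sqsubseteq> x"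
  unfolding is_least_def forces_simps by blast

text \<open>Seen as an empty supremum, the least element is compact by the result on finite suprema,
  and the exponential obtains one from the pointwise construction.\<close>

lemma is_least_iff_sup_empty: "q \<tturnstile> is_least P z \<longleftrightarrow> q \<tturnstile> is_sup P (\<lambda>_. bot) z"
proof
  assume z: "q \<tturnstile> is_least P z"
  show "q \<tturnstile> is_sup P (\<lambda>_. bot) z"
    using is_least_mem[OF z]
    by (rule is_supI) (blast intro: forces_botE is_least_le forces_mono[OF _ z] is_ub_mem)+
next
  assume z: "q \<tturnstile> is_sup P (\<lambda>_. bot) z"
  then show "q \<tturnstile> is_least P z"
    unfolding is_least_def forces_simps
    by (blast intro: is_sup_mem is_sup_least forces_mono forces_botE)
qed

lemma is_least_compact: "q \<tturnstile> is_least P z \<Longrightarrow> q \<tturnstile> is_compact P z"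
  unfolding is_least_iff_sup_empty by (rule enumerated_sup_compact[OF enumerates_empty]) simp_all

text \<open>Equality with the least element becomes a single comparison, so that results on
  decidable comparisons apply to it.\<close>

lemma eq_bot_iff:
  assumes z: "q \<tturnstile> is_least P z" and x: "q \<tturnstile> x \<^bold>\<in> P"
  shows "q \<tturnstile> eq_bot P x \<longleftrightarrow> q \<tturnstile> x \<sqsubseteq> z"
proof
  assume "q \<tturnstile> eq_bot P x"
  then show "q \<tturnstile> x \<sqsubseteq> z"
    unfolding eq_bot_def
  proof (rule forces_exE)
    fix r y assume r: "r \<le> q" and y: "r \<tturnstile> (is_least P y \<^bold>\<and> x \<doteq> y)"
    have "r \<tturnstile> y \<sqsubseteq> z"
      using y is_least_mem[OF forces_mono[OF r z]] by (auto intro: is_least_le)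
    then show "r \<tturnstile> x \<sqsubseteq> z"
      using y by (auto intro: le_trans eq_le)
  qed
next
  assume "q \<tturnstile> x \<sqsubseteq> z"
  then have "q \<tturnstile> x \<doteq> z"
    using is_least_le[OF z x] by (rule le_antisym)
  then show "q \<tturnstile> eq_bot P x"
    unfolding eq_bot_def using z by (intro forces_exI[of _ _ z]) simp
qed

text \<open>For compact \<open>a\<close> the propositions \<open>a \<sqsubseteq> b\<close> and
  \<open>way_below P a b\<close> agree at every stage, so decidability passes both ways.\<close>

lemma decidable_way_below_iff:
  "q \<tturnstile> (\<^bold>\<forall>a b. is_compact P a \<^bold>\<and> is_compact P b \<^bold>\<longrightarrow> decidable (a \<sqsubseteq> b)) \<longleftrightarrow>
   q \<tturnstile> (\<^bold>\<forall>a b. is_compact P a \<^bold>\<and> is_compact P b \<^bold>\<longrightarrow> decidable (way_below P a b))"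
proof -
  have *: "r \<tturnstile> decidable (a \<sqsubseteq> b) \<longleftrightarrow> r \<tturnstile> decidable (way_below P a b)" if "r \<tturnstile> is_compact P a" for r a b
    using compact_way_below_iff[OF forces_mono[OF _ that]]
    by (meson forces_decidable_cong)
  show ?thesis
    unfolding forces_simps using * by blast
qed

end

context forced_exponential
begin

section \<open>Values, continuity and compactness of step functions\<close>

lemma step_value: "q \<tturnstile> step D E a b d y \<longleftrightarrow>
    q \<tturnstile> d \<^bold>\<in> D \<and> q \<tturnstile> is_sup E (\<lambda>w. w \<doteq>\<^bsub>E\<^esub> b \<^bold>\<and> a \<sqsubseteq>\<^bsub>D\<^esub> d) y"
  by (simp add: step_def)

text \<open>The set in question is bounded by \<open>b\<close>, so bounded completeness of
  \<open>E\<close> yields its supremum without a decision on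
  \<open>a \<sqsubseteq> d\<close>.\<close>

lemma step_total:
  assumes b: "q \<tturnstile> b \<^bold>\<in> E" and d: "q \<tturnstile> d \<^bold>\<in> D"
  shows "q \<tturnstile> (\<^bold>\<exists>y. step D E a b d y)"
proof -
  have "q \<tturnstile> is_subset (eq E) (\<lambda>w. w \<doteq>\<^bsub>E\<^esub> b \<^bold>\<and> a \<sqsubseteq>\<^bsub>D\<^esub> d)"
    unfolding is_subset_def forces_simps by (blast intro: E.eq_memL E.eq_trans E.eq_sym)
  moreover have "q \<tturnstile> is_ub E (\<lambda>w. w \<doteq>\<^bsub>E\<^esub> b \<^bold>\<and> a \<sqsubseteq>\<^bsub>D\<^esub> d) b"
    using b by (rule E.is_ubI) (simp add: E.eq_le)
  ultimately have "q \<tturnstile> (\<^bold>\<exists>y. is_sup E (\<lambda>w. w \<doteq>\<^bsub>E\<^esub> b \<^bold>\<and> a \<sqsubseteq>\<^bsub>D\<^esub> d) y)"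
    by (rule E_bounded_sup)
  then show ?thesis
  proof (rule forces_exE)
    fix r y assume r: "r \<le> q" and "r \<tturnstile> is_sup E (\<lambda>w. w \<doteq>\<^bsub>E\<^esub> b \<^bold>\<and> a \<sqsubseteq>\<^bsub>D\<^esub> d) y"
    then show "r \<tturnstile> (\<^bold>\<exists>y. step D E a b d y)"
      using forces_mono[OF r d] by (intro forces_exI[of _ _ y]) (simp only: step_value)
  qed
qed

lemma step_memR: "q \<tturnstile> step D E a b d y \<Longrightarrow> q \<tturnstile> y \<^bold>\<in> E"
  unfolding step_value by (blast intro: E.is_sup_mem)

lemma step_upper: "q \<tturnstile> step D E a b d y \<Longrightarrow> q \<tturnstile> b \<^bold>\<in> E \<Longrightarrow> q \<tturnstile> a \<sqsubseteq>\<^bsub>D\<^esub> d \<Longrightarrow> q \<tturnstile> b \<sqsubseteq>\<^bsub>E\<^esub> y"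
  unfolding step_value by (drule conjunct2, drule E.is_sup_upper) auto

text \<open>The bound \<open>u\<close> has to be above \<open>b\<close> just at the stages where
  \<open>a \<sqsubseteq> d\<close> holds. This universal property replaces a case distinction on
  \<open>a \<sqsubseteq> d\<close>.\<close>

lemma step_least:
  assumes "q \<tturnstile> step D E a b d y" and "q \<tturnstile> u \<^bold>\<in> E"
    and "\<And>r. r \<le> q \<Longrightarrow> r \<tturnstile> a \<sqsubseteq>\<^bsub>D\<^esub> d \<Longrightarrow> r \<tturnstile> b \<sqsubseteq>\<^bsub>E\<^esub> u"
  shows "q \<tturnstile> y \<sqsubseteq>\<^bsub>E\<^esub> u"
proof (rule E.is_sup_least)
  show "q \<tturnstile> is_sup E (\<lambda>w. w \<doteq>\<^bsub>E\<^esub> b \<^bold>\<and> a \<sqsubseteq>\<^bsub>D\<^esub> d) y"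
    using assms(1) by (simp only: step_value)
  fix r w assume "r \<le> q" and "r \<tturnstile> (w \<doteq>\<^bsub>E\<^esub> b \<^bold>\<and> a \<sqsubseteq>\<^bsub>D\<^esub> d)"
  then show "r \<tturnstile> w \<sqsubseteq>\<^bsub>E\<^esub> u"
    using assms(3) by (auto intro: E.le_trans E.eq_le)
qed (rule assms(2))

text \<open>Suprema are preserved because \<open>a\<close> is compact: where
  \<open>a \<sqsubseteq> z\<close> holds, some \<open>x\<close> in \<open>T\<close> satisfies
  \<open>a \<sqsubseteq> x\<close>, and there the step function is already above
  \<open>b\<close>.\<close>

lemma step_continuous:
  assumes a: "q \<tturnstile> is_compact D a" and b: "q \<tturnstile> b \<^bold>\<in> E"
  shows "q \<tturnstile> continuous (step D E a b)"
proof (rule continuousI)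
  fix r d y assume r: "r \<le> q" and y: "r \<tturnstile> step D E a b d y"
  show d: "r \<tturnstile> d \<^bold>\<in> D"
    using y by (simp only: step_value)
  show "r \<tturnstile> y \<^bold>\<in> E"
    using y by (rule step_memR)
  show "r \<tturnstile> y \<doteq>\<^bsub>E\<^esub> y'" if "r \<tturnstile> step D E a b d y'" for y'
    using y that unfolding step_value by (blast intro: E.is_sup_unique)
  fix d' y' assume d': "r \<tturnstile> d \<doteq>\<^bsub>D\<^esub> d'" and y': "r \<tturnstile> y \<doteq>\<^bsub>E\<^esub> y'"
  have iff: "t \<tturnstile> a \<sqsubseteq>\<^bsub>D\<^esub> d \<longleftrightarrow> t \<tturnstile> a \<sqsubseteq>\<^bsub>D\<^esub> d'" if t: "t \<le> r" for t
    using forces_mono[OF t d'] by (blast intro: D.le_trans D.eq_le D.eq_ge)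
  have "r \<tturnstile> is_sup E (\<lambda>w. w \<doteq>\<^bsub>E\<^esub> b \<^bold>\<and> a \<sqsubseteq>\<^bsub>D\<^esub> d) y'"
    using y y' unfolding step_value by (blast intro: E.is_sup_eq)
  then have "r \<tturnstile> is_sup E (\<lambda>w. w \<doteq>\<^bsub>E\<^esub> b \<^bold>\<and> a \<sqsubseteq>\<^bsub>D\<^esub> d') y'"
    by (rule E.is_sup_cong[rotated]) (simp add: iff)
  then show "r \<tturnstile> step D E a b d' y'"
    using D.eq_memR[OF d'] by (simp only: step_value)
next
  fix r d assume r: "r \<le> q" and d: "r \<tturnstile> d \<^bold>\<in> D"
  show "r \<tturnstile> (\<^bold>\<exists>y. step D E a b d y)"
    using forces_mono[OF r b] d by (rule step_total)
next
  fix r T z y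
  assume r: "r \<le> q" and T: "r \<tturnstile> directed D T" "r \<tturnstile> is_sup D T z" and y: "r \<tturnstile> step D E a b z y"
  note a = forces_mono[OF r a] and b = forces_mono[OF r b]
  show "r \<tturnstile> is_sup E (\<lambda>w. \<^bold>\<exists>x. T x \<^bold>\<and> step D E a b x w) y"
  proof (rule E.is_supI)
    show "r \<tturnstile> y \<^bold>\<in> E"
      using y by (rule step_memR)
    fix t w assume t: "t \<le> r" and "t \<tturnstile> (\<^bold>\<exists>x. T x \<^bold>\<and> step D E a b x w)"
    from this(2) show "t \<tturnstile> w \<sqsubseteq>\<^bsub>E\<^esub> y"
    proof (rule forces_exE)
      fix v x assume v: "v \<le> t" and x: "v \<tturnstile> (T x \<^bold>\<and> step D E a b x w)"
      have vr: "v \<le> r"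
        using v t by simp
      note y = forces_mono[OF vr y]
      have w: "v \<tturnstile> step D E a b x w"
        using x by simp
      have le: "v \<tturnstile> x \<sqsubseteq>\<^bsub>D\<^esub> z"
        using x forces_mono[OF vr T(2)] by (auto intro: D.is_sup_upper)
      show "v \<tturnstile> w \<sqsubseteq>\<^bsub>E\<^esub> y"
        using w step_memR[OF y]
      proof (rule step_least)
        fix u assume u: "u \<le> v" and "u \<tturnstile> a \<sqsubseteq>\<^bsub>D\<^esub> x"
        then have "u \<tturnstile> a \<sqsubseteq>\<^bsub>D\<^esub> z"
          using forces_mono[OF u le] by (blast intro: D.le_trans)
        then show "u \<tturnstile> b \<sqsubseteq>\<^bsub>E\<^esub> y"
          using forces_mono[OF u y] forces_mono[OF order_trans[OF u vr] b] by (blast intro: step_upper)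
      qed
    qed
  next
    fix t u assume t: "t \<le> r" and u: "t \<tturnstile> is_ub E (\<lambda>w. \<^bold>\<exists>x. T x \<^bold>\<and> step D E a b x w) u"
    show "t \<tturnstile> y \<sqsubseteq>\<^bsub>E\<^esub> u"
      using forces_mono[OF t y] E.is_ub_mem[OF u]
    proof (rule step_least)
      fix v assume v: "v \<le> t" and az: "v \<tturnstile> a \<sqsubseteq>\<^bsub>D\<^esub> z"
      have vr: "v \<le> r"
        using v t by simp
      have "v \<tturnstile> (\<^bold>\<exists>x. T x \<^bold>\<and> a \<sqsubseteq>\<^bsub>D\<^esub> x)"
        using forces_mono[OF vr a] T[THEN forces_mono[OF vr]] az by (rule D.compactD)
      then show "v \<tturnstile> b \<sqsubseteq>\<^bsub>E\<^esub> u"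
      proof (rule forces_exE)
        fix k x assume k: "k \<le> v" and x: "k \<tturnstile> (T x \<^bold>\<and> a \<sqsubseteq>\<^bsub>D\<^esub> x)"
        have kr: "k \<le> r" and kt: "k \<le> t"
          using k v t by auto
        have "k \<tturnstile> x \<^bold>\<in> D"
          using x by (auto intro: D.le_memR)
        from step_total[OF forces_mono[OF kr b] this] show "k \<tturnstile> b \<sqsubseteq>\<^bsub>E\<^esub> u"
        proof (rule forces_exE)
          fix l w assume l: "l \<le> k" and w: "l \<tturnstile> step D E a b x w"
          have lr: "l \<le> r" and lt: "l \<le> t"
            using l kr kt by auto
          have "l \<tturnstile> b \<sqsubseteq>\<^bsub>E\<^esub> w"
            using w forces_mono[OF lr b] forces_mono[OF l x] by (auto intro: step_upper)
          moreover have "l \<tturnstile> w \<sqsubseteq>\<^bsub>E\<^esub> u"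
            using w forces_mono[OF l x]
            by (intro E.is_ub_upper[OF forces_mono[OF lt u]] forces_exI[of _ _ x]) simp
          ultimately show "l \<tturnstile> b \<sqsubseteq>\<^bsub>E\<^esub> u"
            by (rule E.le_trans)
        qed
      qed
    qed
  qed
qed

text \<open>In one direction, evaluate at \<open>a\<close>, where the step function is above
  \<open>b\<close>; in the other, wherever \<open>a \<sqsubseteq> d\<close> holds, monotonicity of
  \<open>g\<close> puts its value at \<open>d\<close> above \<open>y\<close>.\<close>

lemma step_le_iff:
  assumes a: "q \<tturnstile> is_compact D a" and b: "q \<tturnstile> b \<^bold>\<in> E"
    and g: "q \<tturnstile> continuous g" and y: "q \<tturnstile> g a y"
  shows "q \<tturnstile> step D E a b \<sqsubseteq>\<^bsub>fn_space\<^esub> g \<longleftrightarrow> q \<tturnstile> b \<sqsubseteq>\<^bsub>E\<^esub> y"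
proof
  assume le: "q \<tturnstile> step D E a b \<sqsubseteq>\<^bsub>fn_space\<^esub> g"
  have a': "q \<tturnstile> a \<^bold>\<in> D"
    using a by (rule D.compact_mem)
  from step_total[OF b a'] show "q \<tturnstile> b \<sqsubseteq>\<^bsub>E\<^esub> y"
  proof (rule forces_exE)
    fix r w assume r: "r \<le> q" and w: "r \<tturnstile> step D E a b a w"
    have "r \<tturnstile> b \<sqsubseteq>\<^bsub>E\<^esub> w"
      using w forces_mono[OF r b] D.le_refl[OF forces_mono[OF r a']] by (rule step_upper)
    moreover have "r \<tturnstile> w \<sqsubseteq>\<^bsub>E\<^esub> y"
      using forces_mono[OF r le] w forces_mono[OF r y] by (rule exp_leD)
    ultimately show "r \<tturnstile> b \<sqsubseteq>\<^bsub>E\<^esub> y"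
      by (rule E.le_trans)
  qed
next
  assume le: "q \<tturnstile> b \<sqsubseteq>\<^bsub>E\<^esub> y"
  show "q \<tturnstile> step D E a b \<sqsubseteq>\<^bsub>fn_space\<^esub> g"
    using step_continuous[OF a b] g
  proof (rule exp_leI)
    fix r d w v assume r: "r \<le> q" and w: "r \<tturnstile> step D E a b d w" and v: "r \<tturnstile> g d v"
    show "r \<tturnstile> w \<sqsubseteq>\<^bsub>E\<^esub> v"
      using w cont_memR[OF forces_mono[OF r g] v]
    proof (rule step_least)
      fix t assume t: "t \<le> r" and ad: "t \<tturnstile> a \<sqsubseteq>\<^bsub>D\<^esub> d"
      have tq: "t \<le> q"
        using t r by simp
      show "t \<tturnstile> b \<sqsubseteq>\<^bsub>E\<^esub> v"
        using forces_mono[OF tq le]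
          cont_mono[OF forces_mono[OF tq g] ad forces_mono[OF tq y] forces_mono[OF t v]]
        by (rule E.le_trans)
    qed
  qed
qed

text \<open>By \<open>step_le_iff\<close> the question moves to \<open>E\<close>: \<open>b\<close>
  is below the value of \<open>G\<close> at \<open>a\<close>, which is the directed supremum of the
  values of members of \<open>T\<close>. Compactness of \<open>b\<close> selects a member, and
  \<open>step_le_iff\<close> moves the answer back.\<close>

lemma step_compact:
  assumes a: "q \<tturnstile> is_compact D a" and b: "q \<tturnstile> is_compact E b"
  shows "q \<tturnstile> is_compact fn_space (step D E a b)"
proof (rule exp.compactI)
  have b': "q \<tturnstile> b \<^bold>\<in> E"
    using b by (rule E.compact_mem)
  show "q \<tturnstile> step D E a b \<^bold>\<in> fn_space"
    unfolding exp_mem_iff using a b' by (rule step_continuous)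
  fix r T G
  assume r: "r \<le> q" and T: "r \<tturnstile> directed fn_space T" and G: "r \<tturnstile> is_sup fn_space T G"
    and le: "r \<tturnstile> step D E a b \<sqsubseteq>\<^bsub>fn_space\<^esub> G"
  note a = forces_mono[OF r a] and b = forces_mono[OF r b] and b' = forces_mono[OF r b']
  note a' = D.compact_mem[OF a]
  note sub = exp.directed_subset[OF T]
  have cont: "r \<tturnstile> continuous G"
    using exp.is_sup_mem[OF G] by (simp only: exp_mem_iff)
  from cont_total[OF cont a'] show "r \<tturnstile> (\<^bold>\<exists>s. T s \<^bold>\<and> step D E a b \<sqsubseteq>\<^bsub>fn_space\<^esub> s)"
  proof (rule forces_exE)
    fix t y assume t: "t \<le> r" and y: "t \<tturnstile> G a y"
    note T = forces_mono[OF t T]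
    have "t \<tturnstile> b \<sqsubseteq>\<^bsub>E\<^esub> y"
      using forces_mono[OF t le]
      by (simp only: step_le_iff[OF forces_mono[OF t a] forces_mono[OF t b'] forces_mono[OF t cont] y])
    moreover have "t \<tturnstile> is_sup E (vals T a) y"
      using exp.directed_subset[OF T] directed_vals_sup[OF T] forces_mono[OF t G] y
      by (rule sup_vals)
    moreover have "t \<tturnstile> directed E (vals T a)"
      using T forces_mono[OF t a'] by (rule directed_vals)
    ultimately have "t \<tturnstile> (\<^bold>\<exists>w. vals T a w \<^bold>\<and> b \<sqsubseteq>\<^bsub>E\<^esub> w)"
      using forces_mono[OF t b] by (blast intro: E.compactD)
    then show "t \<tturnstile> (\<^bold>\<exists>s. T s \<^bold>\<and> step D E a b \<sqsubseteq>\<^bsub>fn_space\<^esub> s)"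
    proof (rule forces_exE)
      fix v w assume v: "v \<le> t" and w: "v \<tturnstile> (vals T a w \<^bold>\<and> b \<sqsubseteq>\<^bsub>E\<^esub> w)"
      then have "v \<tturnstile> vals T a w"
        by simp
      then show "v \<tturnstile> (\<^bold>\<exists>s. T s \<^bold>\<and> step D E a b \<sqsubseteq>\<^bsub>fn_space\<^esub> s)"
      proof (rule valsE)
        fix k s assume k: "k \<le> v" and s: "k \<tturnstile> T s" "k \<tturnstile> s a w"
        have kr: "k \<le> r"
          using k v t by auto
        have cont: "k \<tturnstile> continuous s"
          using forces_mono[OF kr sub] s(1) by (rule subset_cont)
        have "k \<tturnstile> step D E a b \<sqsubseteq>\<^bsub>fn_space\<^esub> s"
          using step_le_iff[OF forces_mono[OF kr a] forces_mono[OF kr b'] cont s(2)]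
            forces_mono[OF k w] by simp
        then show "k \<tturnstile> (\<^bold>\<exists>s. T s \<^bold>\<and> step D E a b \<sqsubseteq>\<^bsub>fn_space\<^esub> s)"
          using s(1) by (intro forces_exI[of _ _ s]) simp
      qed
    qed
  qed
qed

section \<open>Step functions as generators of the exponential\<close>

text \<open>Equality with a step function is the internal one, so the predicate is closed under it,
  as a set of generators must be.\<close>

definition steps :: "('a \<Rightarrow> 'b \<Rightarrow> 'h) \<Rightarrow> 'h" where
  "steps s = (\<^bold>\<exists>a b. is_compact D a \<^bold>\<and> is_compact E b \<^bold>\<and> s \<doteq>\<^bsub>fn_space\<^esub> step D E a b)"

lemma stepsE:
  assumes "q \<tturnstile> steps s"
    and "\<And>r a b. r \<le> q \<Longrightarrow> r \<tturnstile> is_compact D a \<Longrightarrow> r \<tturnstile> is_compact E b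
      \<Longrightarrow> r \<tturnstile> s \<doteq>\<^bsub>fn_space\<^esub> step D E a b \<Longrightarrow> r \<tturnstile> \<chi>"
  shows "q \<tturnstile> \<chi>"
  using assms(1) unfolding steps_def
proof (elim forces_exE)
  fix r a t b assume "r \<le> q" and "t \<le> r"
    and "t \<tturnstile> (is_compact D a \<^bold>\<and> is_compact E b \<^bold>\<and> s \<doteq>\<^bsub>fn_space\<^esub> step D E a b)"
  then show "t \<tturnstile> \<chi>"
    by (intro assms(2)[of t a b]) auto
qed

lemma stepsI:
  "q \<tturnstile> is_compact D a \<Longrightarrow> q \<tturnstile> is_compact E b \<Longrightarrow> q \<tturnstile> s \<doteq>\<^bsub>fn_space\<^esub> step D E a b \<Longrightarrow> q \<tturnstile> steps s"
  unfolding steps_def by (rule forces_exI[of _ _ a], rule forces_exI[of _ _ b]) simp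

lemma steps_compact: "q \<tturnstile> steps s \<Longrightarrow> q \<tturnstile> is_compact fn_space s"
  by (erule stepsE) (blast intro: exp.compact_cong step_compact exp_eq_sym)

lemma steps_cong:
  assumes "q \<tturnstile> steps s" and eq: "q \<tturnstile> s \<doteq>\<^bsub>fn_space\<^esub> s'"
  shows "q \<tturnstile> steps s'"
  using assms(1)
proof (rule stepsE)
  fix r a b assume r: "r \<le> q" and ab: "r \<tturnstile> is_compact D a" "r \<tturnstile> is_compact E b"
    and "r \<tturnstile> s \<doteq>\<^bsub>fn_space\<^esub> step D E a b"
  then show "r \<tturnstile> steps s'"
    using exp.eq_trans[OF exp.eq_sym[OF forces_mono[OF r eq]]] by (intro stepsI)
qed

text \<open>
  Continuity determines a function by its values at compact elements, and each of these is
  the supremum of the compact \<open>b\<close> below it, that is, of the values of the step functions below.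
\<close>

lemma steps_dense:
  assumes "q \<tturnstile> f \<^bold>\<in> fn_space"
  shows "q \<tturnstile> is_sup fn_space (\<lambda>s. steps s \<^bold>\<and> s \<sqsubseteq>\<^bsub>fn_space\<^esub> f) f"
  using assms
proof (rule exp.is_supI)
  fix r G assume r: "r \<le> q" and G: "r \<tturnstile> is_ub fn_space (\<lambda>s. steps s \<^bold>\<and> s \<sqsubseteq>\<^bsub>fn_space\<^esub> f) G"
  have f: "r \<tturnstile> continuous f" and G': "r \<tturnstile> continuous G"
    using forces_mono[OF r assms] exp.is_ub_mem[OF G] by (simp_all only: exp_mem_iff)
  show "r \<tturnstile> f \<sqsubseteq>\<^bsub>fn_space\<^esub> G"
    using f G'
  proof (rule exp_leI)
    fix t x y v assume t: "t \<le> r" and y: "t \<tturnstile> f x y" and v: "t \<tturnstile> G x v"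
    note f = forces_mono[OF t f] and G' = forces_mono[OF t G']
    have x: "t \<tturnstile> x \<^bold>\<in> D"
      using f y by (rule cont_memL)
    have v': "t \<tturnstile> v \<^bold>\<in> E"
      using G' v by (rule cont_memR)
    have "t \<tturnstile> is_sup E (\<lambda>w. \<^bold>\<exists>a. (is_compact D a \<^bold>\<and> a \<sqsubseteq>\<^bsub>D\<^esub> x) \<^bold>\<and> f a w) y"
      using f D_basis[OF x] y by (rule cont_sup)
    then show "t \<tturnstile> y \<sqsubseteq>\<^bsub>E\<^esub> v"
      using v'
    proof (rule E.is_sup_least)
      fix u w assume u: "u \<le> t" and "u \<tturnstile> (\<^bold>\<exists>a. (is_compact D a \<^bold>\<and> a \<sqsubseteq>\<^bsub>D\<^esub> x) \<^bold>\<and> f a w)"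
      from this(2) show "u \<tturnstile> w \<sqsubseteq>\<^bsub>E\<^esub> v"
      proof (rule forces_exE)
        fix k a assume k: "k \<le> u" and a: "k \<tturnstile> ((is_compact D a \<^bold>\<and> a \<sqsubseteq>\<^bsub>D\<^esub> x) \<^bold>\<and> f a w)"
        have kt: "k \<le> t"
          using k u by simp
        note f = forces_mono[OF kt f]
        have "k \<tturnstile> w \<^bold>\<in> E"
          using f a by (auto intro: cont_memR)
        from E_basis[OF this] forces_mono[OF kt v'] show "k \<tturnstile> w \<sqsubseteq>\<^bsub>E\<^esub> v"
        proof (rule E.is_sup_least)
          fix l b assume l: "l \<le> k" and b: "l \<tturnstile> (is_compact E b \<^bold>\<and> b \<sqsubseteq>\<^bsub>E\<^esub> w)"
          have lt: "l \<le> t" and lr: "l \<le> r"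
            using l kt t by auto
          have a': "l \<tturnstile> is_compact D a" "l \<tturnstile> a \<sqsubseteq>\<^bsub>D\<^esub> x" "l \<tturnstile> f a w"
            using forces_mono[OF l a] by auto
          have b': "l \<tturnstile> is_compact E b" "l \<tturnstile> b \<^bold>\<in> E" "l \<tturnstile> b \<sqsubseteq>\<^bsub>E\<^esub> w"
            using b by (auto intro: E.le_memL)
          have "l \<tturnstile> step D E a b \<sqsubseteq>\<^bsub>fn_space\<^esub> f"
            using b'(3) step_le_iff[OF a'(1) b'(2) forces_mono[OF l f] a'(3)] by blast
          moreover have "l \<tturnstile> step D E a b \<^bold>\<in> fn_space"
            unfolding exp_mem_iff using a'(1) b'(2) by (rule step_continuous)
          ultimately have le: "l \<tturnstile> step D E a b \<sqsubseteq>\<^bsub>fn_space\<^esub> G"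
            using stepsI[OF a'(1) b'(1)] by (intro exp.is_ub_upper[OF forces_mono[OF lr G]]) simp
          note G' = forces_mono[OF lt G']
          \<comment> \<open>\<open>b\<close> is below the value of \<open>G\<close> at
            \<open>a\<close>, which is below \<open>v\<close> because
            \<open>a \<sqsubseteq> x\<close>.\<close>
          from cont_total[OF G' D.compact_mem[OF a'(1)]] show "l \<tturnstile> b \<sqsubseteq>\<^bsub>E\<^esub> v"
          proof (rule forces_exE)
            fix m c assume m: "m \<le> l" and c: "m \<tturnstile> G a c"
            have "m \<le> t"
              using m lt by simp
            note v = forces_mono[OF this v] and G' = forces_mono[OF m G']
            have "m \<tturnstile> b \<sqsubseteq>\<^bsub>E\<^esub> c"
              using forces_mono[OF m le]
                step_le_iff[OF forces_mono[OF m a'(1)] forces_mono[OF m b'(2)] G' c] by blast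
            moreover have "m \<tturnstile> c \<sqsubseteq>\<^bsub>E\<^esub> v"
              using G' forces_mono[OF m a'(2)] c v by (rule cont_mono)
            ultimately show "m \<tturnstile> b \<sqsubseteq>\<^bsub>E\<^esub> v"
              by (rule E.le_trans)
          qed
        qed
      qed
    qed
  qed
qed simp

end

sublocale forced_exponential \<subseteq> exp: compactly_generated h "exponential D E" steps
  by unfold_locales
    (rule exp_dcpo exp_bounded_complete steps_compact steps_cong steps_dense; assumption?)+

section \<open>Decidability\<close>

context forced_exponential
begin

lemma step_basis_eq: "step_basis D E = exp.generated"
  by (simp add: fun_eq_iff step_basis_def step_family_def exp.generated_def
      exp.generator_family_def steps_def)

section \<open>The least function and decidable comparisons\<close>

lemma E_least: "q \<tturnstile> (\<^bold>\<exists>e. is_least E e)"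
  using forces_if_le[OF E_pointed, of q] by (simp only: pointed_def)

text \<open>The least function is the pointwise supremum of the empty family.\<close>

lemma exp_pointed: "q \<tturnstile> pointed fn_space"
proof -
  have vals: "vals (\<lambda>_. bot) x = (\<lambda>_. bot)" for x :: 'a
    by (simp add: vals_def fun_eq_iff)
  have "q \<tturnstile> is_subset (eq fn_space) (\<lambda>_. bot)"
    by (rule exp.is_subsetI) (blast intro: forces_botE)+
  moreover have "r \<tturnstile> (\<^bold>\<exists>y. is_sup E (vals (\<lambda>_. bot) x) y)" for r and x :: 'a
    unfolding vals
    by (rule forces_exE[OF E_least]) (blast intro: forces_exI dest: E.is_least_iff_sup_empty[THEN iffD1])
  ultimately have "q \<tturnstile> is_sup fn_space (\<lambda>_. bot) (pointwise_sup (\<lambda>_. bot))"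
    by (rule pointwise_sup_is_sup)
  then have "q \<tturnstile> is_least fn_space (pointwise_sup (\<lambda>_. bot))"
    by (rule exp.is_least_iff_sup_empty[THEN iffD2])
  then show ?thesis
    unfolding pointed_def by (rule forces_exI[of _ "is_least fn_space"])
qed

text \<open>The value at \<open>a\<close> of the least function is the least element of
  \<open>E\<close>, so this is \<open>step_le_iff\<close> at that function.\<close>

lemma step_le_least_iff:
  assumes a: "q \<tturnstile> is_compact D a" and b: "q \<tturnstile> b \<^bold>\<in> E"
    and z: "q \<tturnstile> is_least fn_space z" and e: "q \<tturnstile> is_least E e"
  shows "q \<tturnstile> step D E a b \<sqsubseteq>\<^bsub>fn_space\<^esub> z \<longleftrightarrow> q \<tturnstile> b \<sqsubseteq>\<^bsub>E\<^esub> e"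
proof
  note e' = E.is_least_mem[OF e] and a' = D.compact_mem[OF a]
  have cont: "q \<tturnstile> continuous (step D E a e)"
    using a e' by (rule step_continuous)
  assume le: "q \<tturnstile> step D E a b \<sqsubseteq>\<^bsub>fn_space\<^esub> z"
  \<comment> \<open>Instead of computing the value of \<open>z\<close>, it is bounded by
    \<open>step D E a e\<close>, a continuous function whose value at \<open>a\<close> is below
    \<open>e\<close>.\<close>
  have "q \<tturnstile> z \<sqsubseteq>\<^bsub>fn_space\<^esub> step D E a e"
    using z cont unfolding exp_mem_iff[symmetric] by (rule exp.is_least_le)
  with le have le': "q \<tturnstile> step D E a b \<sqsubseteq>\<^bsub>fn_space\<^esub> step D E a e"
    by (rule exp.le_trans)
  from step_total[OF e' a'] show "q \<tturnstile> b \<sqsubseteq>\<^bsub>E\<^esub> e"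
  proof (rule forces_exE)
    fix r y assume r: "r \<le> q" and y: "r \<tturnstile> step D E a e a y"
    note e' = forces_mono[OF r e']
    have "r \<tturnstile> b \<sqsubseteq>\<^bsub>E\<^esub> y"
      using forces_mono[OF r le'] step_le_iff[OF forces_mono[OF r a] forces_mono[OF r b]
          forces_mono[OF r cont] y] by blast
    moreover have "r \<tturnstile> y \<sqsubseteq>\<^bsub>E\<^esub> e"
      using y e' by (rule step_least) (rule forces_mono[OF _ E.le_refl[OF e']])
    ultimately show "r \<tturnstile> b \<sqsubseteq>\<^bsub>E\<^esub> e"
      by (rule E.le_trans)
  qed
next
  assume le: "q \<tturnstile> b \<sqsubseteq>\<^bsub>E\<^esub> e"
  have cont: "q \<tturnstile> continuous z"
    using exp.is_least_mem[OF z] by (simp only: exp_mem_iff)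
  from cont_total[OF cont D.compact_mem[OF a]] show "q \<tturnstile> step D E a b \<sqsubseteq>\<^bsub>fn_space\<^esub> z"
  proof (rule forces_exE)
    fix r y assume r: "r \<le> q" and y: "r \<tturnstile> z a y"
    note cont = forces_mono[OF r cont]
    have "r \<tturnstile> b \<sqsubseteq>\<^bsub>E\<^esub> y"
      using forces_mono[OF r le] E.is_least_le[OF forces_mono[OF r e] cont_memR[OF cont y]]
      by (rule E.le_trans)
    then show "r \<tturnstile> step D E a b \<sqsubseteq>\<^bsub>fn_space\<^esub> z"
      using step_le_iff[OF forces_mono[OF r a] forces_mono[OF r b] cont y] by blast
  qed
qed

text \<open>\<open>g\<close> is an arbitrary function because comparisons both with the least
  function and with elements of \<open>B\<close> are needed. The supremum splits into finitely many
  comparisons, and each listed \<open>s\<close> is a step function only locally, where its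
  comparison is decided.\<close>

lemma decidable_generated_le:
  assumes f: "q \<tturnstile> exp.generated f" and g: "q \<tturnstile> g \<^bold>\<in> fn_space"
    and dec: "\<And>r a b. r \<le> q \<Longrightarrow> r \<tturnstile> is_compact D a \<Longrightarrow> r \<tturnstile> is_compact E b
      \<Longrightarrow> r \<tturnstile> decidable (step D E a b \<sqsubseteq>\<^bsub>fn_space\<^esub> g)"
  shows "q \<tturnstile> decidable (f \<sqsubseteq>\<^bsub>fn_space\<^esub> g)"
  using f
proof (rule exp.generatedE)
  fix r S X assume r: "r \<le> q" and sup: "r \<tturnstile> is_sup fn_space S f" and X: "exp.enumerates r X S"
    and steps: "\<And>s. s \<in> X \<Longrightarrow> r \<tturnstile> steps s"
  have "r \<tturnstile> decidable (s \<sqsubseteq>\<^bsub>fn_space\<^esub> g)" if "s \<in> X" for s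
    using steps[OF that]
  proof (rule stepsE)
    fix t a b assume t: "t \<le> r" and ab: "t \<tturnstile> is_compact D a" "t \<tturnstile> is_compact E b"
      and s: "t \<tturnstile> s \<doteq>\<^bsub>fn_space\<^esub> step D E a b"
    have "v \<tturnstile> step D E a b \<sqsubseteq>\<^bsub>fn_space\<^esub> g \<longleftrightarrow> v \<tturnstile> s \<sqsubseteq>\<^bsub>fn_space\<^esub> g" if v: "v \<le> t" for v
      using forces_mono[OF v s] by (blast intro: exp.le_trans exp.eq_le exp.eq_ge)
    then show "t \<tturnstile> decidable (s \<sqsubseteq>\<^bsub>fn_space\<^esub> g)"
      using dec[OF order_trans[OF t r] ab] by (rule forces_decidable_cong)
  qed
  then have "r \<tturnstile> decidable (INF s\<in>X. s \<sqsubseteq>\<^bsub>fn_space\<^esub> g)"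
    by (rule forces_decidable_INF[OF exp.enumerates_finite[OF X]])
  moreover have "t \<tturnstile> (INF s\<in>X. s \<sqsubseteq>\<^bsub>fn_space\<^esub> g) \<longleftrightarrow> t \<tturnstile> f \<sqsubseteq>\<^bsub>fn_space\<^esub> g" if t: "t \<le> r" for t
    using exp.enumerated_sup_le_iff[OF exp.enumerates_mono[OF t X] forces_mono[OF t sup]
        forces_mono[OF order_trans[OF t r] g]] by blast
  ultimately show "r \<tturnstile> decidable (f \<sqsubseteq>\<^bsub>fn_space\<^esub> g)"
    by (rule forces_decidable_cong[rotated])
qed

text \<open>Being least is a comparison with the least function; for a step function this comparison
  amounts to \<open>b\<close> being least in \<open>E\<close>, which the hypothesis decides.\<close>

lemma decidable_eq_bot:
  assumes dec: "q \<tturnstile> (\<^bold>\<forall>b. is_compact E b \<^bold>\<longrightarrow> decidable (eq_bot E b))"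
    and f: "q \<tturnstile> exp.generated f"
  shows "q \<tturnstile> decidable (eq_bot fn_space f)"
  using exp_pointed[of q] unfolding pointed_def
proof (rule forces_exE)
  fix r z assume r: "r \<le> q" and z: "r \<tturnstile> is_least fn_space z"
  from E_least show "r \<tturnstile> decidable (eq_bot fn_space f)"
  proof (rule forces_exE)
    fix t e assume t: "t \<le> r" and e: "t \<tturnstile> is_least E e"
    note z = forces_mono[OF t z] and f = forces_mono[OF order_trans[OF t r] f]
      and dec = forces_mono[OF order_trans[OF t r] dec]
    have "t \<tturnstile> decidable (f \<sqsubseteq>\<^bsub>fn_space\<^esub> z)"
      using f exp.is_least_mem[OF z]
    proof (rule decidable_generated_le)
      fix v a b assume v: "v \<le> t" and a: "v \<tturnstile> is_compact D a" and b: "v \<tturnstile> is_compact E b"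
      have b': "v \<tturnstile> b \<^bold>\<in> E"
        using b by (rule E.compact_mem)
      have "k \<tturnstile> eq_bot E b \<longleftrightarrow> k \<tturnstile> step D E a b \<sqsubseteq>\<^bsub>fn_space\<^esub> z" if k: "k \<le> v" for k
        using E.eq_bot_iff[OF forces_mono[OF order_trans[OF k v] e] forces_mono[OF k b']]
          step_le_least_iff[OF forces_mono[OF k a] forces_mono[OF k b']
            forces_mono[OF order_trans[OF k v] z] forces_mono[OF order_trans[OF k v] e]] by blast
      moreover have "v \<tturnstile> decidable (eq_bot E b)"
        using forces_mono[OF v dec] b unfolding forces_simps by blast
      ultimately show "v \<tturnstile> decidable (step D E a b \<sqsubseteq>\<^bsub>fn_space\<^esub> z)"
        by (rule forces_decidable_cong)
    qed
    moreover have "v \<tturnstile> f \<sqsubseteq>\<^bsub>fn_space\<^esub> z \<longleftrightarrow> v \<tturnstile> eq_bot fn_space f" if v: "v \<le> t" for v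
      using exp.eq_bot_iff[OF forces_mono[OF v z]
          exp.compact_mem[OF exp.generated_compact[OF forces_mono[OF v f]]]] by blast
    ultimately show "t \<tturnstile> decidable (eq_bot fn_space f)"
      by (rule forces_decidable_cong[rotated])
  qed
qed

text \<open>Deciding \<open>a' \<sqsubseteq> a\<close> turns the set with supremum \<open>y\<close>
  into a singleton or the empty set, and both suprema are compact.\<close>

lemma step_value_compact:
  assumes dec: "q \<tturnstile> decidable (a' \<sqsubseteq>\<^bsub>D\<^esub> a)" and b: "q \<tturnstile> is_compact E b"
    and y: "q \<tturnstile> step D E a' b a y"
  shows "q \<tturnstile> is_compact E y"
  using dec
proof (rule forces_decidableE)
  fix r assume r: "r \<le> q"
  note b = forces_mono[OF r b] and y = forces_mono[OF r y]
  note b' = E.compact_mem[OF b]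
  {
    assume "r \<tturnstile> a' \<sqsubseteq>\<^bsub>D\<^esub> a"
    with y b' have "r \<tturnstile> b \<sqsubseteq>\<^bsub>E\<^esub> y"
      by (rule step_upper)
    moreover have "r \<tturnstile> y \<sqsubseteq>\<^bsub>E\<^esub> b"
      using y b' by (rule step_least) (rule forces_mono[OF _ E.le_refl[OF b']])
    ultimately show "r \<tturnstile> is_compact E y"
      using b by (blast intro: E.compact_cong E.le_antisym)
  next
    assume neg: "r \<tturnstile> (\<^bold>\<not> (a' \<sqsubseteq>\<^bsub>D\<^esub> a))"
    \<comment> \<open>A stage below \<open>r\<close> at which \<open>a' \<sqsubseteq> a\<close>
      holds forces \<open>bot\<close>, so \<open>b\<close> imposes no constraint and
      \<open>y\<close> is below every element.\<close>
    have "r \<tturnstile> is_least E y"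
      unfolding is_least_def forces_simps
    proof (intro conjI ballI allI impI)
      show "r \<tturnstile> y \<^bold>\<in> E"
        using y by (rule step_memR)
      fix x t assume t: "t \<le> r" and "t \<tturnstile> x \<^bold>\<in> E"
      then show "t \<tturnstile> y \<sqsubseteq>\<^bsub>E\<^esub> x"
        using neg unfolding forces_simps
        by (intro step_least[OF forces_mono[OF t y]]) (blast intro: forces_botE order_trans)+
    qed
    then show "r \<tturnstile> is_compact E y"
      by (rule E.is_least_compact)
  }
qed

text \<open>
  The value at \<open>a\<close> is the supremum of the values at \<open>a\<close> of the finitely many step functions,
  each of which is \<open>b\<close> or \<open>\<bottom>\<close> once the comparison of the compact elements is decided.
\<close>

lemma generated_value_compact:
  assumes dec: "q \<tturnstile> (\<^bold>\<forall>a b. is_compact D a \<^bold>\<and> is_compact D b \<^bold>\<longrightarrow> decidable (a \<sqsubseteq>\<^bsub>D\<^esub> b))"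
    and g: "q \<tturnstile> exp.generated g" and a: "q \<tturnstile> is_compact D a" and y: "q \<tturnstile> g a y"
  shows "q \<tturnstile> is_compact E y"
  using g
proof (rule exp.generatedE)
  fix r S X assume r: "r \<le> q" and fam: "r \<tturnstile> exp.generator_family S"
    and sup: "r \<tturnstile> is_sup fn_space S g" and X: "exp.enumerates r X S"
    and steps: "\<And>s. s \<in> X \<Longrightarrow> r \<tturnstile> steps s"
  note dec = forces_mono[OF r dec] and a = forces_mono[OF r a] and y = forces_mono[OF r y]
  have S: "r \<tturnstile> is_subset (eq fn_space) S" "r \<tturnstile> is_bounded fn_space S"
    using fam by (simp_all add: exp.generator_family_def)
  have sup: "r \<tturnstile> is_sup E (vals S a) y"
    using S(1) bounded_vals_sup[OF S] sup y by (rule sup_vals)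
  have "r \<tturnstile> (\<^bold>\<exists>w. s a w)" if "s \<in> X" for s
    using subset_cont[OF S(1) exp.enumerates_member[OF X that]] D.compact_mem[OF a]
    by (rule cont_total)
  \<comment> \<open>Finite choice picks a value at \<open>a\<close> for each listed function; these
    values enumerate \<open>vals S a\<close>.\<close>
  with exp.enumerates_finite[OF X] show "r \<tturnstile> is_compact E y"
  proof (rule forces_finite_choice)
    fix t f assume t: "t \<le> r" and f: "\<And>s. s \<in> X \<Longrightarrow> t \<tturnstile> s a (f s)"
    note Xt = exp.enumerates_mono[OF t X] and St = forces_mono[OF t S(1)]
    have "E.enumerates t (f ` X) (vals S a)"
      unfolding E.enumerates_def
    proof (intro conjI ballI allI impI)
      show "finite (f ` X)"
        using exp.enumerates_finite[OF X] by simp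
      show "t \<tturnstile> vals S a w" if "w \<in> f ` X" for w
      proof -
        from that obtain s where "s \<in> X" "w = f s"
          by blast
        then show ?thesis
          using valsI[of t S s, OF exp.enumerates_member[OF Xt]] f by simp
      qed
      fix v w assume v: "v \<le> t" and "v \<tturnstile> vals S a w"
      from this(2) show "v \<tturnstile> (SUP x\<in>f ` X. x \<doteq>\<^bsub>E\<^esub> w)"
      proof (rule valsE)
        fix k s assume k: "k \<le> v" and s: "k \<tturnstile> S s" "k \<tturnstile> s a w"
        have kt: "k \<le> t"
          using k v by simp
        from exp.enumerates_mono[OF kt Xt] s(1) show "k \<tturnstile> (SUP x\<in>f ` X. x \<doteq>\<^bsub>E\<^esub> w)"
        proof (rule exp.enumeratesE)
          fix l s' assume l: "l \<le> k" and s': "s' \<in> X" and eq: "l \<tturnstile> s' \<doteq>\<^bsub>fn_space\<^esub> s"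
          have lt: "l \<le> t"
            using l kt by simp
          have "l \<tturnstile> f s' \<doteq>\<^bsub>E\<^esub> w"
            using subset_cont[OF forces_mono[OF lt St] forces_mono[OF l s(1)]]
              exp_eqD[OF eq forces_mono[OF lt f[OF s']]] forces_mono[OF l s(2)]
            by (rule cont_unique)
          then show "l \<tturnstile> (SUP x\<in>f ` X. x \<doteq>\<^bsub>E\<^esub> w)"
            by (rule forces_bexI) (use s' in simp)
        qed
      qed
    qed
    then show "t \<tturnstile> is_compact E y"
      using forces_mono[OF t sup]
    proof (rule E.enumerated_sup_compact)
      fix w assume "w \<in> f ` X"
      then obtain s where s: "s \<in> X" and w: "w = f s"
        by blast
      from forces_mono[OF t steps[OF s]] show "t \<tturnstile> is_compact E w"
      proof (rule stepsE)
        fix v a' b assume v: "v \<le> t" and a': "v \<tturnstile> is_compact D a'" and b: "v \<tturnstile> is_compact E b"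
          and eq: "v \<tturnstile> s \<doteq>\<^bsub>fn_space\<^esub> step D E a' b"
        have vr: "v \<le> r"
          using v t by simp
        have "v \<tturnstile> decidable (a' \<sqsubseteq>\<^bsub>D\<^esub> a)"
          using forces_mono[OF vr dec] a' forces_mono[OF vr a] unfolding forces_simps by blast
        moreover have "v \<tturnstile> step D E a' b a w"
          using exp_eqD[OF eq] forces_mono[OF v f[OF s]] by (simp add: w)
        ultimately show "v \<tturnstile> is_compact E w"
          using b by (blast intro: step_value_compact)
      qed
    qed
  qed
qed

text \<open>The value of \<open>g\<close> at \<open>a\<close> exists only locally, so the comparison
  with \<open>b\<close> is decided there and the decision carried back.\<close>

lemma decidable_le:
  assumes decD: "q \<tturnstile> (\<^bold>\<forall>a b. is_compact D a \<^bold>\<and> is_compact D b \<^bold>\<longrightarrow> decidable (a \<sqsubseteq>\<^bsub>D\<^esub> b))"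
    and decE: "q \<tturnstile> (\<^bold>\<forall>a b. is_compact E a \<^bold>\<and> is_compact E b \<^bold>\<longrightarrow> decidable (a \<sqsubseteq>\<^bsub>E\<^esub> b))"
    and f: "q \<tturnstile> exp.generated f" and g: "q \<tturnstile> exp.generated g"
  shows "q \<tturnstile> decidable (f \<sqsubseteq>\<^bsub>fn_space\<^esub> g)"
proof -
  have g': "q \<tturnstile> g \<^bold>\<in> fn_space"
    using g by (blast intro: exp.compact_mem exp.generated_compact)
  with f show ?thesis
  proof (rule decidable_generated_le)
    fix r a b assume r: "r \<le> q" and a: "r \<tturnstile> is_compact D a" and b: "r \<tturnstile> is_compact E b"
    have cont: "r \<tturnstile> continuous g"
      using forces_mono[OF r g'] by (simp only: exp_mem_iff)
    from cont_total[OF cont D.compact_mem[OF a]]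
    show "r \<tturnstile> decidable (step D E a b \<sqsubseteq>\<^bsub>fn_space\<^esub> g)"
    proof (rule forces_exE)
      fix t y assume t: "t \<le> r" and y: "t \<tturnstile> g a y"
      have tq: "t \<le> q"
        using t r by simp
      note a = forces_mono[OF t a] and b = forces_mono[OF t b] and cont = forces_mono[OF t cont]
      have "t \<tturnstile> is_compact E y"
        using forces_mono[OF tq decD] forces_mono[OF tq g] a y by (rule generated_value_compact)
      then have "t \<tturnstile> decidable (b \<sqsubseteq>\<^bsub>E\<^esub> y)"
        using forces_mono[OF tq decE] b unfolding forces_simps by blast
      moreover have "v \<tturnstile> b \<sqsubseteq>\<^bsub>E\<^esub> y \<longleftrightarrow> v \<tturnstile> step D E a b \<sqsubseteq>\<^bsub>fn_space\<^esub> g" if v: "v \<le> t" for v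
        using step_le_iff[OF forces_mono[OF v a] E.compact_mem[OF forces_mono[OF v b]]
            forces_mono[OF v cont] forces_mono[OF v y]] by blast
      ultimately show "t \<tturnstile> decidable (step D E a b \<sqsubseteq>\<^bsub>fn_space\<^esub> g)"
        by (rule forces_decidable_cong[rotated])
    qed
  qed
qed

text \<open>Since \<open>f\<close> is compact, way-below and the order agree to its right at every
  stage.\<close>

lemma decidable_way_below:
  assumes f: "q \<tturnstile> exp.generated f" and dec: "q \<tturnstile> decidable (f \<sqsubseteq>\<^bsub>fn_space\<^esub> g)"
  shows "q \<tturnstile> decidable (way_below fn_space f g)"
  using dec
proof (rule forces_decidable_cong[rotated])
  fix r assume "r \<le> q"
  from exp.generated_compact[OF forces_mono[OF this f]]
  show "r \<tturnstile> f \<sqsubseteq>\<^bsub>fn_space\<^esub> g \<longleftrightarrow> r \<tturnstile> way_below fn_space f g"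
    by (rule exp.compact_way_below_iff[symmetric])
qed

section \<open>The results as internal statements\<close>

text \<open>\<open>step_basis\<close> speaks of elements that are suprema of families; this
  guarantees that every admissible family has one.\<close>

lemma step_family_sup: "q \<tturnstile> (\<^bold>\<forall>S. step_family D E S \<^bold>\<longrightarrow> (\<^bold>\<exists>f. is_sup fn_space S f))"
proof -
  have "step_family D E = exp.generator_family"
    by (simp add: fun_eq_iff step_family_def exp.generator_family_def steps_def)
  then show ?thesis
    unfolding forces_simps by (auto intro: exp.family_sup)
qed

lemma step_basis_iff_compact: "q \<tturnstile> (\<^bold>\<forall>f. step_basis D E f \<^bold>\<longleftrightarrow> is_compact fn_space f)"
  unfolding step_basis_eq forces_simps exp.generated_iff_compact by blast

lemma step_basis_eq_bot_decidable:
  "q \<tturnstile> ((\<^bold>\<forall>b. is_compact E b \<^bold>\<longrightarrow> decidable (eq_bot E b)) \<^bold>\<longrightarrow>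
    (\<^bold>\<forall>f. step_basis D E f \<^bold>\<longrightarrow> decidable (eq_bot fn_space f)))"
  unfolding step_basis_eq forces_imp[of q]
proof (intro allI impI)
  fix r assume dec: "r \<tturnstile> (\<^bold>\<forall>b. is_compact E b \<^bold>\<longrightarrow> decidable (eq_bot E b))"
  show "r \<tturnstile> (\<^bold>\<forall>f. exp.generated f \<^bold>\<longrightarrow> decidable (eq_bot fn_space f))"
    unfolding forces_all forces_imp using decidable_eq_bot[OF forces_mono[OF _ dec]] by blast
qed

lemma decidable_le_equiv_way_below:
  "q \<tturnstile> (((\<^bold>\<forall>a b. is_compact D a \<^bold>\<and> is_compact D b \<^bold>\<longrightarrow> decidable (a \<sqsubseteq>\<^bsub>D\<^esub> b)) \<^bold>\<and>
       (\<^bold>\<forall>a b. is_compact E a \<^bold>\<and> is_compact E b \<^bold>\<longrightarrow> decidable (a \<sqsubseteq>\<^bsub>E\<^esub> b)))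
      \<^bold>\<longleftrightarrow>
      ((\<^bold>\<forall>a b. is_compact D a \<^bold>\<and> is_compact D b \<^bold>\<longrightarrow> decidable (way_below D a b)) \<^bold>\<and>
       (\<^bold>\<forall>a b. is_compact E a \<^bold>\<and> is_compact E b \<^bold>\<longrightarrow> decidable (way_below E a b))))"
  by (simp only: forces_conj forces_imp[of q] D.decidable_way_below_iff
      E.decidable_way_below_iff simp_thms)

lemma step_basis_le_decidable:
  "q \<tturnstile> ((\<^bold>\<forall>a b. is_compact D a \<^bold>\<and> is_compact D b \<^bold>\<longrightarrow> decidable (a \<sqsubseteq>\<^bsub>D\<^esub> b)) \<^bold>\<and>
      (\<^bold>\<forall>a b. is_compact E a \<^bold>\<and> is_compact E b \<^bold>\<longrightarrow> decidable (a \<sqsubseteq>\<^bsub>E\<^esub> b))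
      \<^bold>\<longrightarrow>
      (\<^bold>\<forall>f g. step_basis D E f \<^bold>\<and> step_basis D E g \<^bold>\<longrightarrow> decidable (f \<sqsubseteq>\<^bsub>fn_space\<^esub> g)) \<^bold>\<and>
      (\<^bold>\<forall>f g. step_basis D E f \<^bold>\<and> step_basis D E g \<^bold>\<longrightarrow> decidable (way_below fn_space f g)))"
  unfolding step_basis_eq forces_imp[of q] forces_conj
proof (intro allI impI; elim conjE)
  fix r
  assume decD: "r \<tturnstile> (\<^bold>\<forall>a b. is_compact D a \<^bold>\<and> is_compact D b \<^bold>\<longrightarrow> decidable (a \<sqsubseteq>\<^bsub>D\<^esub> b))"
    and decE: "r \<tturnstile> (\<^bold>\<forall>a b. is_compact E a \<^bold>\<and> is_compact E b \<^bold>\<longrightarrow> decidable (a \<sqsubseteq>\<^bsub>E\<^esub> b))"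
  have le: "t \<tturnstile> decidable (f \<sqsubseteq>\<^bsub>fn_space\<^esub> g)"
    if "t \<le> r" "t \<tturnstile> exp.generated f" "t \<tturnstile> exp.generated g" for t f g
    using forces_mono[OF that(1) decD] forces_mono[OF that(1) decE] that(2,3)
    by (rule decidable_le)
  then show "r \<tturnstile> (\<^bold>\<forall>f g. exp.generated f \<^bold>\<and> exp.generated g \<^bold>\<longrightarrow>
        decidable (f \<sqsubseteq>\<^bsub>fn_space\<^esub> g)) \<and>
      r \<tturnstile> (\<^bold>\<forall>f g. exp.generated f \<^bold>\<and> exp.generated g \<^bold>\<longrightarrow>
        decidable (way_below fn_space f g))"
    unfolding forces_simps using decidable_way_below by blast
qed

end

text \<open>The conjuncts on existing suprema and on a least element give \<open>step_basis\<close>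
  and \<open>eq_bot\<close> their meaning in the exponential. The equivalence of the two forms of
  decidability lets the last conjunct be read with either.\<close>

theorem proposition2p31:
  fixes D :: "('a, 'h::complete_heyting_algebra) hposet"
    and E :: "('b, 'h) hposet"
  shows "valid (
    inhabited D \<^bold>\<and> algebraic_dcpo D \<^bold>\<and>
    pointed E \<^bold>\<and> bounded_complete E \<^bold>\<and> algebraic_dcpo E
    \<^bold>\<longrightarrow>
      (\<^bold>\<forall>S. step_family D E S \<^bold>\<longrightarrow> (\<^bold>\<exists>f. is_sup (exponential D E) S f)) \<^bold>\<and>
      pointed (exponential D E) \<^bold>\<and>
      algebraic_dcpo (exponential D E) \<^bold>\<and>
      (\<^bold>\<forall>f. step_basis D E f \<^bold>\<longleftrightarrow> is_compact (exponential D E) f) \<^bold>\<and>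
      ((\<^bold>\<forall>b. is_compact E b \<^bold>\<longrightarrow> decidable (eq_bot E b)) \<^bold>\<longrightarrow>
         (\<^bold>\<forall>f. step_basis D E f \<^bold>\<longrightarrow> decidable (eq_bot (exponential D E) f))) \<^bold>\<and>
      (((\<^bold>\<forall>a b. is_compact D a \<^bold>\<and> is_compact D b \<^bold>\<longrightarrow> decidable (a \<sqsubseteq>\<^bsub>D\<^esub> b)) \<^bold>\<and>
        (\<^bold>\<forall>a b. is_compact E a \<^bold>\<and> is_compact E b \<^bold>\<longrightarrow> decidable (a \<sqsubseteq>\<^bsub>E\<^esub> b)))
       \<^bold>\<longleftrightarrow>
       ((\<^bold>\<forall>a b. is_compact D a \<^bold>\<and> is_compact D b \<^bold>\<longrightarrow> decidable (way_below D a b)) \<^bold>\<and>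
        (\<^bold>\<forall>a b. is_compact E a \<^bold>\<and> is_compact E b \<^bold>\<longrightarrow> decidable (way_below E a b)))) \<^bold>\<and>
      ((\<^bold>\<forall>a b. is_compact D a \<^bold>\<and> is_compact D b \<^bold>\<longrightarrow> decidable (a \<sqsubseteq>\<^bsub>D\<^esub> b)) \<^bold>\<and>
       (\<^bold>\<forall>a b. is_compact E a \<^bold>\<and> is_compact E b \<^bold>\<longrightarrow> decidable (a \<sqsubseteq>\<^bsub>E\<^esub> b))
       \<^bold>\<longrightarrow>
       (\<^bold>\<forall>f g. step_basis D E f \<^bold>\<and> step_basis D E g \<^bold>\<longrightarrow>
          decidable (f \<sqsubseteq>\<^bsub>exponential D E\<^esub> g)) \<^bold>\<and>
       (\<^bold>\<forall>f g. step_basis D E f \<^bold>\<and> step_basis D E g \<^bold>\<longrightarrow>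
          decidable (way_below (exponential D E) f g))))"
proof -
  let ?h = "inhabited D \<^bold>\<and> algebraic_dcpo D \<^bold>\<and>
    pointed E \<^bold>\<and> bounded_complete E \<^bold>\<and> algebraic_dcpo E"
  have D: "?h \<le> algebraic_dcpo D" and E: "?h \<le> algebraic_dcpo E"
    and rest: "?h \<le> pointed E" "?h \<le> bounded_complete E"
    by (blast intro: le_infI1 le_infI2 order_refl)+
  have "algebraic_dcpo D \<le> poset D" "algebraic_dcpo E \<le> poset E"
    by (simp_all add: algebraic_dcpo_def dcpo_def le_infI1)
  \<comment> \<open>With the antecedent itself as the parameter \<open>h\<close>, the internal
    implication is forcing of the conclusion at stage \<open>top\<close>.\<close>
  with D E rest interpret forced_exponential ?h D E
    by unfold_locales (auto intro: order_trans)
  show ?thesis (is "valid (_ \<^bold>\<longrightarrow> ?conclusion)")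
  proof -
    have "forces top ?conclusion"
      unfolding forces_conj
      using step_family_sup exp_pointed exp.algebraic step_basis_iff_compact
        step_basis_eq_bot_decidable decidable_le_equiv_way_below[unfolded forces_conj]
        step_basis_le_decidable
      by (intro conjI) (assumption | blast)+
    then have "?h \<le> ?conclusion"
      by (simp only: forces_def inf_top_right)
    then show ?thesis
      unfolding valid_def by (intro top_le) (simp only: le_Imp_iff inf_top_left)
  qed
qed

end
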